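(* Let $(\mathfrak W_1,\mathfrak V_1)$ and $(\mathfrak W_2,\mathfrak V_2)$ be AVWCs. 1. If $C_{\mathrm S}(\mathfrak W_1,\mathfrak V_1)=C_{\mathrm S}(\mathfrak W_2,\mathfrak V_2)=0$, then $C_{\mathrm S}(\mathfrak W_1\otimes\mathfrak W_2,\mathfrak V_1\otimes\mathfrak V_2)>0$ holds if and only if $\mathfrak W_1\otimes\mathfrak W_2$ is not symmetrizable and $C^{\mathrm{mean}}_{\mathrm{S,ran}}(\mathfrak W_1\otimes\mathfrak W_2,\mathfrak V_1\otimes\mathfrak V_2)>0$. If $C_{\mathrm S}$ shows super-activation for these two AVWCs, then $C_{\mathrm S}(\mathfrak W_1\otimes\mathfrak W_2,\mathfrak V_1\otimes\mathfrak V_2)=C^{\mathrm{mean}}_{\mathrm{S,ran}}(\mathfrak W_1\otimes\mathfrak W_2,\mathfrak V_1\otimes\mathfrak V_2)$. 2. There exist AVWCs for which $C_{\mathrm S}$ shows super-activation. 3. If $C^{\mathrm{mean}}_{\mathrm{S,ran}}$ shows super-activation for $(\mathfrak W_1,\mathfrak V_1)$ and $(\mathfrak W_2,\mathfrak V_2)$, then $C_{\mathrm S}$ shows super-activation for them if and only if at least one of $\mathfrak W_1,\mathfrak W_2$ is non-symmetrizable. 4. If $C^{\mathrm{mean}}_{\mathrm{S,ran}}$ shows no super-activation for $(\mathfrak W_1,\mathfrak V_1)$ and $(\mathfrak W_2,\mathfrak V_2)$, then super-activation of $C_{\mathrm S}$ can only happen if (up to swapping the labels 1 and 2) $\mathfrak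 W_1$ is non-symmetrizable, $\mathfrak W_2$ is symmetrizable, $C^{\mathrm{mean}}_{\mathrm{S,ran}}(\mathfrak W_1,\mathfrak V_1)=0$ and $C^{\mathrm{mean}}_{\mathrm{S,ran}}(\mathfrak W_2,\mathfrak V_2)>0$.
   Context: All alphabets are finite; logs base 2; $C(\mathcal A,\mathcal B)$ denotes channels. An AVWC $(\mathfrak W,\mathfrak V)$: channels $W_s\in C(\mathcal X,\mathcal Y)$ (to Bob), $V_s\in C(\mathcal X,\mathcal Z)$ (to Eve), $s$ in a finite state set $\mathcal S$; $W_{s^n}=W_{s_1}\otimes\cdots\otimes W_{s_n}$, $V_{s^n}$ likewise. $\mathfrak W=(W_s)_s$ is symmetrizable if there is $U\in C(\mathcal X,\mathcal S)$ with $\sum_su(s|x)w_s(y|x')=\sum_su(s|x')w_s(y|x)$ for all $x,x',y$. Joint use: taking (without loss of generality) a common state set $\mathcal S$, $(\mathfrak W_1\otimes\mathfrak W_2,\mathfrak V_1\otimes\mathfrak V_2)$ is the AVWC with input $\mathcal X_1\times\mathcal X_2$, outputs $\mathcal Y_1\times\mathcal Y_2$ and $\mathcal Z_1\times\mathcal Z_2$, state set $\mathcal S\times\mathcal S$, and channels $W_{1,s}\otimes W_{2,s'}$, $V_{1,s}\otimes V_{2,s'}$. A common randomness assisted code of blocklength $n$: $K,\Gamma\in\mathbb N$, stochastic encoders $e^\gamma\in C([K],\mathcal X^n)$, sets $D^\gamma_k\subset\mathcal Y^n$ disjoint in $k$; error $1-\min_{s^n}\frac1{K\Gamma}\sum_{k,\gamma}\sum_{x^n}e^\gamma(x^n|k)w_{s^n}(D^\gamma_k|x^n)$;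 $\mathfrak K$ uniform on $[K]$, independent $\mathfrak\Gamma$ uniform on $[\Gamma]$, Eve's output $\mathfrak Z_{s^n}\sim V_{s^n}(\cdot|x^n)$ with $x^n\sim e^\gamma(\cdot|k)$. $C_{\mathrm S}$ is the supremum of $R$ achievable with $\Gamma_n=1$, error $\to0$, $\liminf\frac1n\log K_n=R$ and $\limsup_n\max_{s^n}I(\mathfrak K_n;\mathfrak Z_{s^n})=0$; $C^{\mathrm{mean}}_{\mathrm{S,ran}}$ is the same with arbitrary $\Gamma_n$ and secrecy condition $\limsup_n\max_{s^n}I(\mathfrak K_n;\mathfrak Z_{s^n}|\mathfrak\Gamma_n)=0$. A capacity $C$ shows super-activation for two AVWCs if $C(\mathfrak W_1,\mathfrak V_1)=C(\mathfrak W_2,\mathfrak V_2)=0$ but $C(\mathfrak W_1\otimes\mathfrak W_2,\mathfrak V_1\otimes\mathfrak V_2)>0$. *)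

theory Defs
  imports "HOL-Analysis.Analysis"
begin

record ('s, 'x, 'y, 'z) avwc =
  St   :: "'s set"
  Inp  :: "'x set"
  OutB :: "'y set"
  OutE :: "'z set"
  chW  :: "'s \<Rightarrow> 'x \<Rightarrow> 'y \<Rightarrow> real"
  chV  :: "'s \<Rightarrow> 'x \<Rightarrow> 'z \<Rightarrow> real"

definition channel :: "'a set \<Rightarrow> 'b set \<Rightarrow> ('a \<Rightarrow> 'b \<Rightarrow> real) \<Rightarrow> bool" where
  "channel A B w \<longleftrightarrow> (\<forall>a\<in>A. (\<forall>b\<in>B. 0 \<le> w a b) \<and> (\<Sum>b\<in>B. w a b) = 1)"

definition is_avwc :: "('s, 'x, 'y, 'z) avwc \<Rightarrow> bool" where
  "is_avwc A \<longleftrightarrow>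
     finite (St A) \<and> St A \<noteq> {} \<and> finite (Inp A) \<and> Inp A \<noteq> {} \<and>
     finite (OutB A) \<and> OutB A \<noteq> {} \<and> finite (OutE A) \<and> OutE A \<noteq> {} \<and>
     (\<forall>s\<in>St A. channel (Inp A) (OutB A) (chW A s) \<and> channel (Inp A) (OutE A) (chV A s))"

definition symmetrizable :: "('s, 'x, 'y, 'z) avwc \<Rightarrow> bool" where
  "symmetrizable A \<longleftrightarrow>
     (\<exists>u :: 'x \<Rightarrow> 's \<Rightarrow> real. channel (Inp A) (St A) u \<and>
        (\<forall>x\<in>Inp A. \<forall>x'\<in>Inp A. \<forall>y\<in>OutB A.
           (\<Sum>s\<in>St A. u x s * chW A s x' y) = (\<Sum>s\<in>St A. u x' s * chW A s x y)))"

text \<open>Joint use of two AVWCs (state set is the product of the two state sets;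
  with a common state set S this is exactly S \<times> S).\<close>
definition joint :: "('s1, 'x1, 'y1, 'z1) avwc \<Rightarrow> ('s2, 'x2, 'y2, 'z2) avwc \<Rightarrow>
    ('s1 \<times> 's2, 'x1 \<times> 'x2, 'y1 \<times> 'y2, 'z1 \<times> 'z2) avwc" where
  "joint A1 A2 = \<lparr> St = St A1 \<times> St A2, Inp = Inp A1 \<times> Inp A2,
     OutB = OutB A1 \<times> OutB A2, OutE = OutE A1 \<times> OutE A2,
     chW = (\<lambda>(s1, s2) (x1, x2) (y1, y2). chW A1 s1 x1 y1 * chW A2 s2 x2 y2),
     chV = (\<lambda>(s1, s2) (x1, x2) (z1, z2). chV A1 s1 x1 z1 * chV A2 s2 x2 z2) \<rparr>"

definition words :: "nat \<Rightarrow> 'a set \<Rightarrow> (nat \<Rightarrow> 'a) set" where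
  "words n A = PiE {..<n} (\<lambda>_. A)"

definition prodch :: "nat \<Rightarrow> ('s \<Rightarrow> 'a \<Rightarrow> 'b \<Rightarrow> real) \<Rightarrow> (nat \<Rightarrow> 's) \<Rightarrow> (nat \<Rightarrow> 'a) \<Rightarrow> (nat \<Rightarrow> 'b) \<Rightarrow> real" where
  "prodch n w sn xn yn = (\<Prod>i<n. w (sn i) (xn i) (yn i))"

text \<open>A common randomness assisted code of blocklength n: message set {..<K},
  common randomness {..<G}, stochastic encoders e g k, decoding sets D g k.\<close>
definition is_code :: "('s, 'x, 'y, 'z) avwc \<Rightarrow> nat \<Rightarrow> nat \<Rightarrow> nat \<Rightarrow>
    (nat \<Rightarrow> nat \<Rightarrow> (nat \<Rightarrow> 'x) \<Rightarrow> real) \<Rightarrow> (nat \<Rightarrow> nat \<Rightarrow> (nat \<Rightarrow> 'y) set) \<Rightarrow> bool" where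
  "is_code A n K G e D \<longleftrightarrow> 1 \<le> K \<and> 1 \<le> G \<and>
     (\<forall>g<G. \<forall>k<K. (\<forall>xn\<in>words n (Inp A). 0 \<le> e g k xn) \<and> (\<Sum>xn\<in>words n (Inp A). e g k xn) = 1) \<and>
     (\<forall>g<G. \<forall>k<K. D g k \<subseteq> words n (OutB A)) \<and>
     (\<forall>g<G. \<forall>k<K. \<forall>k'<K. k \<noteq> k' \<longrightarrow> D g k \<inter> D g k' = {})"

definition code_err :: "('s, 'x, 'y, 'z) avwc \<Rightarrow> nat \<Rightarrow> nat \<Rightarrow> nat \<Rightarrow>
    (nat \<Rightarrow> nat \<Rightarrow> (nat \<Rightarrow> 'x) \<Rightarrow> real) \<Rightarrow> (nat \<Rightarrow> nat \<Rightarrow> (nat \<Rightarrow> 'y) set) \<Rightarrow> real" where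
  "code_err A n K G e D = 1 - Min ((\<lambda>sn. (1 / (real K * real G)) *
      (\<Sum>g<G. \<Sum>k<K. \<Sum>xn\<in>words n (Inp A). e g k xn * (\<Sum>yn\<in>D g k. prodch n (chW A) sn xn yn)))
      ` words n (St A))"

text \<open>Conditional mutual information I(K; Z_{s^n} | Gamma) (in bits), with K uniform on
  {..<K}, Gamma uniform on {..<G}, independent; convention 0 log(0/p) = 0.
  For G = 1 this is I(K; Z_{s^n}).\<close>
definition cond_mi :: "('s, 'x, 'y, 'z) avwc \<Rightarrow> nat \<Rightarrow> nat \<Rightarrow> nat \<Rightarrow>
    (nat \<Rightarrow> nat \<Rightarrow> (nat \<Rightarrow> 'x) \<Rightarrow> real) \<Rightarrow> (nat \<Rightarrow> 's) \<Rightarrow> real" where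
  "cond_mi A n K G e sn =
     (let q = (\<lambda>g k zn. \<Sum>xn\<in>words n (Inp A). e g k xn * prodch n (chV A) sn xn zn);
          p = (\<lambda>g zn. (1 / real K) * (\<Sum>k'<K. q g k' zn))
      in (1 / real G) * (\<Sum>g<G. (1 / real K) * (\<Sum>k<K. \<Sum>zn\<in>words n (OutE A).
            (if q g k zn = 0 then 0 else q g k zn * log 2 (q g k zn / p g zn)))))"

definition achievable :: "bool \<Rightarrow> ('s, 'x, 'y, 'z) avwc \<Rightarrow> real \<Rightarrow> bool" where
  "achievable nocr A R \<longleftrightarrow>
     (\<exists>(K :: nat \<Rightarrow> nat) (G :: nat \<Rightarrow> nat) (e :: nat \<Rightarrow> nat \<Rightarrow> nat \<Rightarrow> (nat \<Rightarrow> 'x) \<Rightarrow> real)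
        (D :: nat \<Rightarrow> nat \<Rightarrow> nat \<Rightarrow> (nat \<Rightarrow> 'y) set).
        (nocr \<longrightarrow> (\<forall>n. G n = 1)) \<and>
        (\<forall>n. is_code A n (K n) (G n) (e n) (D n)) \<and>
        (\<lambda>n. code_err A n (K n) (G n) (e n) (D n)) \<longlonglongrightarrow> 0 \<and>
        liminf (\<lambda>n. ereal (log 2 (real (K n)) / real n)) = ereal R \<and>
        limsup (\<lambda>n. ereal (Max ((\<lambda>sn. cond_mi A n (K n) (G n) (e n) sn) ` words n (St A)))) = 0)"

definition C_S :: "('s, 'x, 'y, 'z) avwc \<Rightarrow> ereal" where
  "C_S A = Sup (ereal ` {R. achievable True A R})"

definition C_mean_ran :: "('s, 'x, 'y, 'z) avwc \<Rightarrow> ereal" where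
  "C_mean_ran A = Sup (ereal ` {R. achievable False A R})"

definition superact_S :: "('s1, 'x1, 'y1, 'z1) avwc \<Rightarrow> ('s2, 'x2, 'y2, 'z2) avwc \<Rightarrow> bool" where
  "superact_S A1 A2 \<longleftrightarrow> C_S A1 = 0 \<and> C_S A2 = 0 \<and> C_S (joint A1 A2) > 0"

definition superact_mean :: "('s1, 'x1, 'y1, 'z1) avwc \<Rightarrow> ('s2, 'x2, 'y2, 'z2) avwc \<Rightarrow> bool" where
  "superact_mean A1 A2 \<longleftrightarrow> C_mean_ran A1 = 0 \<and> C_mean_ran A2 = 0 \<and> C_mean_ran (joint A1 A2) > 0"

end

theory Submission
  imports Defs "HOL-Real_Asymp.Real_Asymp"
begin

text \<open>Everything follows from the dichotomy \<open>C_S A = 0\<close> if \<open>A\<close> is symmetrizable and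
  \<open>C_S A = C_mean_ran A\<close> otherwise, together with the fact that a joint AVWC is symmetrizable
  if and only if both components are.  In the non-symmetrizable case the common randomness of a
  given code is first reduced to polynomially many values by random sampling (exponential moments
  control error and leakage for all state sequences at once) and is then sent in the clear by a
  prefix of sublinear length; Eve may decode the prefix, since the leakage is conditioned on
  the common randomness.  For super-activation, combine a noiseless channel that Eve also observes
  (not symmetrizable, no secrecy) with the adder \<open>y = x + s\<close> hidden from Eve (symmetrizable,
  but with a positive common randomness assisted rate).\<close>

section \<open>Words and codes with deterministic encoders\<close>

lemma finite_words [simp]: "finite A \<Longrightarrow> finite (words n A)"
  unfolding words_def by (rule finite_PiE) auto

lemma card_words: "card (words n A) = card A ^ n"
  unfolding words_def by (simp add: card_PiE)

lemma words_nth: "w \<in> words n A \<Longrightarrow> i < n \<Longrightarrow> w i \<in> A"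
  unfolding words_def by auto

lemma words_nonempty: "A \<noteq> {} \<Longrightarrow> words n A \<noteq> {}"
  unfolding words_def by (simp add: PiE_eq_empty_iff)

lemma words_Zero: "words 0 A = {\<lambda>_. undefined}"
  unfolding words_def by simp

lemma sum_words_prod:
  fixes f :: "nat \<Rightarrow> 'a \<Rightarrow> real"
  assumes "finite A"
  shows "(\<Sum>w\<in>words n A. \<Prod>i<n. f i (w i)) = (\<Prod>i<n. \<Sum>a\<in>A. f i a)"
  unfolding words_def using prod_sum_PiE[of "{..<n}" "\<lambda>_. A" f] assms by simp

definition append_word :: "nat \<Rightarrow> nat \<Rightarrow> (nat \<Rightarrow> 'a) \<Rightarrow> (nat \<Rightarrow> 'a) \<Rightarrow> nat \<Rightarrow> 'a" where
  "append_word m n a b = (\<lambda>i. if i < m then a i else if i < m + n then b (i - m) else undefined)"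

lemma append_word_mem:
  assumes "a \<in> words m A" "b \<in> words n A"
  shows "append_word m n a b \<in> words (m + n) A"
  using assms unfolding words_def append_word_def by (auto simp: PiE_iff extensional_def)

lemma bij_append_word:
  "bij_betw (\<lambda>(a, b). append_word m n a b) (words m A \<times> words n A) (words (m + n) A)"
proof (rule bij_betw_byWitness[where f' = "\<lambda>w. (restrict w {..<m}, \<lambda>i\<in>{..<n}. w (i + m))"])
  show "\<forall>p\<in>words m A \<times> words n A. (\<lambda>w. (restrict w {..<m}, \<lambda>i\<in>{..<n}. w (i + m)))
      (case p of (a, b) \<Rightarrow> append_word m n a b) = p"
    by (auto simp: words_def append_word_def PiE_iff extensional_def fun_eq_iff restrict_def)
  show "\<forall>w\<in>words (m + n) A. (case (restrict w {..<m}, \<lambda>i\<in>{..<n}. w (i + m)) of (a, b) \<Rightarrow>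
      append_word m n a b) = w"
    by (auto simp: words_def append_word_def PiE_iff extensional_def fun_eq_iff restrict_def)
  show "(\<lambda>(a, b). append_word m n a b) ` (words m A \<times> words n A) \<subseteq> words (m + n) A"
    using append_word_mem by fastforce
  show "(\<lambda>w. (restrict w {..<m}, \<lambda>i\<in>{..<n}. w (i + m))) ` words (m + n) A \<subseteq> words m A \<times> words n A"
  proof (rule image_subsetI)
    fix w assume w: "w \<in> words (m + n) A"
    have "restrict w {..<m} \<in> words m A" "(\<lambda>i\<in>{..<n}. w (i + m)) \<in> words n A"
      unfolding words_def using words_nth[OF w] by auto
    then show "(restrict w {..<m}, \<lambda>i\<in>{..<n}. w (i + m)) \<in> words m A \<times> words n A" by blast
  qed
qed

lemma append_word_inject:
  assumes "a \<in> words m A" "a' \<in> words m A" "b \<in> words n A" "b' \<in> words n A"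
    "append_word m n a b = append_word m n a' b'"
  shows "a = a' \<and> b = b'"
  using bij_append_word[of m n A] assms unfolding bij_betw_def inj_on_def by fastforce

lemma sum_words_append:
  "(\<Sum>w\<in>words (m + n) A. f w) = (\<Sum>a\<in>words m A. \<Sum>b\<in>words n A. f (append_word m n a b))"
  using sum.reindex_bij_betw[OF bij_append_word, of f m n A]
  by (simp add: sum.cartesian_product case_prod_unfold)

lemma words_append_cases:
  assumes "w \<in> words (m + n) A"
  obtains a b where "a \<in> words m A" "b \<in> words n A" "w = append_word m n a b"
proof -
  from assms have "w \<in> (\<lambda>(a, b). append_word m n a b) ` (words m A \<times> words n A)"
    using bij_append_word[of m n A] unfolding bij_betw_def by simp
  then show ?thesis using that by auto
qed

lemma prodch_append:
  "prodch (m + n) w (append_word m n s s') (append_word m n x x') (append_word m n y y')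
     = prodch m w s x y * prodch n w s' x' y'"
proof -
  have "prodch (m + n) w (append_word m n s s') (append_word m n x x') (append_word m n y y')
      = (\<Prod>i<m. w (s i) (x i) (y i)) * (\<Prod>i\<in>{m..<m+n}. w (s' (i-m)) (x' (i-m)) (y' (i-m)))"
    unfolding prodch_def append_word_def
    by (subst atLeast0LessThan[symmetric], subst prod.atLeastLessThan_concat[symmetric, of 0 m])
       (auto simp: atLeast0LessThan intro!: arg_cong2[where f = "(*)"] prod.cong)
  also have "(\<Prod>i\<in>{m..<m+n}. w (s' (i-m)) (x' (i-m)) (y' (i-m))) = (\<Prod>i<n. w (s' i) (x' i) (y' i))"
    using prod.shift_bounds_nat_ivl[of "\<lambda>i. w (s' (i-m)) (x' (i-m)) (y' (i-m))" 0 m n]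
    by (simp add: atLeast0LessThan add.commute)
  finally show ?thesis unfolding prodch_def .
qed

lemma prodch_nonneg:
  assumes "\<forall>s\<in>S. channel X Y (w s)" "s \<in> words n S" "x \<in> words n X" "y \<in> words n Y"
  shows "0 \<le> prodch n w s x y"
  unfolding prodch_def
proof (intro prod_nonneg ballI)
  fix i assume "i \<in> {..<n}"
  then have "s i \<in> S" "x i \<in> X" "y i \<in> Y" using assms(2-4) words_nth by auto
  then show "0 \<le> w (s i) (x i) (y i)" using assms(1) by (simp add: channel_def)
qed

lemma sum_prodch:
  assumes "\<forall>s\<in>S. channel X Y (w s)" "s \<in> words n S" "x \<in> words n X" "finite Y"
  shows "(\<Sum>y\<in>words n Y. prodch n w s x y) = 1"
proof -
  have "(\<Sum>y\<in>Y. w (s i) (x i) y) = 1" if "i < n" for i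
    using assms(1) words_nth[OF assms(2) that] words_nth[OF assms(3) that] by (simp add: channel_def)
  then show ?thesis unfolding prodch_def 
    using sum_words_prod[OF assms(4), of "\<lambda>i. w (s i) (x i)" n] by simp
qed

definition dprob :: "nat \<Rightarrow> ('s, 'x, 'y, 'z) avwc \<Rightarrow> (nat \<Rightarrow> 's) \<Rightarrow> (nat \<Rightarrow> 'x) \<Rightarrow> (nat \<Rightarrow> 'y) set \<Rightarrow> real"
  where "dprob n A s x D = (\<Sum>y\<in>D. prodch n (chW A) s x y)"

lemma avwc_chW: "is_avwc A \<Longrightarrow> \<forall>s\<in>St A. channel (Inp A) (OutB A) (chW A s)"
  and avwc_chV: "is_avwc A \<Longrightarrow> \<forall>s\<in>St A. channel (Inp A) (OutE A) (chV A s)"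
  and avwc_finite [simp]: "is_avwc A \<Longrightarrow> finite (St A)" "is_avwc A \<Longrightarrow> finite (Inp A)"
    "is_avwc A \<Longrightarrow> finite (OutB A)" "is_avwc A \<Longrightarrow> finite (OutE A)"
  and avwc_nonempty [simp]: "is_avwc A \<Longrightarrow> St A \<noteq> {}" "is_avwc A \<Longrightarrow> Inp A \<noteq> {}"
    "is_avwc A \<Longrightarrow> OutB A \<noteq> {}" "is_avwc A \<Longrightarrow> OutE A \<noteq> {}"
  unfolding is_avwc_def by auto

lemma sum_div_mod:
  fixes f :: "nat \<Rightarrow> nat \<Rightarrow> real"
  shows "(\<Sum>g<N * M. f (g div M) (g mod M)) = (\<Sum>i<N. \<Sum>j<M. f i j)"
proof (cases "M = 0")
  case False
  have 1: "i * M + j < N * M" if "i < N" "j < M" for i j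
  proof -
    have "i * M + j < Suc i * M" using that by simp
    also have "\<dots> \<le> N * M" using that by (intro mult_le_mono1) simp
    finally show ?thesis .
  qed
  have "(\<Sum>g<N * M. f (g div M) (g mod M)) = (\<Sum>(i, j)\<in>{..<N} \<times> {..<M}. f i j)"
    using False 1
    by (intro sum.reindex_bij_witness[where i = "\<lambda>(i, j). i * M + j" and j = "\<lambda>g. (g div M, g mod M)"])
       (auto simp: less_mult_imp_div_less)
  then show ?thesis by (simp add: sum.cartesian_product)
qed simp

lemma dprob_append:
  assumes "D \<subseteq> words m (OutB A)" "E \<subseteq> words n (OutB A)"
  shows "dprob (m + n) A (append_word m n s s') (append_word m n x x')
      ((\<lambda>(y, y'). append_word m n y y') ` (D \<times> E)) = dprob m A s x D * dprob n A s' x' E"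
proof -
  have "inj_on (\<lambda>(y, y'). append_word m n y y') (D \<times> E)"
    using bij_append_word[of m n "OutB A"] assms unfolding bij_betw_def
    by (meson Sigma_mono inj_on_subset)
  then show ?thesis unfolding dprob_def
    by (subst sum.reindex)
       (simp_all add: case_prod_unfold prodch_append sum_product sum.cartesian_product)
qed

text \<open>The success probability is averaged over the messages, so that it is additive under
  concatenation.\<close>
definition det_code :: "('s, 'x, 'y, 'z) avwc \<Rightarrow> nat \<Rightarrow> nat \<Rightarrow> (nat \<Rightarrow> nat \<Rightarrow> 'x) \<Rightarrow> (nat \<Rightarrow> (nat \<Rightarrow> 'y) set) \<Rightarrow> real \<Rightarrow> bool"
  where "det_code A m N c D \<epsilon> \<longleftrightarrow>
    (\<forall>g<N. c g \<in> words m (Inp A) \<and> D g \<subseteq> words m (OutB A)) \<and>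
    (\<forall>g<N. \<forall>h<N. g \<noteq> h \<longrightarrow> D g \<inter> D h = {}) \<and>
    (\<forall>s\<in>words m (St A). real N * (1 - \<epsilon>) \<le> (\<Sum>g<N. dprob m A s (c g) (D g)))"

context
  fixes A :: "('s, 'x, 'y, 'z) avwc"
  assumes avwc: "is_avwc A"
begin

lemma dprob_nonneg:
  assumes "s \<in> words n (St A)" "x \<in> words n (Inp A)" "D \<subseteq> words n (OutB A)"
  shows "0 \<le> dprob n A s x D"
  unfolding dprob_def using assms prodch_nonneg[OF avwc_chW[OF avwc]] by (intro sum_nonneg) blast

lemma dprob_mono:
  assumes "s \<in> words n (St A)" "x \<in> words n (Inp A)" "D \<subseteq> E" "E \<subseteq> words n (OutB A)"
  shows "dprob n A s x D \<le> dprob n A s x E"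
  unfolding dprob_def
  using assms prodch_nonneg[OF avwc_chW[OF avwc]] finite_subset[OF assms(4) finite_words] avwc
  by (intro sum_mono2) auto

lemma dprob_words:
  assumes "s \<in> words n (St A)" "x \<in> words n (Inp A)"
  shows "dprob n A s x (words n (OutB A)) = 1"
  unfolding dprob_def using sum_prodch[OF avwc_chW[OF avwc]] assms avwc by simp

lemma dprob_le_1:
  assumes "s \<in> words n (St A)" "x \<in> words n (Inp A)" "D \<subseteq> words n (OutB A)"
  shows "dprob n A s x D \<le> 1"
  using dprob_mono[OF assms(1,2,3) order_refl] dprob_words[OF assms(1,2)] by simp

lemma det_code_concat:
  assumes 1: "det_code A m N c D \<epsilon>" and 2: "det_code A n M c' D' \<epsilon>'"
  shows "det_code A (m + n) (N * M) (\<lambda>g. append_word m n (c (g div M)) (c' (g mod M)))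
     (\<lambda>g. (\<lambda>(y, y'). append_word m n y y') ` (D (g div M) \<times> D' (g mod M))) (\<epsilon> + \<epsilon>')"
  unfolding det_code_def
proof (intro conjI allI impI ballI)
  have dm: "g div M < N" "g mod M < M" if "g < N * M" for g
    using that by (simp_all add: less_mult_imp_div_less) (metis gr_zeroI mod_less_divisor mult_0_right not_less_zero)
  have D: "D i \<subseteq> words m (OutB A)" if "i < N" for i using 1 that unfolding det_code_def by blast
  have D': "D' j \<subseteq> words n (OutB A)" if "j < M" for j using 2 that unfolding det_code_def by blast
  fix g assume g: "g < N * M"
  show "append_word m n (c (g div M)) (c' (g mod M)) \<in> words (m + n) (Inp A)"
    using 1 2 dm[OF g] unfolding det_code_def by (intro append_word_mem) auto
  show "(\<lambda>(y, y'). append_word m n y y') ` (D (g div M) \<times> D' (g mod M)) \<subseteq> words (m + n) (OutB A)"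
  proof (intro image_subsetI, clarify)
    fix y y' assume "y \<in> D (g div M)" "y' \<in> D' (g mod M)"
    then have "y \<in> words m (OutB A)" "y' \<in> words n (OutB A)"
      using 1 2 dm[OF g] unfolding det_code_def by auto
    then show "append_word m n y y' \<in> words (m + n) (OutB A)" by (rule append_word_mem)
  qed
  fix h assume h: "h < N * M" and "g \<noteq> h"
  then have ne: "g div M \<noteq> h div M \<or> g mod M \<noteq> h mod M"
    by (metis div_mult_mod_eq)
  show "(\<lambda>(y, y'). append_word m n y y') ` (D (g div M) \<times> D' (g mod M)) \<inter>
      (\<lambda>(y, y'). append_word m n y y') ` (D (h div M) \<times> D' (h mod M)) = {}"
  proof (rule ccontr)
    assume "\<not> ?thesis"
    then obtain y y' z z' where yz: "y \<in> D (g div M)" "y' \<in> D' (g mod M)" "z \<in> D (h div M)" "z' \<in> D' (h mod M)"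
      "append_word m n y y' = append_word m n z z'" by auto
    moreover have "y \<in> words m (OutB A)" "z \<in> words m (OutB A)" "y' \<in> words n (OutB A)" "z' \<in> words n (OutB A)"
      using subsetD[OF D[OF dm(1)]] subsetD[OF D'[OF dm(2)]] yz(1-4) g h by blast+
    ultimately have "y = z \<and> y' = z'" using append_word_inject by blast
    moreover have "D (g div M) \<inter> D (h div M) = {} \<or> D' (g mod M) \<inter> D' (h mod M) = {}"
    proof (cases "g div M = h div M")
      case True
      then have "D' (g mod M) \<inter> D' (h mod M) = {}"
        using ne 2 dm(2)[OF g] dm(2)[OF h] unfolding det_code_def by simp
      then show ?thesis ..
    next
      case False
      then have "D (g div M) \<inter> D (h div M) = {}"
        using 1 dm(1)[OF g] dm(1)[OF h] unfolding det_code_def by simp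
      then show ?thesis ..
    qed
    ultimately show False using yz(1-4) by blast
  qed
next
  fix s assume "s \<in> words (m + n) (St A)"
  then obtain s1 s2 where s: "s1 \<in> words m (St A)" "s2 \<in> words n (St A)" "s = append_word m n s1 s2"
    by (rule words_append_cases)
  have dm: "g div M < N" "g mod M < M" if "g < N * M" for g
    using that by (simp_all add: less_mult_imp_div_less) (metis gr_zeroI mod_less_divisor mult_0_right not_less_zero)
  let ?a = "\<lambda>i. dprob m A s1 (c i) (D i)" and ?b = "\<lambda>j. dprob n A s2 (c' j) (D' j)"
  have "(\<Sum>g<N * M. dprob (m + n) A s (append_word m n (c (g div M)) (c' (g mod M)))
      ((\<lambda>(y, y'). append_word m n y y') ` (D (g div M) \<times> D' (g mod M))))
     = (\<Sum>g<N * M. ?a (g div M) * ?b (g mod M))"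
  proof (rule sum.cong[OF refl])
    fix g assume "g \<in> {..<N * M}"
    then have "D (g div M) \<subseteq> words m (OutB A)" "D' (g mod M) \<subseteq> words n (OutB A)"
      using 1 2 dm unfolding det_code_def by auto
    then show "dprob (m + n) A s (append_word m n (c (g div M)) (c' (g mod M)))
      ((\<lambda>(y, y'). append_word m n y y') ` (D (g div M) \<times> D' (g mod M))) = ?a (g div M) * ?b (g mod M)"
      unfolding s by (rule dprob_append)
  qed
  also have "\<dots> = (\<Sum>i<N. ?a i) * (\<Sum>j<M. ?b j)"
    by (subst sum_div_mod[of "\<lambda>i j. ?a i * ?b j"]) (simp add: sum_product)
  finally have eq: "(\<Sum>g<N * M. dprob (m + n) A s (append_word m n (c (g div M)) (c' (g mod M)))
      ((\<lambda>(y, y'). append_word m n y y') ` (D (g div M) \<times> D' (g mod M)))) = \<dots>" .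
  have a: "(\<Sum>i<N. ?a i) \<le> real N" 
    using sum_bounded_above[of "{..<N}" ?a 1] 1 s(1) dprob_le_1 unfolding det_code_def by auto
  have b: "(\<Sum>i<M. ?b i) \<le> real M" 
    using sum_bounded_above[of "{..<M}" ?b 1] 2 s(2) dprob_le_1 unfolding det_code_def by auto
  have a': "real N * (1 - \<epsilon>) \<le> (\<Sum>i<N. ?a i)" and b': "real M * (1 - \<epsilon>') \<le> (\<Sum>i<M. ?b i)"
    using 1 2 s unfolding det_code_def by auto
  have "0 \<le> (real N - (\<Sum>i<N. ?a i)) * (real M - (\<Sum>i<M. ?b i))" using a b by simp
  moreover have "real M * (real N * (1 - \<epsilon>)) \<le> real M * (\<Sum>i<N. ?a i)"
    "real N * (real M * (1 - \<epsilon>')) \<le> real N * (\<Sum>i<M. ?b i)"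
    using a' b' by (auto intro: mult_left_mono)
  ultimately show "real (N * M) * (1 - (\<epsilon> + \<epsilon>')) \<le> (\<Sum>g<N * M. dprob (m + n) A s (append_word m n (c (g div M)) (c' (g mod M)))
      ((\<lambda>(y, y'). append_word m n y y') ` (D (g div M) \<times> D' (g mod M))))"
    unfolding eq by (simp add: algebra_simps)
qed

lemma det_code_power:
  assumes "det_code A m N c D \<epsilon>"
  shows "\<exists>c D. det_code A (t * m) (N ^ t) c D (real t * \<epsilon>)"
proof (induction t)
  case 0
  show ?case
    by (rule exI[of _ "\<lambda>_ _. undefined"], rule exI[of _ "\<lambda>_. {\<lambda>_. undefined}"])
       (auto simp: det_code_def words_Zero dprob_def prodch_def)
next
  case (Suc t)
  then obtain c' D' where "det_code A (t * m) (N ^ t) c' D' (real t * \<epsilon>)" by blast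
  from det_code_concat[OF assms this] show ?case by (auto simp: algebra_simps)
qed

end

section \<open>Second moments and the symmetrizability gap\<close>

lemma sum_PiE_coord:
  assumes "k \<in> I"
  shows "(\<Sum>v\<in>PiE I (\<lambda>_. X). h v) = (\<Sum>u\<in>PiE (I - {k}) (\<lambda>_. X). \<Sum>a\<in>X. h (u(k := a)))"
proof -
  have "PiE I (\<lambda>_. X) = PiE (insert k (I - {k})) (\<lambda>_. X)" using assms by (simp add: insert_absorb)
  also have "\<dots> = (\<lambda>(a, u). u(k := a)) ` (X \<times> PiE (I - {k}) (\<lambda>_. X))"
    by (rule PiE_insert_eq)
  finally have eq: "PiE I (\<lambda>_. X) = \<dots>" .
  have "inj_on (\<lambda>(a, u). u(k := a)) (X \<times> PiE (I - {k}) (\<lambda>_. X))"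
    by (rule inj_combinator) simp
  then have "(\<Sum>v\<in>PiE I (\<lambda>_. X). h v) = (\<Sum>(a, u)\<in>X \<times> PiE (I - {k}) (\<lambda>_. X). h (u(k := a)))"
    unfolding eq by (subst sum.reindex) (simp_all add: case_prod_unfold)
  also have "\<dots> = (\<Sum>a\<in>X. \<Sum>u\<in>PiE (I - {k}) (\<lambda>_. X). h (u(k := a)))"
    by (simp add: sum.cartesian_product)
  also have "\<dots> = (\<Sum>u\<in>PiE (I - {k}) (\<lambda>_. X). \<Sum>a\<in>X. h (u(k := a)))"
    by (rule sum.swap)
  finally show ?thesis .
qed

lemma sum_words_coord:
  assumes "k < N"
  shows "(\<Sum>v\<in>words N X. h v) = (\<Sum>u\<in>PiE ({..<N} - {k}) (\<lambda>_. X). \<Sum>a\<in>X. h (u(k := a)))"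
  unfolding words_def using assms by (intro sum_PiE_coord) simp

lemma sum_words_two_coords:
  fixes f :: "'a \<Rightarrow> 'a \<Rightarrow> real"
  assumes "k < N" "j < N" "k \<noteq> j"
  shows "real (card X ^ 2) * (\<Sum>v\<in>words N X. f (v k) (v j)) = real (card X ^ N) * (\<Sum>a\<in>X. \<Sum>b\<in>X. f a b)"
proof -
  have 1: "(\<Sum>v\<in>words N X. f (v k) (v j)) = (\<Sum>u\<in>PiE ({..<N} - {k}) (\<lambda>_. X). \<Sum>a\<in>X. f a (u j))"
    unfolding sum_words_coord[OF assms(1)] using assms(3) by simp
  have "j \<in> {..<N} - {k}" using assms by simp
  from sum_PiE_coord[OF this, of "\<lambda>u. \<Sum>a\<in>X. f a (u j)"]
  have "(\<Sum>v\<in>words N X. f (v k) (v j)) = real (card X ^ (N - 1 - 1)) * (\<Sum>b\<in>X. \<Sum>a\<in>X. f a b)"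
    unfolding 1 using assms by (simp add: card_PiE)
  moreover have "card X ^ N = card X ^ 2 * card X ^ (N - 1 - 1)"
  proof -
    have "N = 2 + (N - 1 - 1)" using assms by arith
    then show ?thesis by (metis power_add)
  qed
  moreover have "(\<Sum>b\<in>X. \<Sum>a\<in>X. f a b) = (\<Sum>a\<in>X. \<Sum>b\<in>X. f a b)" by (rule sum.swap)
  ultimately show ?thesis by simp
qed

lemma sum_words_centered:
  fixes f :: "'a \<Rightarrow> real"
  assumes "k < N" "(\<Sum>a\<in>X. f a) = 0" "\<And>v a. F (v(k := a)) = F v"
  shows "(\<Sum>v\<in>words N X. f (v k) * F v) = 0"
proof -
  have "(\<Sum>a\<in>X. f ((u(k := a)) k) * F (u(k := a))) = 0" for u
    unfolding assms(3) fun_upd_same using assms(2) by (simp flip: sum_distrib_right)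
  then show ?thesis unfolding sum_words_coord[OF assms(1)] by simp
qed

lemma card_words_coord:
  assumes "finite X" "j < N" "b \<in> X"
  shows "(\<Sum>v\<in>words N X. of_bool (v j = b)) * real (card X) = real (card X ^ N)"
proof -
  have "(\<Sum>v\<in>words N X. of_bool (v j = b)) = real (card (PiE ({..<N} - {j}) (\<lambda>_. X)))"
    unfolding sum_words_coord[OF assms(2)] fun_upd_same using assms by (simp add: of_bool_def)
  also have "\<dots> * real (card X) = real (card X ^ N)"
    using assms by (cases N) (simp_all add: card_PiE)
  finally show ?thesis .
qed

lemma words_second_moment:
  fixes w g :: "nat \<Rightarrow> 'b \<Rightarrow> real"
  assumes B: "finite B" and w0: "\<And>i b. i < n \<Longrightarrow> b \<in> B \<Longrightarrow> 0 \<le> w i b"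
    and w1: "\<And>i. i < n \<Longrightarrow> (\<Sum>b\<in>B. w i b) = 1"
    and g0: "\<And>i. i < n \<Longrightarrow> (\<Sum>b\<in>B. w i b * g i b) = 0"
    and g1: "\<And>i b. i < n \<Longrightarrow> b \<in> B \<Longrightarrow> \<bar>g i b\<bar> \<le> 1"
  shows "(\<Sum>y\<in>words n B. (\<Prod>i<n. w i (y i)) * (\<Sum>i<n. g i (y i))\<^sup>2) \<le> real n"
proof -
  let ?p = "\<lambda>y. \<Prod>i<n. w i (y i)"
  have p0: "0 \<le> ?p y" if "y \<in> words n B" for y
    using w0 words_nth[OF that] by (intro prod_nonneg) auto
  have p1: "(\<Sum>y\<in>words n B. ?p y) = 1" using B w1 by (simp add: sum_words_prod)
  have cross: "(\<Sum>y\<in>words n B. ?p y * (g j (y j) * g l (y l))) \<le> (if j = l then 1 else 0)"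
    if jl: "j < n" "l < n" for j l
  proof (cases "j = l")
    case True
    have "(\<Sum>y\<in>words n B. ?p y * (g j (y j) * g l (y l))) \<le> (\<Sum>y\<in>words n B. ?p y)"
    proof (rule sum_mono)
      fix y assume y: "y \<in> words n B"
      have "\<bar>g j (y j)\<bar> \<le> 1" using g1 jl words_nth[OF y] by blast
      then have "g j (y j) * g l (y l) \<le> 1" using True abs_square_le_1[of "g j (y j)"]
        by (simp add: power2_eq_square)
      then show "?p y * (g j (y j) * g l (y l)) \<le> ?p y" using p0[OF y] mult_left_le by blast
    qed
    then show ?thesis using True p1 by simp
  next
    case False
    let ?f = "\<lambda>i b. w i b * ((if i = j then g j b else 1) * (if i = l then g l b else 1))"
    have "?p y * (g j (y j) * g l (y l)) = (\<Prod>i<n. ?f i (y i))" for y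
      using jl by (simp add: prod.distrib)
    then have "(\<Sum>y\<in>words n B. ?p y * (g j (y j) * g l (y l))) = (\<Prod>i<n. \<Sum>b\<in>B. ?f i b)"
      using sum_words_prod[OF B, of ?f n] by simp
    also have "\<dots> = 0" using jl False g0[of j] by (intro prod_zero) (auto intro!: bexI[of _ j])
    finally show ?thesis using False by simp
  qed
  have "(\<Sum>y\<in>words n B. ?p y * (\<Sum>i<n. g i (y i))\<^sup>2)
     = (\<Sum>y\<in>words n B. \<Sum>j<n. \<Sum>l<n. ?p y * (g j (y j) * g l (y l)))"
    by (simp only: power2_eq_square sum_product) (simp only: sum_distrib_left)
  also have "\<dots> = (\<Sum>j<n. \<Sum>l<n. \<Sum>y\<in>words n B. ?p y * (g j (y j) * g l (y l)))"
    by (subst sum.swap) (intro sum.cong refl sum.swap)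
  also have "\<dots> \<le> (\<Sum>j<n. \<Sum>l<n. if j = l then 1 else 0)"
    using cross by (intro sum_mono) auto
  also have "\<dots> = real n" by simp
  finally show ?thesis .
qed

lemma words_chebyshev:
  fixes w g :: "nat \<Rightarrow> 'b \<Rightarrow> real"
  assumes B: "finite B" and w0: "\<And>i b. i < n \<Longrightarrow> b \<in> B \<Longrightarrow> 0 \<le> w i b"
    and w1: "\<And>i. i < n \<Longrightarrow> (\<Sum>b\<in>B. w i b) = 1"
    and g0: "\<And>i. i < n \<Longrightarrow> (\<Sum>b\<in>B. w i b * g i b) = 0"
    and g1: "\<And>i b. i < n \<Longrightarrow> b \<in> B \<Longrightarrow> \<bar>g i b\<bar> \<le> 1" and t: "0 < t"
  shows "(\<Sum>y | y \<in> words n B \<and> t < \<bar>\<Sum>i<n. g i (y i)\<bar>. \<Prod>i<n. w i (y i)) \<le> real n / t\<^sup>2"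
proof -
  let ?p = "\<lambda>y. \<Prod>i<n. w i (y i)" and ?G = "\<lambda>y. \<Sum>i<n. g i (y i)"
  have p0: "0 \<le> ?p y" if "y \<in> words n B" for y
    using w0 words_nth[OF that] by (intro prod_nonneg) auto
  have "t\<^sup>2 * (\<Sum>y | y \<in> words n B \<and> t < \<bar>?G y\<bar>. ?p y)
     = (\<Sum>y | y \<in> words n B \<and> t < \<bar>?G y\<bar>. ?p y * t\<^sup>2)" by (simp add: sum_distrib_left mult.commute)
  also have "\<dots> \<le> (\<Sum>y | y \<in> words n B \<and> t < \<bar>?G y\<bar>. ?p y * (?G y)\<^sup>2)"
  proof (rule sum_mono)
    fix y assume y: "y \<in> {y. y \<in> words n B \<and> t < \<bar>?G y\<bar>}"
    then have "t\<^sup>2 \<le> \<bar>?G y\<bar>\<^sup>2" using t by (intro power_mono) auto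
    then show "?p y * t\<^sup>2 \<le> ?p y * (?G y)\<^sup>2" using p0 y by (intro mult_left_mono) auto
  qed
  also have "\<dots> \<le> (\<Sum>y\<in>words n B. ?p y * (?G y)\<^sup>2)"
    using p0 B by (intro sum_mono2) auto
  also have "\<dots> \<le> real n" by (rule words_second_moment[OF assms(1-5)])
  finally show ?thesis using t by (simp add: pos_le_divide_eq mult.commute)
qed

text \<open>A Bessel inequality for a family which is orthogonal up to at most one partner
  \<open>j k\<close> of each \<open>k\<close>.\<close>
lemma card_correlated_le:
  fixes \<phi> :: "'k \<Rightarrow> 'v \<Rightarrow> real"
  assumes V: "finite V" "V \<noteq> {}" and B: "finite B"
    and \<phi>1: "\<And>k v. k \<in> B \<Longrightarrow> v \<in> V \<Longrightarrow> \<bar>\<phi> k v\<bar> \<le> 1" and \<psi>1: "\<And>v. v \<in> V \<Longrightarrow> \<bar>\<psi> v\<bar> \<le> 1"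
    and orth: "\<And>k k'. k \<in> B \<Longrightarrow> k' \<in> B \<Longrightarrow> k \<noteq> k' \<Longrightarrow> k' \<noteq> j k \<Longrightarrow> (\<Sum>v\<in>V. \<phi> k v * \<phi> k' v) = 0"
    and corr: "\<And>k. k \<in> B \<Longrightarrow> \<theta> * real (card V) < \<bar>\<Sum>v\<in>V. \<phi> k v * \<psi> v\<bar>" and \<theta>: "0 < \<theta>"
  shows "real (card B) \<le> 2 / \<theta>\<^sup>2"
proof (cases "B = {}")
  case False
  define M where "M = real (card V)"
  have M: "M > 0" unfolding M_def using V by (simp add: card_gt_0_iff)
  define e where "e k = sgn (\<Sum>v\<in>V. \<phi> k v * \<psi> v)" for k
  have e1: "\<bar>e k\<bar> \<le> 1" for k unfolding e_def by (simp add: sgn_real_def)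
  let ?F = "\<lambda>v. \<Sum>k\<in>B. e k * \<phi> k v"
  have "\<theta> * M * card B = (\<Sum>k\<in>B. \<theta> * M)" by simp
  also have "\<dots> \<le> (\<Sum>k\<in>B. e k * (\<Sum>v\<in>V. \<phi> k v * \<psi> v))"
    using corr unfolding e_def M_def by (intro sum_mono) (simp add: abs_sgn mult.commute less_imp_le)
  also have "\<dots> = (\<Sum>v\<in>V. ?F v * \<psi> v)"
    by (simp add: sum_distrib_left sum_distrib_right mult.assoc sum.swap[of _ V B])
  finally have 1: "\<theta> * M * card B \<le> (\<Sum>v\<in>V. ?F v * \<psi> v)" .
  have "(\<Sum>v\<in>V. (?F v)\<^sup>2) = (\<Sum>v\<in>V. \<Sum>k\<in>B. \<Sum>k'\<in>B. e k * e k' * (\<phi> k v * \<phi> k' v))"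
    by (simp add: power2_eq_square sum_product mult_ac)
  also have "\<dots> = (\<Sum>k\<in>B. \<Sum>k'\<in>B. \<Sum>v\<in>V. e k * e k' * (\<phi> k v * \<phi> k' v))"
    by (subst sum.swap) (intro sum.cong refl sum.swap)
  also have "\<dots> \<le> (\<Sum>k\<in>B. \<Sum>k'\<in>B. (if k' = k then M else 0) + (if k' = j k then M else 0))"
  proof (intro sum_mono)
    fix k k' assume k: "k \<in> B" "k' \<in> B"
    show "(\<Sum>v\<in>V. e k * e k' * (\<phi> k v * \<phi> k' v)) \<le> (if k' = k then M else 0) + (if k' = j k then M else 0)"
    proof (cases "k' = k \<or> k' = j k")
      case True
      have "(\<Sum>v\<in>V. e k * e k' * (\<phi> k v * \<phi> k' v)) \<le> (\<Sum>v\<in>V. 1)"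
      proof (rule sum_mono)
        fix v assume "v \<in> V"
        then have "\<bar>e k * e k' * (\<phi> k v * \<phi> k' v)\<bar> \<le> 1"
          using e1 \<phi>1 k by (auto simp: abs_mult intro!: mult_le_one)
        then show "e k * e k' * (\<phi> k v * \<phi> k' v) \<le> 1" by linarith
      qed
      then show ?thesis using True M unfolding M_def by auto
    next
      case False
      then have "(\<Sum>v\<in>V. \<phi> k v * \<phi> k' v) = 0" using orth[OF k] by auto
      then show ?thesis using False by (simp flip: sum_distrib_left)
    qed
  qed
  also have "\<dots> \<le> (\<Sum>k\<in>B. M + M)"
  proof (rule sum_mono)
    fix k assume "k \<in> B"
    have "(\<Sum>k'\<in>B. (if k' = k then M else 0) + (if k' = j k then M else 0))
      = (if k \<in> B then M else 0) + (if j k \<in> B then M else 0)"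
      using B by (simp add: sum.distrib)
    then show "(\<Sum>k'\<in>B. (if k' = k then M else 0) + (if k' = j k then M else 0)) \<le> M + M"
      using M by auto
  qed
  finally have 2: "(\<Sum>v\<in>V. (?F v)\<^sup>2) \<le> 2 * M * card B" by (simp add: mult_ac)
  have 3: "(\<Sum>v\<in>V. (\<psi> v)\<^sup>2) \<le> M"
  proof -
    have "(\<Sum>v\<in>V. (\<psi> v)\<^sup>2) \<le> (\<Sum>v\<in>V. 1)" using \<psi>1 by (intro sum_mono) (simp add: abs_square_le_1)
    then show ?thesis unfolding M_def by simp
  qed
  have "(\<theta> * M * card B)\<^sup>2 \<le> (\<Sum>v\<in>V. ?F v * \<psi> v)\<^sup>2"
    using 1 \<theta> M by (intro power_mono) auto
  also have "\<dots> \<le> (\<Sum>v\<in>V. (?F v)\<^sup>2) * (\<Sum>v\<in>V. (\<psi> v)\<^sup>2)" by (rule Cauchy_Schwarz_ineq_sum)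
  also have "\<dots> \<le> (2 * M * card B) * M" using 2 3 M by (intro mult_mono) (auto intro: sum_nonneg)
  finally have "(\<theta>\<^sup>2 * card B) * (M\<^sup>2 * card B) \<le> 2 * (M\<^sup>2 * card B)"
    by (simp add: power2_eq_square algebra_simps)
  moreover have "M\<^sup>2 * card B > 0" using M False B by (simp add: card_gt_0_iff)
  ultimately have "\<theta>\<^sup>2 * card B \<le> 2" using mult_le_cancel_right_pos by blast
  then show ?thesis using \<theta> by (simp add: pos_le_divide_eq mult.commute)
qed simp

definition symm_dist :: "('s, 'x, 'y, 'z) avwc \<Rightarrow> ('x \<Rightarrow> 's \<Rightarrow> real) \<Rightarrow> real" where
  "symm_dist A u = (\<Sum>x\<in>Inp A. \<Sum>x'\<in>Inp A. \<Sum>y\<in>OutB A.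
     \<bar>(\<Sum>s\<in>St A. u x s * chW A s x' y) - (\<Sum>s\<in>St A. u x' s * chW A s x y)\<bar>)"

context
  fixes A :: "('s, 'x, 'y, 'z) avwc"
  assumes avwc: "is_avwc A"
begin

lemma dprob_Un_le:
  assumes "s \<in> words n (St A)" "x \<in> words n (Inp A)" "D \<subseteq> words n (OutB A)" "E \<subseteq> words n (OutB A)"
  shows "dprob n A s x (D \<union> E) \<le> dprob n A s x D + dprob n A s x E"
proof -
  have f: "finite D" "finite E" using assms(3,4) avwc by (auto intro: finite_subset[OF _ finite_words])
  have "0 \<le> dprob n A s x (D \<inter> E)" using assms by (intro dprob_nonneg[OF avwc]) auto
  then show ?thesis unfolding dprob_def using sum.union_inter[OF f, of "prodch n (chW A) s x"] by linarith
qed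

lemma dprob_UN_le:
  assumes "s \<in> words n (St A)" "x \<in> words n (Inp A)" "finite I" "\<And>i. i \<in> I \<Longrightarrow> D i \<subseteq> words n (OutB A)"
  shows "dprob n A s x (\<Union>i\<in>I. D i) \<le> (\<Sum>i\<in>I. dprob n A s x (D i))"
  using assms(3,4)
proof (induction I rule: finite_induct)
  case (insert i I)
  have "dprob n A s x (D i \<union> (\<Union>i\<in>I. D i)) \<le> dprob n A s x (D i) + dprob n A s x (\<Union>i\<in>I. D i)"
    using insert.prems by (intro dprob_Un_le assms(1,2)) auto
  then show ?case using insert by auto
qed (simp add: dprob_def)

lemma symm_dist_eq_0: "symm_dist A u = 0 \<longleftrightarrow> (\<forall>x\<in>Inp A. \<forall>x'\<in>Inp A. \<forall>y\<in>OutB A.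
   (\<Sum>s\<in>St A. u x s * chW A s x' y) = (\<Sum>s\<in>St A. u x' s * chW A s x y))"
  unfolding symm_dist_def using avwc by (simp add: sum_nonneg_eq_0_iff sum_nonneg)

lemma not_symmetrizable_gap:
  assumes "\<not> symmetrizable A"
  obtains \<delta> where "\<delta> > 0" "\<And>u. channel (Inp A) (St A) u \<Longrightarrow> \<delta> \<le> symm_dist A u"
proof -
  define K :: "('x \<times> 's \<Rightarrow> real) set" where
    "K = PiE UNIV (\<lambda>p. if p \<in> Inp A \<times> St A then {0..1} else {0})"
  define C where "C = K \<inter> (\<Inter>x\<in>Inp A. {f. (\<Sum>s\<in>St A. f (x, s)) = 1})"
  have "compactin (product_topology (\<lambda>_. euclidean) UNIV) K"
    unfolding K_def compactin_PiE by auto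
  then have "compact K" by (simp add: euclidean_product_topology)
  moreover have "closed (\<Inter>x\<in>Inp A. {f :: 'x \<times> 's \<Rightarrow> real. (\<Sum>s\<in>St A. f (x, s)) = 1})"
    by (intro closed_INT ballI closed_Collect_eq continuous_intros continuous_on_product_coordinates)
  ultimately have C: "compact C" unfolding C_def by (rule compact_Int_closed)
  have cont: "continuous_on C (\<lambda>f. symm_dist A (curry f))"
    unfolding symm_dist_def curry_def
    by (intro continuous_intros continuous_on_subset[OF continuous_on_product_coordinates]) auto
  have chan: "channel (Inp A) (St A) (curry f)" if "f \<in> C" for f
  proof -
    have "0 \<le> f (x, s)" if "x \<in> Inp A" "s \<in> St A" for x s
    proof -
      have "f (x, s) \<in> (if (x, s) \<in> Inp A \<times> St A then {0..1} else {0})"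
        using \<open>f \<in> C\<close> unfolding C_def K_def by blast
      then show ?thesis using that by simp
    qed
    then show ?thesis using that unfolding channel_def C_def by auto
  qed
  have ex: "\<exists>f\<in>C. symm_dist A (curry f) = symm_dist A u" if u: "channel (Inp A) (St A) u" for u
  proof -
    define f where "f = (\<lambda>(x, s). if (x, s) \<in> Inp A \<times> St A then u x s else 0)"
    have "u x s \<le> 1" if "x \<in> Inp A" "s \<in> St A" for x s
      using u that avwc member_le_sum[of s "St A" "u x"] unfolding channel_def by auto
    then have "f \<in> C" using u unfolding C_def K_def f_def channel_def by auto
    moreover have "symm_dist A (curry f) = symm_dist A u" unfolding symm_dist_def f_def by simp
    ultimately show ?thesis by blast
  qed
  show thesis
  proof (cases "C = {}")
    case True
    then show thesis using ex that[of 1] by fastforce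
  next
    case False
    then obtain f where f: "f \<in> C" "\<And>g. g \<in> C \<Longrightarrow> symm_dist A (curry f) \<le> symm_dist A (curry g)"
      using continuous_attains_inf[OF C _ cont] by auto
    have "symm_dist A (curry f) \<noteq> 0"
      using assms chan[OF f(1)] unfolding symm_dist_eq_0 symmetrizable_def by blast
    moreover have "symm_dist A (curry f) \<ge> 0" unfolding symm_dist_def by (intro sum_nonneg) auto
    ultimately have "symm_dist A (curry f) > 0" by simp
    then show thesis using that ex f(2) by metis
  qed
qed

lemma not_symmetrizable_card_ge_2:
  assumes "\<not> symmetrizable A"
  shows "2 \<le> card (Inp A)"
proof (rule ccontr)
  assume "\<not> 2 \<le> card (Inp A)"
  moreover have "card (Inp A) > 0" using avwc by (simp add: card_gt_0_iff)
  ultimately have "card (Inp A) = 1" by linarith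
  then obtain x where x: "Inp A = {x}" using card_1_singletonE by blast
  obtain t where t: "t \<in> St A" using avwc_nonempty[OF avwc] by blast
  have "channel (Inp A) (St A) (\<lambda>x s. of_bool (s = t))"
    unfolding channel_def using avwc t by (auto simp: of_bool_def)
  then have "symmetrizable A" unfolding symmetrizable_def x by auto
  then show False using assms by blast
qed

end

section \<open>Reliable transmission over a non-symmetrizable channel\<close>

context
  fixes A :: "('s, 'x, 'y, 'z) avwc"
  assumes avwc: "is_avwc A"
begin

text \<open>The codewords are the coordinate functions on the set of all words of length \<open>N\<close>, one
  position per word, so that they are exactly independent of each other.  The decoder accepts
  \<open>k\<close> if the output, jointly with \<open>c k\<close> and any rival \<open>c j\<close>, looks as though the state were
  chosen by a channel from the letters of \<open>c j\<close> alone.  If the true message and a rival were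
  both accepted, symmetrizing the two state channels would nearly symmetrize the AVWC.  The true
  message is rejected only if \<open>c k\<close> is correlated with the states given some \<open>c j\<close>, which by
  Bessel's inequality happens for boundedly many \<open>k\<close>.\<close>
lemma block_code:
  assumes ns: "\<not> symmetrizable A"
  shows "\<exists>C>0. \<forall>N. \<exists>c D. det_code A (card (Inp A) ^ N) N c D (C / real N)"
proof -
  define X Y S W where "X = Inp A" and "Y = OutB A" and "S = St A" and "W = chW A"
  have fin: "finite X" "finite Y" "finite S" and ne: "X \<noteq> {}" "Y \<noteq> {}" "S \<noteq> {}"
    using avwc unfolding X_def Y_def S_def by auto
  have W0: "0 \<le> W s x y" and W1: "(\<Sum>y\<in>Y. W s x y) = 1" if "s \<in> S" "x \<in> X" "y \<in> Y" for s x y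
    using avwc_chW[OF avwc] that unfolding channel_def W_def X_def Y_def S_def by auto
  have Wle: "W s x y \<le> 1" if "s \<in> S" "x \<in> X" "y \<in> Y" for s x y
    using member_le_sum[of y Y "W s x"] W0[OF that(1,2)] W1[OF that] fin that by auto
  obtain \<delta> where \<delta>: "\<delta> > 0" "\<And>u. channel X S u \<Longrightarrow> \<delta> \<le> symm_dist A u"
    using not_symmetrizable_gap[OF avwc ns] unfolding X_def S_def by blast
  define q where "q = real (card X)"
  have cX: "2 \<le> card X" using not_symmetrizable_card_ge_2[OF avwc ns] unfolding X_def .
  then have q: "q \<ge> 2" unfolding q_def by simp
  define cY cS where "cY = real (card Y)" and "cS = real (card S)"
  have cYS: "cY > 0" "cS > 0" using fin ne unfolding cY_def cS_def by (auto simp: card_gt_0_iff)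
  define \<eta> where "\<eta> = \<delta> / (4 * q^2 * (q^2 * cY))"
  have \<eta>: "\<eta> > 0" unfolding \<eta>_def using \<delta> q cYS by simp
  define \<theta> where "\<theta> = \<eta> / (2 * cS)"
  have \<theta>: "\<theta> > 0" unfolding \<theta>_def using \<eta> cYS by simp
  define C where "C = q^2 * cS * (2 / \<theta>\<^sup>2) + 2 * (q^2 * cY * (4 / \<eta>\<^sup>2))"
  have C: "C > 0" unfolding C_def using q cYS \<eta> \<theta> by (intro add_pos_pos mult_pos_pos divide_pos_pos) auto
  have "\<exists>c D. det_code A (card X ^ N) N c D (C / real N)" for N
  proof -
    define M where "M = card X ^ N"
    have M: "real M > 0" unfolding M_def using cX by simp
    obtain pos where pos: "bij_betw pos {..<M} (words N X)"
      using ex_bij_betw_nat_finite[of "words N X"] fin unfolding M_def card_words atLeast0LessThan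
      by auto
    have posX: "pos i k \<in> X" if "i < M" "k < N" for i k
      using pos that words_nth unfolding bij_betw_def by blast
    define c where "c k = (\<lambda>i\<in>{..<M}. pos i k)" for k
    have cw: "c k \<in> words M X" if "k < N" for k
      unfolding words_def c_def using posX that by auto
    define T where "T k j a b y yn = (\<Sum>i<M. of_bool (pos i k = a \<and> pos i j = b \<and> yn i = y)) / real M"
      for k j a b and y :: 'y and yn :: "nat \<Rightarrow> 'y"
    define Q where "Q U a b y = (\<Sum>s\<in>S. U b s * W s a y) / q^2" for U :: "'x \<Rightarrow> 's \<Rightarrow> real" and a b y
    define cand where "cand k yn \<longleftrightarrow> (\<forall>j<N. j \<noteq> k \<longrightarrow> (\<exists>U. channel X S U \<and>
       (\<forall>a\<in>X. \<forall>b\<in>X. \<forall>y\<in>Y. \<bar>T k j a b y yn - Q U a b y\<bar> \<le> \<eta>)))" for k yn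
    define D where "D k = {yn \<in> words M Y. cand k yn}" for k
    have uniq: "k = k'" if "k < N" "k' < N" "cand k yn" "cand k' yn" for k k' yn
    proof (rule ccontr)
      assume "k \<noteq> k'"
      then obtain U U' where U: "channel X S U" "channel X S U'"
        and QU: "\<And>a b y. a \<in> X \<Longrightarrow> b \<in> X \<Longrightarrow> y \<in> Y \<Longrightarrow> \<bar>T k k' a b y yn - Q U a b y\<bar> \<le> \<eta>"
        and QU': "\<And>a b y. a \<in> X \<Longrightarrow> b \<in> X \<Longrightarrow> y \<in> Y \<Longrightarrow> \<bar>T k' k a b y yn - Q U' a b y\<bar> \<le> \<eta>"
        using \<open>cand k yn\<close> \<open>cand k' yn\<close> \<open>k < N\<close> \<open>k' < N\<close> unfolding cand_def by metis
      have TT: "T k k' a b y yn = T k' k b a y yn" for a b y unfolding T_def by (simp add: conj_ac)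
      have close: "\<bar>Q U a b y - Q U' b a y\<bar> \<le> 2 * \<eta>" if "a \<in> X" "b \<in> X" "y \<in> Y" for a b y
        using QU[OF that] QU'[OF that(2,1,3)] TT[of a b y] by linarith
      define u where "u x s = (U x s + U' x s) / 2" for x s
      have chu: "channel X S u" using U unfolding channel_def u_def
        by (auto simp: sum.distrib simp flip: sum_divide_distrib)
      have "\<bar>(\<Sum>s\<in>S. u x s * W s x' y) - (\<Sum>s\<in>S. u x' s * W s x y)\<bar> \<le> 2 * \<eta> * q^2"
        if x: "x \<in> X" "x' \<in> X" "y \<in> Y" for x x' y
      proof -
        have e: "(\<Sum>s\<in>S. u b s * W s a y) = (Q U a b y + Q U' a b y) / 2 * q^2" for a b
          unfolding Q_def u_def using q by (simp add: sum.distrib algebra_simps add_divide_distrib flip: sum_divide_distrib)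
        have "\<bar>(Q U x' x y + Q U' x' x y) / 2 - (Q U x x' y + Q U' x x' y) / 2\<bar> \<le> 2 * \<eta>"
          using close[OF x] close[OF x(2,1,3)] unfolding abs_le_iff by (simp add: field_simps)
        then have "\<bar>(Q U x' x y + Q U' x' x y) / 2 - (Q U x x' y + Q U' x x' y) / 2\<bar> * q^2 \<le> 2 * \<eta> * q^2"
          by (intro mult_right_mono) auto
        moreover have "\<bar>(\<Sum>s\<in>S. u x s * W s x' y) - (\<Sum>s\<in>S. u x' s * W s x y)\<bar>
           = \<bar>(Q U x' x y + Q U' x' x y) / 2 - (Q U x x' y + Q U' x x' y) / 2\<bar> * q^2"
          unfolding e left_diff_distrib[symmetric] by (simp add: abs_mult)
        ultimately show ?thesis by simp
      qed
      then have "symm_dist A u \<le> (\<Sum>x\<in>X. \<Sum>x'\<in>X. \<Sum>y\<in>Y. 2 * \<eta> * q^2)"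
        unfolding symm_dist_def X_def[symmetric] Y_def[symmetric] S_def[symmetric] W_def[symmetric]
        by (intro sum_mono) auto
      also have "\<dots> = \<delta> / 2" unfolding \<eta>_def using q cYS
        by (simp add: q_def[symmetric] cY_def[symmetric] power2_eq_square)
      also have "\<dots> < \<delta>" using \<delta> by simp
      finally show False using \<delta>(2)[OF chu] by simp
    qed
    have "real N * (1 - C / real N) \<le> (\<Sum>k<N. dprob M A s (c k) (D k))" if s: "s \<in> words M S" for s
    proof -
      have sS: "s i \<in> S" if "i < M" for i using words_nth[OF s that] .
      define G where "G k j a b \<tau> = (\<Sum>i<M. (of_bool (pos i k = a) - 1 / q) * of_bool (pos i j = b) * of_bool (s i = \<tau>))" for k j a b \<tau>
      define bad where "bad a b \<tau> = {k. k < N \<and> (\<exists>j<N. j \<noteq> k \<and> \<theta> * real M < \<bar>G k j a b \<tau>\<bar>)}" for a b \<tau>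
      have card_bad: "real (card (bad a b \<tau>)) \<le> 2 / \<theta>\<^sup>2" if ab: "a \<in> X" "b \<in> X" for a b \<tau>
      proof -
        have "\<forall>k\<in>bad a b \<tau>. \<exists>j<N. j \<noteq> k \<and> \<theta> * real M < \<bar>G k j a b \<tau>\<bar>" unfolding bad_def by blast
        then obtain j where j: "\<And>k. k \<in> bad a b \<tau> \<Longrightarrow> j k < N \<and> j k \<noteq> k \<and> \<theta> * real M < \<bar>G k (j k) a b \<tau>\<bar>"
          by metis
        let ?f = "\<lambda>k i. (of_bool (pos i k = a) - 1 / q) * of_bool (pos i (j k) = b)"
        show ?thesis
        proof (rule card_correlated_le[where \<phi> = ?f and \<psi> = "\<lambda>i. of_bool (s i = \<tau>)" and V = "{..<M}" and j = j])
          show "finite {..<M}" "finite (bad a b \<tau>)" unfolding bad_def by auto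
          show "{..<M} \<noteq> {}" using M by auto
          show "\<bar>?f k i\<bar> \<le> 1" for k i using q by (auto simp: of_bool_def)
          show "\<bar>of_bool (s i = \<tau>) :: real\<bar> \<le> 1" for i by (simp add: of_bool_def)
          show "\<theta> * real (card {..<M}) < \<bar>\<Sum>i<M. ?f k i * of_bool (s i = \<tau>)\<bar>" if "k \<in> bad a b \<tau>" for k
            using j[OF that] unfolding G_def by simp
          show "0 < \<theta>" by (rule \<theta>)
        next
          fix k k' assume k: "k \<in> bad a b \<tau>" "k' \<in> bad a b \<tau>" "k \<noteq> k'" "k' \<noteq> j k"
          have kN: "k < N" "k' < N" using k unfolding bad_def by auto
          let ?F = "\<lambda>v. of_bool (v (j k) = b) * ((of_bool (v k = a) - 1 / q) * of_bool (v (j k') = b)) :: real"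
          have "(\<Sum>i<M. ?f k i * ?f k' i) = (\<Sum>v\<in>words N X. (of_bool (v k' = a) - 1 / q) * ?F v)"
            using sum.reindex_bij_betw[OF pos, of "\<lambda>v. (of_bool (v k' = a) - 1 / q) * ?F v"]
            by (simp add: mult_ac)
          also have "\<dots> = 0"
            using kN(2)
          proof (rule sum_words_centered)
            show "(\<Sum>x\<in>X. of_bool (x = a) - 1 / q) = 0"
              using ab fin ne by (simp add: sum_subtractf q_def of_bool_def)
            show "?F (v(k' := x)) = ?F v" for v x using k j[OF k(2)] by auto
          qed
          finally show "(\<Sum>i<M. ?f k i * ?f k' i) = 0" .
        qed
      qed
      define Bad where "Bad = (\<Union>a\<in>X. \<Union>b\<in>X. \<Union>\<tau>\<in>S. bad a b \<tau>)"
      have BadN: "Bad \<subseteq> {..<N}" unfolding Bad_def bad_def by auto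
      have card_Bad: "real (card Bad) \<le> q^2 * cS * (2 / \<theta>\<^sup>2)"
      proof -
        have "card Bad \<le> (\<Sum>a\<in>X. \<Sum>b\<in>X. \<Sum>\<tau>\<in>S. card (bad a b \<tau>))"
          unfolding Bad_def
          by (intro order_trans[OF card_UN_le] sum_mono fin) auto
        then have "real (card Bad) \<le> (\<Sum>a\<in>X. \<Sum>b\<in>X. \<Sum>\<tau>\<in>S. real (card (bad a b \<tau>)))"
          by (simp flip: of_nat_sum)
        also have "\<dots> \<le> (\<Sum>a\<in>X. \<Sum>b\<in>X. \<Sum>\<tau>\<in>S. 2 / \<theta>\<^sup>2)"
          using card_bad by (intro sum_mono) auto
        also have "\<dots> = q^2 * cS * (2 / \<theta>\<^sup>2)"
          by (simp add: q_def cS_def power2_eq_square)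
        finally show ?thesis .
      qed
      define E where "E k j a b y = {yn \<in> words M Y. real M * \<eta> / 2 < \<bar>\<Sum>i<M. of_bool (pos i k = a \<and> pos i j = b) * (of_bool (yn i = y) - W (s i) a y)\<bar>}" for k j a b y
      define e where "e = real N * (q^2 * cY * (4 / \<eta>\<^sup>2)) / real M"
      have PE: "dprob M A s (c k) (E k j a b y) \<le> 4 / \<eta>\<^sup>2 / real M" if k: "k < N" and abY: "a \<in> X" "b \<in> X" "y \<in> Y" for k j a b y
      proof -
        let ?w = "\<lambda>i y. W (s i) (c k i) y"
        let ?g = "\<lambda>i yi. of_bool (pos i k = a \<and> pos i j = b) * (of_bool (yi = y) - W (s i) a y)"
        have cX: "c k i \<in> X" if "i < M" for i using posX that k unfolding c_def by auto
        have "(\<Sum>yn | yn \<in> words M Y \<and> real M * \<eta> / 2 < \<bar>\<Sum>i<M. ?g i (yn i)\<bar>. \<Prod>i<M. ?w i (yn i)) \<le> real M / (real M * \<eta> / 2)\<^sup>2"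
        proof (rule words_chebyshev)
          show "finite Y" "0 < real M * \<eta> / 2" using fin M \<eta> by auto
          show "0 \<le> ?w i yi" if "i < M" "yi \<in> Y" for i yi using W0 sS cX that by auto
          show w1: "(\<Sum>yi\<in>Y. ?w i yi) = 1" if "i < M" for i using W1 sS cX that abY by blast
          show "\<bar>?g i yi\<bar> \<le> 1" if "i < M" "yi \<in> Y" for i yi
            using W0[OF sS[OF that(1)] abY(1,3)] Wle[OF sS[OF that(1)] abY(1,3)] by (auto simp: of_bool_def)
          show "(\<Sum>yi\<in>Y. ?w i yi * ?g i yi) = 0" if i: "i < M" for i
          proof (cases "pos i k = a \<and> pos i j = b")
            case True
            then have "c k i = a" using i unfolding c_def by simp
            then have "(\<Sum>yi\<in>Y. ?w i yi * ?g i yi) = (\<Sum>yi\<in>Y. W (s i) a yi * of_bool (yi = y)) - (\<Sum>yi\<in>Y. W (s i) a yi) * W (s i) a y"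
              using True by (simp add: algebra_simps sum_subtractf sum_distrib_left)
            also have "\<dots> = 0" using W1[OF sS[OF i] abY(1,3)] fin abY by (simp add: of_bool_def if_distrib cong: if_cong)
            finally show ?thesis .
          qed auto
        qed
        then show ?thesis unfolding E_def dprob_def prodch_def W_def[symmetric] using M \<eta>
          by (simp add: power2_eq_square field_simps)
      qed
      have good: "1 - e \<le> dprob M A s (c k) (D k)" if k: "k < N" "k \<notin> Bad" for k
      proof -
        let ?I = "{..<N} \<times> X \<times> X \<times> Y"
        let ?E = "\<lambda>(j, a, b, y). E k j a b y"
        have sub: "words M Y - (\<Union>i\<in>?I. ?E i) \<subseteq> D k"
        proof
          fix yn assume yn: "yn \<in> words M Y - (\<Union>i\<in>?I. ?E i)"
          have "\<exists>U. channel X S U \<and> (\<forall>a\<in>X. \<forall>b\<in>X. \<forall>y\<in>Y. \<bar>T k j a b y yn - Q U a b y\<bar> \<le> \<eta>)"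
            if j: "j < N" "j \<noteq> k" for j
          proof (intro exI conjI ballI)
            define U where "U b \<tau> = q / real M * (\<Sum>i<M. of_bool (pos i j = b) * of_bool (s i = \<tau>))" for b \<tau>
            have "(\<Sum>\<tau>\<in>S. U b \<tau>) = 1" if b: "b \<in> X" for b
            proof -
              have "(\<Sum>\<tau>\<in>S. U b \<tau>) = q / real M * (\<Sum>i<M. \<Sum>\<tau>\<in>S. of_bool (pos i j = b) * of_bool (s i = \<tau>))"
                unfolding U_def sum_distrib_left by (rule sum.swap)
              also have "(\<Sum>i<M. \<Sum>\<tau>\<in>S. of_bool (pos i j = b) * of_bool (s i = \<tau>)) = (\<Sum>i<M. of_bool (pos i j = b) :: real)"
                using sS fin by (intro sum.cong refl) (simp add: of_bool_def)
              also have "\<dots> = (\<Sum>v\<in>words N X. of_bool (v j = b))"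
                using sum.reindex_bij_betw[OF pos, of "\<lambda>v. of_bool (v j = b) :: real"] by simp
              finally show ?thesis using card_words_coord[OF fin(1) j(1) b] M
                unfolding M_def[symmetric] q_def[symmetric] by (simp add: field_simps)
            qed
            moreover have "0 \<le> U b \<tau>" for b \<tau> unfolding U_def using q by (intro mult_nonneg_nonneg sum_nonneg) auto
            ultimately show "channel X S U" unfolding channel_def by simp
            fix a b y assume abY: "a \<in> X" "b \<in> X" "y \<in> Y"
            let ?ET = "(\<Sum>i<M. of_bool (pos i k = a \<and> pos i j = b) * W (s i) a y) / real M"
            have "yn \<notin> E k j a b y" using yn j abY by auto
            then have "\<bar>\<Sum>i<M. of_bool (pos i k = a \<and> pos i j = b) * (of_bool (yn i = y) - W (s i) a y)\<bar> \<le> real M * \<eta> / 2"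
              using yn unfolding E_def by auto
            moreover have "(\<Sum>i<M. of_bool (pos i k = a \<and> pos i j = b) * (of_bool (yn i = y) - W (s i) a y)) = real M * (T k j a b y yn - ?ET)"
              unfolding T_def using M by (simp add: right_diff_distrib sum_subtractf conj_assoc flip: of_bool_conj)
            ultimately have "real M * \<bar>T k j a b y yn - ?ET\<bar> \<le> real M * (\<eta> / 2)" using M by (simp add: abs_mult)
            then have 1: "\<bar>T k j a b y yn - ?ET\<bar> \<le> \<eta> / 2" using M by (simp add: mult_le_cancel_left_pos)
            have "?ET - Q U a b y = (\<Sum>\<tau>\<in>S. G k j a b \<tau> * W \<tau> a y) / real M"
            proof -
              have "(\<Sum>\<tau>\<in>S. G k j a b \<tau> * W \<tau> a y)
                = (\<Sum>\<tau>\<in>S. \<Sum>i<M. of_bool (pos i k = a) * of_bool (pos i j = b) * of_bool (s i = \<tau>) * W \<tau> a y)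
                  - (\<Sum>\<tau>\<in>S. \<Sum>i<M. of_bool (pos i j = b) * of_bool (s i = \<tau>) * W \<tau> a y) / q"
                unfolding G_def sum_distrib_right sum_divide_distrib sum_subtractf[symmetric]
                by (intro sum.cong refl) (simp add: left_diff_distrib)
              also have "(\<Sum>\<tau>\<in>S. \<Sum>i<M. of_bool (pos i k = a) * of_bool (pos i j = b) * of_bool (s i = \<tau>) * W \<tau> a y)
                 = (\<Sum>i<M. \<Sum>\<tau>\<in>S. of_bool (pos i k = a) * of_bool (pos i j = b) * of_bool (s i = \<tau>) * W \<tau> a y)"
                by (rule sum.swap)
              also have "\<dots> = (\<Sum>i<M. of_bool (pos i k = a \<and> pos i j = b) * W (s i) a y)"
                using sS fin by (intro sum.cong refl) (simp add: of_bool_def if_distrib[of "\<lambda>x. x * _"] cong: if_cong)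
              also have "(\<Sum>\<tau>\<in>S. \<Sum>i<M. of_bool (pos i j = b) * of_bool (s i = \<tau>) * W \<tau> a y) / q = real M * Q U a b y"
                unfolding Q_def U_def sum_distrib_right sum_distrib_left sum_divide_distrib
                using q M by (intro sum.cong refl) (simp add: power2_eq_square)
              finally show ?thesis using M by (simp add: field_simps)
            qed
            also have "\<bar>\<dots>\<bar> \<le> \<eta> / 2"
            proof -
              have "\<bar>\<Sum>\<tau>\<in>S. G k j a b \<tau> * W \<tau> a y\<bar> \<le> (\<Sum>\<tau>\<in>S. \<theta> * real M)"
              proof (rule order_trans[OF sum_abs sum_mono])
                fix \<tau> assume \<tau>: "\<tau> \<in> S"
                have "k \<notin> bad a b \<tau>" using k(2) abY \<tau> unfolding Bad_def by blast
                then have "\<bar>G k j a b \<tau>\<bar> \<le> \<theta> * real M" using j k(1) unfolding bad_def by auto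
                then have "\<bar>G k j a b \<tau>\<bar> * \<bar>W \<tau> a y\<bar> \<le> \<theta> * real M * 1"
                  using W0[OF \<tau> abY(1,3)] Wle[OF \<tau> abY(1,3)] by (intro mult_mono) auto
                then show "\<bar>G k j a b \<tau> * W \<tau> a y\<bar> \<le> \<theta> * real M" by (simp add: abs_mult)
              qed
              also have "\<dots> = \<eta> / 2 * real M" unfolding \<theta>_def using cYS by (simp add: cS_def[symmetric])
              finally show ?thesis using M by (simp add: pos_divide_le_eq)
            qed
            finally show "\<bar>T k j a b y yn - Q U a b y\<bar> \<le> \<eta>" using 1 by linarith
          qed
          then show "yn \<in> D k" using yn unfolding D_def cand_def by auto
        qed
        have sA: "s \<in> words M (St A)" and cA: "c k \<in> words M (Inp A)"
          using s cw[OF k(1)] unfolding S_def X_def by auto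
        have "1 = dprob M A s (c k) (words M Y)" using dprob_words[OF avwc sA cA] unfolding Y_def by simp
        also have "\<dots> \<le> dprob M A s (c k) (D k \<union> (\<Union>i\<in>?I. ?E i))"
          using sub by (intro dprob_mono[OF avwc sA cA]) (auto simp: D_def E_def Y_def)
        also have "\<dots> \<le> dprob M A s (c k) (D k) + dprob M A s (c k) (\<Union>i\<in>?I. ?E i)"
          by (intro dprob_Un_le[OF avwc sA cA]) (auto simp: D_def E_def Y_def)
        also have "dprob M A s (c k) (\<Union>i\<in>?I. ?E i) \<le> (\<Sum>i\<in>?I. dprob M A s (c k) (?E i))"
          using fin by (intro dprob_UN_le[OF avwc sA cA]) (auto simp: E_def Y_def)
        also have "\<dots> \<le> (\<Sum>i\<in>?I. 4 / \<eta>\<^sup>2 / real M)" using PE[OF k(1)] by (intro sum_mono) auto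
        also have "\<dots> = e" unfolding e_def by (simp add: card_cartesian_product q_def cY_def power2_eq_square)
        finally show ?thesis by simp
      qed
      have e0: "e \<ge> 0" unfolding e_def using q cYS M by simp
      have "(\<Sum>k<N. 1 - of_bool (k \<in> Bad) - e) \<le> (\<Sum>k<N. dprob M A s (c k) (D k))"
      proof (rule sum_mono)
        fix k assume k: "k \<in> {..<N}"
        have "0 \<le> dprob M A s (c k) (D k)"
          using s cw k unfolding S_def X_def by (intro dprob_nonneg[OF avwc]) (auto simp: D_def Y_def)
        then show "1 - of_bool (k \<in> Bad) - e \<le> dprob M A s (c k) (D k)" using good[of k] k e0 by auto
      qed
      moreover have "(\<Sum>k<N. 1 - of_bool (k \<in> Bad) - e) = real N - real (card Bad) - real N * e"
      proof -
        have "(\<Sum>k<N. of_bool (k \<in> Bad) :: real) = real (card Bad)"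
          using BadN by (simp add: of_bool_def sum.If_cases Int_absorb1 flip: Int_def)
        then show ?thesis by (simp add: sum_subtractf)
      qed
      moreover have "real N * e \<le> 2 * (q^2 * cY * (4 / \<eta>\<^sup>2))"
      proof -
        have "real N * real N \<le> 2 * 2 ^ N"
        proof (induction N)
          case (Suc n)
          consider "n = 0" | "n = 1" | "n = 2" | "n \<ge> 3" by linarith
          then show ?case
          proof cases
            case 4
            then have "3 * real n \<le> real n * real n" by (intro mult_right_mono) auto
            moreover have "1 \<le> real n" using 4 by simp
            moreover have "real (Suc n) * real (Suc n) = real n * real n + 2 * real n + 1"
              by (simp add: algebra_simps)
            ultimately have "real (Suc n) * real (Suc n) \<le> 2 * (real n * real n)" by linarith
            also have "\<dots> \<le> 2 * (2 * 2 ^ n)" using Suc by simp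
            finally show ?thesis by simp
          qed simp_all
        qed simp
        also have "\<dots> \<le> 2 * real M" unfolding M_def using power_mono[of 2 "real (card X)" N] cX by simp
        finally have "real N * real N / real M \<le> 2" using M by (simp add: pos_divide_le_eq)
        then have "real N * real N / real M * (q^2 * cY * (4 / \<eta>\<^sup>2)) \<le> 2 * (q^2 * cY * (4 / \<eta>\<^sup>2))"
          using q cYS by (intro mult_right_mono) auto
        then show ?thesis unfolding e_def by (simp add: mult_ac)
      qed
      ultimately have "real N - C \<le> (\<Sum>k<N. dprob M A s (c k) (D k))" using card_Bad unfolding C_def by linarith
      then show ?thesis by (cases "N = 0") (simp_all add: right_diff_distrib)
    qed
    then have "det_code A M N c D (C / real N)"
      unfolding det_code_def
      using cw uniq by (auto simp: D_def X_def Y_def S_def)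
    then show ?thesis unfolding M_def by blast
  qed
  then show ?thesis using C unfolding X_def by blast
qed

end

section \<open>Mutual information and concatenation\<close>

definition rel_term :: "real \<Rightarrow> real \<Rightarrow> real" where
  "rel_term a b = (if a = 0 then 0 else a * log 2 (a / b))"

text \<open>The tangent at \<open>a / b = t\<close>: \<open>t = 1\<close> gives nonnegativity of the mutual information, the
  ratio of the two sums the log-sum inequality.\<close>
lemma rel_term_ge:
  assumes "0 \<le> a" "0 \<le> b" "b = 0 \<Longrightarrow> a = 0" "0 < t"
  shows "a * log 2 t + (a - b * t) / ln 2 \<le> rel_term a b"
proof (cases "a = 0")
  case True
  then show ?thesis using assms by (simp add: rel_term_def)
next
  case False
  then have ab: "a > 0" "b > 0" using assms by force+
  have "ln (b * t / a) \<le> b * t / a - 1" using ab assms(4) by (intro ln_le_minus_one) simp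
  then have "a * ln (b * t / a) \<le> a * (b * t / a - 1)" using ab by (intro mult_left_mono) auto
  then have "a * ln t + (a - b * t) \<le> a * ln (a / b)"
    using ab assms(4) by (simp add: ln_mult ln_div algebra_simps)
  then have "(a * ln t + (a - b * t)) / ln 2 \<le> a * ln (a / b) / ln 2"
    by (rule divide_right_mono) simp
  then show ?thesis using False by (simp add: rel_term_def log_def add_divide_distrib)
qed

lemma log_sum_inequality:
  assumes I: "finite I" and pos: "\<And>i. i \<in> I \<Longrightarrow> 0 \<le> c i \<and> 0 \<le> a i \<and> 0 \<le> b i \<and> (b i = 0 \<longrightarrow> a i = 0)"
  shows "rel_term (\<Sum>i\<in>I. c i * a i) (\<Sum>i\<in>I. c i * b i) \<le> (\<Sum>i\<in>I. c i * rel_term (a i) (b i))"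
proof (cases "(\<Sum>i\<in>I. c i * a i) = 0")
  case True
  then have "c i * a i = 0" if "i \<in> I" for i
    using sum_nonneg_eq_0_iff[OF I, of "\<lambda>i. c i * a i"] pos that by auto
  then have "c i * rel_term (a i) (b i) = 0" if "i \<in> I" for i
    using that by (auto simp: rel_term_def)
  then have "(\<Sum>i\<in>I. c i * rel_term (a i) (b i)) = 0" by (intro sum.neutral) auto
  then show ?thesis using True by (simp add: rel_term_def)
next
  case False
  let ?P = "\<Sum>i\<in>I. c i * a i" and ?Q = "\<Sum>i\<in>I. c i * b i"
  have P: "?P > 0" using False sum_nonneg[of I "\<lambda>i. c i * a i"] pos by force
  have Q0: "?Q \<ge> 0" using pos by (intro sum_nonneg) auto
  have "?Q \<noteq> 0"
  proof
    assume "?Q = 0"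
    then have "c i * b i = 0" if "i \<in> I" for i
      using sum_nonneg_eq_0_iff[OF I, of "\<lambda>i. c i * b i"] pos that by auto
    then have "c i * a i = 0" if "i \<in> I" for i using pos that by fastforce
    then have "?P = 0" by (intro sum.neutral) auto
    then show False using False by simp
  qed
  then have Q: "?Q > 0" using Q0 by simp
  define t where "t = ?P / ?Q"
  have t: "t > 0" unfolding t_def using P Q by simp
  have "rel_term ?P ?Q = ?P * log 2 t + (?P - ?Q * t) / ln 2"
    unfolding rel_term_def t_def using P Q by simp
  also have "\<dots> = (\<Sum>i\<in>I. c i * (a i * log 2 t + (a i - b i * t) / ln 2))"
  proof -
    have "c i * (a i * log 2 t + (a i - b i * t) / ln 2) = c i * a i * (log 2 t + 1 / ln 2) - c i * b i * (t / ln 2)" for i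
      by (simp add: algebra_simps diff_divide_distrib)
    then have "(\<Sum>i\<in>I. c i * (a i * log 2 t + (a i - b i * t) / ln 2)) = ?P * (log 2 t + 1 / ln 2) - ?Q * (t / ln 2)"
      by (simp only: sum_subtractf sum_distrib_right)
    then show ?thesis by (simp add: algebra_simps diff_divide_distrib)
  qed
  also have "\<dots> \<le> (\<Sum>i\<in>I. c i * rel_term (a i) (b i))"
    using pos t by (intro sum_mono mult_left_mono rel_term_ge) auto
  finally show ?thesis .
qed

definition mut_inf :: "nat \<Rightarrow> 'z set \<Rightarrow> (nat \<Rightarrow> 'z \<Rightarrow> real) \<Rightarrow> real" where
  "mut_inf K Z q = (\<Sum>k<K. \<Sum>z\<in>Z. rel_term (q k z) ((\<Sum>k'<K. q k' z) / real K)) / real K"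

lemma avg_eq_0D:
  fixes q :: "nat \<Rightarrow> 'z \<Rightarrow> real"
  assumes "\<And>k. k < K \<Longrightarrow> 0 \<le> q k z" "k < K" "(\<Sum>k'<K. q k' z) / real K = 0"
  shows "q k z = 0"
  using assms sum_nonneg_eq_0_iff[of "{..<K}" "\<lambda>k. q k z"] by auto

lemma mut_inf_nonneg:
  assumes "\<And>k z. k < K \<Longrightarrow> z \<in> Z \<Longrightarrow> 0 \<le> q k z"
  shows "0 \<le> mut_inf K Z q"
proof (cases "K = 0")
  case False
  let ?p = "\<lambda>z. (\<Sum>k<K. q k z) / real K"
  have "(\<Sum>k<K. \<Sum>z\<in>Z. (q k z - ?p z) / ln 2) \<le> (\<Sum>k<K. \<Sum>z\<in>Z. rel_term (q k z) (?p z))"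
  proof (intro sum_mono)
    fix k z assume kz: "k \<in> {..<K}" "z \<in> Z"
    have "0 \<le> ?p z" using kz assms by (intro divide_nonneg_nonneg sum_nonneg) auto
    then show "(q k z - ?p z) / ln 2 \<le> rel_term (q k z) (?p z)"
      using rel_term_ge[of "q k z" "?p z" 1] avg_eq_0D[of K q z k] assms kz by auto
  qed
  also have "(\<Sum>k<K. \<Sum>z\<in>Z. (q k z - ?p z) / ln 2) = 0"
    using False by (subst sum.swap) (simp add: sum_subtractf flip: sum_divide_distrib)
  finally show ?thesis unfolding mut_inf_def by simp
qed (simp add: mut_inf_def)

lemma mut_inf_le:
  assumes "\<And>k z. k < K \<Longrightarrow> z \<in> Z \<Longrightarrow> 0 \<le> q k z" "\<And>k. k < K \<Longrightarrow> (\<Sum>z\<in>Z. q k z) = 1" "1 \<le> K"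
  shows "mut_inf K Z q \<le> log 2 (real K)"
proof -
  let ?p = "\<lambda>z. (\<Sum>k<K. q k z) / real K"
  have "(\<Sum>k<K. \<Sum>z\<in>Z. rel_term (q k z) (?p z)) \<le> (\<Sum>k<K. \<Sum>z\<in>Z. q k z * log 2 (real K))"
  proof (intro sum_mono)
    fix k z assume kz: "k \<in> {..<K}" "z \<in> Z"
    show "rel_term (q k z) (?p z) \<le> q k z * log 2 (real K)"
    proof (cases "q k z = 0")
      case False
      then have q: "q k z > 0" using assms(1) kz by force
      have "q k z \<le> (\<Sum>k<K. q k z)" using kz assms(1) by (intro member_le_sum) auto
      then have "q k z / ?p z \<le> real K" "0 < q k z / ?p z"
        using q assms(3) by (simp_all add: field_simps)
      then show ?thesis using q assms(3) unfolding rel_term_def by (auto intro!: mult_left_mono)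
    qed (simp add: rel_term_def)
  qed
  also have "\<dots> = real K * log 2 (real K)" using assms(2) by (simp flip: sum_distrib_right)
  finally show ?thesis unfolding mut_inf_def using assms(3) by (simp add: pos_divide_le_eq mult.commute)
qed

definition eve_out :: "('s, 'x, 'y, 'z) avwc \<Rightarrow> nat \<Rightarrow> ((nat \<Rightarrow> 'x) \<Rightarrow> real) \<Rightarrow> (nat \<Rightarrow> 's) \<Rightarrow> (nat \<Rightarrow> 'z) \<Rightarrow> real"
  where "eve_out A n e s z = (\<Sum>x\<in>words n (Inp A). e x * prodch n (chV A) s x z)"

lemma sum_of_bool_point:
  fixes f :: "'a \<Rightarrow> real"
  assumes "finite S" "x \<in> S"
  shows "(\<Sum>a\<in>S. of_bool (a = x) * f a) = f x"
  using assms by (simp add: of_bool_def if_distrib[of "\<lambda>x. x * _"] cong: if_cong)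

lemma cond_mi_eq:
  "cond_mi A n K G e s = (\<Sum>g<G. mut_inf K (words n (OutE A)) (\<lambda>k. eve_out A n (e g k) s)) / real G"
  unfolding cond_mi_def mut_inf_def rel_term_def eve_out_def Let_def by (simp cong: if_cong)

definition succ_prob :: "('s, 'x, 'y, 'z) avwc \<Rightarrow> nat \<Rightarrow> nat \<Rightarrow> (nat \<Rightarrow> (nat \<Rightarrow> 'x) \<Rightarrow> real) \<Rightarrow> (nat \<Rightarrow> (nat \<Rightarrow> 'y) set) \<Rightarrow> (nat \<Rightarrow> 's) \<Rightarrow> real"
  where "succ_prob A n K e D s = (\<Sum>k<K. \<Sum>x\<in>words n (Inp A). e k x * dprob n A s x (D k)) / real K"

lemma code_err_eq:
  "code_err A n K G e D = 1 - Min ((\<lambda>s. (\<Sum>g<G. succ_prob A n K (e g) (D g) s) / real G) ` words n (St A))"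
  unfolding code_err_def succ_prob_def dprob_def by (simp flip: sum_divide_distrib add: mult.commute)

context
  fixes A :: "('s, 'x, 'y, 'z) avwc"
  assumes avwc: "is_avwc A"
begin

lemma code_err_le_iff:
  "code_err A n K G e D \<le> r \<longleftrightarrow> (\<forall>s\<in>words n (St A). 1 - r \<le> (\<Sum>g<G. succ_prob A n K (e g) (D g) s) / real G)"
proof -
  have "finite ((\<lambda>s. (\<Sum>g<G. succ_prob A n K (e g) (D g) s) / real G) ` words n (St A))"
    "(\<lambda>s. (\<Sum>g<G. succ_prob A n K (e g) (D g) s) / real G) ` words n (St A) \<noteq> {}"
    using avwc words_nonempty[of "St A" n] by auto
  from Min_ge_iff[OF this, of "1 - r"] show ?thesis unfolding code_err_eq by auto
qed

lemma succ_prob_bounds: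
  assumes "is_code A n K G e D" "g < G" "s \<in> words n (St A)"
  shows "0 \<le> succ_prob A n K (e g) (D g) s" "succ_prob A n K (e g) (D g) s \<le> 1"
proof -
  have K: "K \<ge> 1" using assms unfolding is_code_def by blast
  have e: "\<And>x. x \<in> words n (Inp A) \<Longrightarrow> 0 \<le> e g k x" "(\<Sum>x\<in>words n (Inp A). e g k x) = 1"
    and D: "D g k \<subseteq> words n (OutB A)" if "k < K" for k
    using assms(1,2) that unfolding is_code_def by auto
  show "0 \<le> succ_prob A n K (e g) (D g) s"
    unfolding succ_prob_def using e D assms(3) dprob_nonneg[OF avwc]
    by (intro divide_nonneg_nonneg sum_nonneg mult_nonneg_nonneg) auto
  have "(\<Sum>x\<in>words n (Inp A). e g k x * dprob n A s x (D g k)) \<le> 1" if k: "k < K" for k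
  proof -
    have "(\<Sum>x\<in>words n (Inp A). e g k x * dprob n A s x (D g k)) \<le> (\<Sum>x\<in>words n (Inp A). e g k x * 1)"
      using e[OF k] D[OF k] dprob_le_1[OF avwc] assms(3) by (intro sum_mono mult_left_mono) auto
    then show ?thesis using e[OF k] by simp
  qed
  then have "(\<Sum>k<K. \<Sum>x\<in>words n (Inp A). e g k x * dprob n A s x (D g k)) \<le> real K"
    using sum_bounded_above[of "{..<K}" _ "1 :: real"] by force
  then show "succ_prob A n K (e g) (D g) s \<le> 1" unfolding succ_prob_def using K by simp
qed

lemma eve_out_nonneg:
  assumes "is_code A n K G e D" "g < G" "k < K" "s \<in> words n (St A)" "z \<in> words n (OutE A)"
  shows "0 \<le> eve_out A n (e g k) s z"
  unfolding eve_out_def using assms prodch_nonneg[OF avwc_chV[OF avwc]]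
  unfolding is_code_def by (intro sum_nonneg mult_nonneg_nonneg) auto

lemma sum_eve_out:
  assumes "is_code A n K G e D" "g < G" "k < K" "s \<in> words n (St A)"
  shows "(\<Sum>z\<in>words n (OutE A). eve_out A n (e g k) s z) = 1"
proof -
  have "(\<Sum>z\<in>words n (OutE A). eve_out A n (e g k) s z)
     = (\<Sum>x\<in>words n (Inp A). e g k x * (\<Sum>z\<in>words n (OutE A). prodch n (chV A) s x z))"
    unfolding eve_out_def by (subst sum.swap) (simp add: sum_distrib_left)
  also have "\<dots> = (\<Sum>x\<in>words n (Inp A). e g k x)"
    using sum_prodch[OF avwc_chV[OF avwc] assms(4)] avwc by simp
  finally show ?thesis using assms unfolding is_code_def by simp
qed

lemma cond_mi_nonneg:
  assumes "is_code A n K G e D" "s \<in> words n (St A)"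
  shows "0 \<le> cond_mi A n K G e s"
  unfolding cond_mi_eq using eve_out_nonneg[OF assms(1)] assms(2)
  by (intro divide_nonneg_nonneg sum_nonneg mut_inf_nonneg) auto

lemma code_err_nonneg:
  assumes "is_code A n K G e D"
  shows "0 \<le> code_err A n K G e D"
proof (rule ccontr)
  assume "\<not> ?thesis"
  then have *: "code_err A n K G e D < 0" by simp
  obtain s where s: "s \<in> words n (St A)" using words_nonempty[of "St A" n] avwc by fastforce
  have "1 - code_err A n K G e D \<le> (\<Sum>g<G. succ_prob A n K (e g) (D g) s) / real G"
    using code_err_le_iff[of n K G e D "code_err A n K G e D"] s by blast
  moreover have "(\<Sum>g<G. succ_prob A n K (e g) (D g) s) \<le> (\<Sum>g<G. 1)"
    using succ_prob_bounds(2)[OF assms _ s] by (intro sum_mono) auto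
  moreover have "G \<ge> 1" using assms unfolding is_code_def by blast
  moreover from this have "real G * code_err A n K G e D < 0" using * by (simp add: mult_pos_neg)
  ultimately show False by (simp add: field_simps)
qed

lemma card_messages_le:
  assumes "is_code A n K G e D"
  shows "real K * (1 - code_err A n K G e D) \<le> real (card (OutB A) ^ n)"
proof -
  obtain s where s: "s \<in> words n (St A)" using words_nonempty[of "St A" n] avwc by fastforce
  have KG: "K \<ge> 1" "G \<ge> 1" using assms unfolding is_code_def by auto
  have "real K * succ_prob A n K (e g) (D g) s \<le> real (card (OutB A) ^ n)" if g: "g < G" for g
  proof -
    have e: "\<And>x. x \<in> words n (Inp A) \<Longrightarrow> 0 \<le> e g k x" "(\<Sum>x\<in>words n (Inp A). e g k x) = 1"
      and D: "D g k \<subseteq> words n (OutB A)" if "k < K" for k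
      using assms g that unfolding is_code_def by auto
    have fD: "finite (D g k)" if "k < K" for k
      using D[OF that] avwc by (auto intro: finite_subset[OF _ finite_words])
    have "(\<Sum>x\<in>words n (Inp A). e g k x * dprob n A s x (D g k)) \<le> real (card (D g k))" if k: "k < K" for k
    proof -
      have "dprob n A s x (D g k) \<le> real (card (D g k))" if x: "x \<in> words n (Inp A)" for x
      proof -
        have "prodch n (chW A) s x y \<le> 1" if "y \<in> D g k" for y
          using dprob_le_1[OF avwc s x, of "{y}"] that D[OF k] unfolding dprob_def by auto
        then show ?thesis unfolding dprob_def using sum_bounded_above[of "D g k" "prodch n (chW A) s x" 1] by simp
      qed
      then have "(\<Sum>x\<in>words n (Inp A). e g k x * dprob n A s x (D g k)) \<le> (\<Sum>x\<in>words n (Inp A). e g k x * real (card (D g k)))"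
        using e[OF k] by (intro sum_mono mult_left_mono) auto
      then show ?thesis using e[OF k] by (simp flip: sum_distrib_right)
    qed
    then have "(\<Sum>k<K. \<Sum>x\<in>words n (Inp A). e g k x * dprob n A s x (D g k)) \<le> (\<Sum>k<K. real (card (D g k)))"
      by (intro sum_mono) auto
    also have "\<dots> = real (card (\<Union>k<K. D g k))"
      using fD assms g unfolding is_code_def by (subst card_UN_disjoint) auto
    also have "card (\<Union>k<K. D g k) \<le> card (words n (OutB A))"
      using D avwc by (intro card_mono) auto
    finally show ?thesis using KG unfolding succ_prob_def by (simp add: card_words)
  qed
  then have "(\<Sum>g<G. real K * succ_prob A n K (e g) (D g) s) \<le> (\<Sum>g<G. real (card (OutB A) ^ n))"
    by (intro sum_mono) auto
  then have "real K * ((\<Sum>g<G. succ_prob A n K (e g) (D g) s) / real G) \<le> real (card (OutB A) ^ n)"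
    using KG by (simp add: field_simps flip: sum_distrib_left)
  moreover have "1 - code_err A n K G e D \<le> (\<Sum>g<G. succ_prob A n K (e g) (D g) s) / real G"
    using code_err_le_iff[of n K G e D "code_err A n K G e D"] s by blast
  ultimately show ?thesis by (meson mult_left_mono of_nat_0_le_iff order_trans)
qed

lemma concat_code:
  assumes code: "is_code A n K G e D" and pre: "det_code A p G c P \<epsilon>"
  shows "\<exists>e' D'. is_code A (p + n) K 1 e' D' \<and> code_err A (p + n) K 1 e' D' \<le> code_err A n K G e D + \<epsilon> \<and>
    (\<forall>s\<in>words (p + n) (St A). \<exists>s'\<in>words n (St A). cond_mi A (p + n) K 1 e' s \<le> cond_mi A n K G e s')"
proof -
  have KG: "K \<ge> 1" "G \<ge> 1" using code unfolding is_code_def by auto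
  have e: "\<And>x. x \<in> words n (Inp A) \<Longrightarrow> 0 \<le> e g k x" "(\<Sum>x\<in>words n (Inp A). e g k x) = 1"
    and D: "D g k \<subseteq> words n (OutB A)" if "g < G" "k < K" for g k
    using code that unfolding is_code_def by auto
  have c: "c g \<in> words p (Inp A)" and P: "P g \<subseteq> words p (OutB A)" if "g < G" for g
    using pre that unfolding det_code_def by auto
  define e1 where "e1 k w = (\<Sum>g<G. of_bool (restrict w {..<p} = c g) * e g k (\<lambda>i\<in>{..<n}. w (i + p))) / real G" for k w
  define D1 where "D1 k = (\<Union>g<G. (\<lambda>(y, y'). append_word p n y y') ` (P g \<times> D g k))" for k
  have split: "restrict (append_word p n a b) {..<p} = a" "(\<lambda>i\<in>{..<n}. append_word p n a b (i + p)) = b"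
    if "a \<in> words p X" "b \<in> words n X" for a b and X :: "'x set"
    using that unfolding words_def append_word_def by (auto simp: PiE_iff extensional_def fun_eq_iff)
  have e1_sum: "(\<Sum>w\<in>words (p + n) (Inp A). e1 k w * F w)
     = (\<Sum>g<G. \<Sum>x\<in>words n (Inp A). e g k x * F (append_word p n (c g) x)) / real G" for k F
  proof -
    have "(\<Sum>w\<in>words (p + n) (Inp A). e1 k w * F w)
      = (\<Sum>a\<in>words p (Inp A). \<Sum>b\<in>words n (Inp A). (\<Sum>g<G. of_bool (a = c g) * e g k b) / real G * F (append_word p n a b))"
      unfolding sum_words_append e1_def by (intro sum.cong refl) (simp add: split)
    also have "\<dots> = (\<Sum>a\<in>words p (Inp A). \<Sum>b\<in>words n (Inp A). \<Sum>g<G. of_bool (a = c g) * (e g k b * F (append_word p n a b) / real G))"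
      unfolding sum_distrib_right sum_divide_distrib by (intro sum.cong refl) simp
    also have "\<dots> = (\<Sum>a\<in>words p (Inp A). \<Sum>g<G. \<Sum>b\<in>words n (Inp A). of_bool (a = c g) * (e g k b * F (append_word p n a b) / real G))"
      by (intro sum.cong refl sum.swap)
    also have "\<dots> = (\<Sum>g<G. \<Sum>a\<in>words p (Inp A). \<Sum>b\<in>words n (Inp A). of_bool (a = c g) * (e g k b * F (append_word p n a b) / real G))"
      by (rule sum.swap)
    also have "\<dots> = (\<Sum>g<G. \<Sum>a\<in>words p (Inp A). of_bool (a = c g) * (\<Sum>b\<in>words n (Inp A). e g k b * F (append_word p n a b) / real G))"
      by (simp add: sum_distrib_left)
    also have "\<dots> = (\<Sum>g<G. \<Sum>b\<in>words n (Inp A). e g k b * F (append_word p n (c g) b) / real G)"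
      using c avwc by (intro sum.cong[OF refl] sum_of_bool_point) auto
    finally show ?thesis by (simp add: sum_divide_distrib)
  qed
  have D1_sub: "D1 k \<subseteq> words (p + n) (OutB A)" if "k < K" for k
  proof -
    have "append_word p n y y' \<in> words (p + n) (OutB A)" if "g < G" "y \<in> P g" "y' \<in> D g k" for g y y'
      using P D that \<open>k < K\<close> by (intro append_word_mem) blast+
    then show ?thesis unfolding D1_def by auto
  qed
  have code1: "is_code A (p + n) K 1 (\<lambda>_. e1) (\<lambda>_. D1)"
    unfolding is_code_def
  proof (intro conjI allI impI ballI)
    show "1 \<le> K" "(1::nat) \<le> 1" using KG by auto
    fix k assume k: "k < K"
    show "D1 k \<subseteq> words (p + n) (OutB A)" by (rule D1_sub[OF k])
    have "(\<Sum>w\<in>words (p + n) (Inp A). e1 k w * 1) = 1"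
      unfolding e1_sum using e(2)[OF _ k] KG by simp
    then show "(\<Sum>w\<in>words (p + n) (Inp A). e1 k w) = 1" by simp
    show "0 \<le> e1 k w" if "w \<in> words (p + n) (Inp A)" for w
      using that
    proof (rule words_append_cases)
      fix a b assume "a \<in> words p (Inp A)" "b \<in> words n (Inp A)" "w = append_word p n a b"
      then show ?thesis unfolding e1_def using e(1)[OF _ k]
        by (intro divide_nonneg_nonneg sum_nonneg mult_nonneg_nonneg) (auto simp: split)
    qed
    fix k' assume k': "k' < K" "k \<noteq> k'"
    show "D1 k \<inter> D1 k' = {}"
    proof (rule ccontr)
      assume "\<not> ?thesis"
      then obtain g g' y y' z z' where yz: "g < G" "g' < G" "y \<in> P g" "y' \<in> D g k" "z \<in> P g'" "z' \<in> D g' k'"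
        "append_word p n y y' = append_word p n z z'" unfolding D1_def by auto
      then have "y \<in> words p (OutB A)" "z \<in> words p (OutB A)" "y' \<in> words n (OutB A)" "z' \<in> words n (OutB A)"
        using P D k k' by blast+
      then have "y = z" "y' = z'" using append_word_inject yz(7) by blast+
      moreover from this have "g = g'" using yz(1,2,3,5) pre unfolding det_code_def by blast
      ultimately show False using yz code k k' unfolding is_code_def by blast
    qed
  qed
  have err: "code_err A (p + n) K 1 (\<lambda>_. e1) (\<lambda>_. D1) \<le> code_err A n K G e D + \<epsilon>"
    unfolding code_err_le_iff
  proof
    fix s assume "s \<in> words (p + n) (St A)"
    then obtain s1 s2 where s: "s1 \<in> words p (St A)" "s2 \<in> words n (St A)" "s = append_word p n s1 s2"
      by (rule words_append_cases)
    let ?\<alpha> = "\<lambda>g. dprob p A s1 (c g) (P g)" and ?\<beta> = "\<lambda>g. succ_prob A n K (e g) (D g) s2"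
    have 1: "1 - code_err A n K G e D \<le> (\<Sum>g<G. ?\<beta> g) / real G"
      using code_err_le_iff[of n K G e D "code_err A n K G e D"] s by blast
    have "real G * (1 - \<epsilon>) \<le> (\<Sum>g<G. ?\<alpha> g)" using pre s unfolding det_code_def by blast
    then have 2: "1 - \<epsilon> \<le> (\<Sum>g<G. ?\<alpha> g) / real G" using KG by (simp add: field_simps)
    have "(\<Sum>g<G. ?\<alpha> g) / real G + (\<Sum>g<G. ?\<beta> g) / real G - 1 = (\<Sum>g<G. ?\<alpha> g + ?\<beta> g - 1) / real G"
      using KG by (simp add: sum_subtractf sum.distrib add_divide_distrib diff_divide_distrib)
    also have "\<dots> \<le> (\<Sum>g<G. ?\<alpha> g * ?\<beta> g) / real G"
    proof (intro divide_right_mono sum_mono)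
      fix g assume "g \<in> {..<G}"
      then have "0 \<le> (1 - ?\<alpha> g) * (1 - ?\<beta> g)"
        using dprob_le_1[OF avwc s(1) c P] succ_prob_bounds(2)[OF code _ s(2)] by simp
      then show "?\<alpha> g + ?\<beta> g - 1 \<le> ?\<alpha> g * ?\<beta> g" by (simp add: algebra_simps)
    qed simp
    also have "\<dots> = (\<Sum>k<K. (\<Sum>g<G. \<Sum>x\<in>words n (Inp A). e g k x * (?\<alpha> g * dprob n A s2 x (D g k))) / real G) / real K"
    proof -
      have "(\<Sum>g<G. ?\<alpha> g * ?\<beta> g) = (\<Sum>g<G. \<Sum>k<K. (\<Sum>x\<in>words n (Inp A). e g k x * (?\<alpha> g * dprob n A s2 x (D g k))) / real K)"
        unfolding succ_prob_def by (simp add: sum_distrib_left sum_divide_distrib mult_ac)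
      also have "\<dots> = (\<Sum>k<K. \<Sum>g<G. (\<Sum>x\<in>words n (Inp A). e g k x * (?\<alpha> g * dprob n A s2 x (D g k))) / real K)"
        by (rule sum.swap)
      finally show ?thesis by (simp add: sum_divide_distrib mult_ac)
    qed
    also have "\<dots> \<le> (\<Sum>k<K. (\<Sum>g<G. \<Sum>x\<in>words n (Inp A). e g k x * dprob (p + n) A s (append_word p n (c g) x) (D1 k)) / real G) / real K"
    proof (intro divide_right_mono sum_mono mult_left_mono)
      fix k g x assume kgx: "k \<in> {..<K}" "g \<in> {..<G}" "x \<in> words n (Inp A)"
      show "0 \<le> e g k x" using e kgx by auto
      have "?\<alpha> g * dprob n A s2 x (D g k) = dprob (p + n) A s (append_word p n (c g) x) ((\<lambda>(y, y'). append_word p n y y') ` (P g \<times> D g k))"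
        unfolding s using P D kgx by (subst dprob_append) auto
      also have "\<dots> \<le> dprob (p + n) A s (append_word p n (c g) x) (D1 k)"
        using s c kgx D1_sub by (intro dprob_mono[OF avwc] append_word_mem) (auto simp: D1_def intro: append_word_mem)
      finally show "?\<alpha> g * dprob n A s2 x (D g k) \<le> dprob (p + n) A s (append_word p n (c g) x) (D1 k)" .
    qed auto
    also have "\<dots> = succ_prob A (p + n) K e1 D1 s" unfolding succ_prob_def e1_sum ..
    finally show "1 - (code_err A n K G e D + \<epsilon>) \<le> (\<Sum>g<(1::nat). succ_prob A (p + n) K e1 D1 s) / real 1"
      using 1 2 by simp
  qed
  have mi: "\<exists>s'\<in>words n (St A). cond_mi A (p + n) K 1 (\<lambda>_. e1) s \<le> cond_mi A n K G e s'" if "s \<in> words (p + n) (St A)" for s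
    using that
  proof (rule words_append_cases)
    fix s1 s2 assume s: "s1 \<in> words p (St A)" "s2 \<in> words n (St A)" "s = append_word p n s1 s2"
    let ?a = "\<lambda>z g. prodch p (chV A) s1 (c g) z / real G"
    let ?q = "\<lambda>g k z. eve_out A n (e g k) s2 z"
    let ?p = "\<lambda>g z. (\<Sum>k<K. ?q g k z) / real K"
    have out: "eve_out A (p + n) (e1 k) s (append_word p n z z') = (\<Sum>g<G. ?a z g * ?q g k z')" for k z z'
      unfolding eve_out_def[of A "p + n"] e1_sum s prodch_append
      by (simp add: eve_out_def sum_distrib_left sum_divide_distrib mult_ac)
    have avg: "(\<Sum>k<K. \<Sum>g<G. ?a z g * ?q g k z') / real K = (\<Sum>g<G. ?a z g * ?p g z')" for z z'
      by (subst sum.swap) (simp add: sum_distrib_left sum_divide_distrib)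
    have "mut_inf K (words (p + n) (OutE A)) (\<lambda>k. eve_out A (p + n) (e1 k) s)
      = (\<Sum>k<K. \<Sum>z\<in>words p (OutE A). \<Sum>z'\<in>words n (OutE A). rel_term (\<Sum>g<G. ?a z g * ?q g k z') (\<Sum>g<G. ?a z g * ?p g z')) / real K"
      unfolding mut_inf_def sum_words_append out avg ..
    also have "\<dots> \<le> (\<Sum>k<K. \<Sum>z\<in>words p (OutE A). \<Sum>z'\<in>words n (OutE A). \<Sum>g<G. ?a z g * rel_term (?q g k z') (?p g z')) / real K"
    proof (intro divide_right_mono sum_mono log_sum_inequality conjI impI)
      fix k z z' g assume k: "k \<in> {..<K}" "z \<in> words p (OutE A)" "z' \<in> words n (OutE A)" "g \<in> {..<G}"
      have q0: "0 \<le> ?q g k z'" if "k < K" for k using eve_out_nonneg[OF code _ that s(2)] k by auto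
      show "0 \<le> ?a z g" using prodch_nonneg[OF avwc_chV[OF avwc] s(1) c] k by auto
      show "0 \<le> ?q g k z'" using q0 k by auto
      show "0 \<le> ?p g z'" using q0 by (intro divide_nonneg_nonneg sum_nonneg) auto
      show "?q g k z' = 0" if "?p g z' = 0" using avg_eq_0D[of K "?q g" z' k] q0 k that by auto
    qed auto
    also have "\<dots> = (\<Sum>g<G. (\<Sum>z\<in>words p (OutE A). ?a z g) * (\<Sum>k<K. \<Sum>z'\<in>words n (OutE A). rel_term (?q g k z') (?p g z')) / real K)"
    proof -
      have "(\<Sum>k<K. \<Sum>z\<in>words p (OutE A). \<Sum>z'\<in>words n (OutE A). \<Sum>g<G. ?a z g * rel_term (?q g k z') (?p g z'))
        = (\<Sum>k<K. \<Sum>z\<in>words p (OutE A). \<Sum>g<G. \<Sum>z'\<in>words n (OutE A). ?a z g * rel_term (?q g k z') (?p g z'))"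
        by (intro sum.cong refl sum.swap)
      also have "\<dots> = (\<Sum>k<K. \<Sum>g<G. \<Sum>z\<in>words p (OutE A). \<Sum>z'\<in>words n (OutE A). ?a z g * rel_term (?q g k z') (?p g z'))"
        by (intro sum.cong refl sum.swap)
      also have "\<dots> = (\<Sum>g<G. \<Sum>k<K. \<Sum>z\<in>words p (OutE A). \<Sum>z'\<in>words n (OutE A). ?a z g * rel_term (?q g k z') (?p g z'))"
        by (rule sum.swap)
      also have "\<dots> = (\<Sum>g<G. \<Sum>k<K. (\<Sum>z\<in>words p (OutE A). ?a z g) * (\<Sum>z'\<in>words n (OutE A). rel_term (?q g k z') (?p g z')))"
        by (simp only: sum_product)
      finally show ?thesis by (simp only: sum_distrib_left sum_divide_distrib)
    qed
    also have "\<dots> = (\<Sum>g<G. mut_inf K (words n (OutE A)) (?q g)) / real G"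
    proof -
      have "(\<Sum>z\<in>words p (OutE A). ?a z g) = 1 / real G" if "g < G" for g
        using sum_prodch[OF avwc_chV[OF avwc] s(1) c[OF that]] avwc by (simp flip: sum_divide_distrib)
      then show ?thesis unfolding mut_inf_def by (simp add: sum_divide_distrib mult.commute)
    qed
    finally have "cond_mi A (p + n) K 1 (\<lambda>_. e1) s \<le> cond_mi A n K G e s2"
      unfolding cond_mi_eq by simp
    then show ?thesis using s by blast
  qed
  show ?thesis using code1 err mi by blast
qed

end

section \<open>Reduction of the common randomness\<close>

lemma exists_good_sample:
  fixes X :: "'t \<Rightarrow> nat \<Rightarrow> real"
  assumes T: "finite T" and N: "1 \<le> N"
    and X0: "\<And>t \<gamma>. t \<in> T \<Longrightarrow> \<gamma> < N \<Longrightarrow> 0 \<le> X t \<gamma> \<and> X t \<gamma> \<le> 1"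
    and mean: "\<And>t. t \<in> T \<Longrightarrow> (\<Sum>\<gamma><N. X t \<gamma>) \<le> real N * \<mu> t"
  shows "\<exists>f. (\<forall>g<G. f g < N) \<and> (\<forall>t\<in>T. (\<Sum>g<G. X t (f g)) \<le> 2 * real G * \<mu> t + ln (real (card T)))"
proof (cases "T = {}")
  case True
  then show ?thesis using N by (intro exI[of _ "\<lambda>_. 0"]) auto
next
  case False
  let ?F = "words G {..<N}"
  let ?V = "\<lambda>t f. exp ((\<Sum>g<G. X t (f g)) - 2 * real G * \<mu> t)"
  have moment: "(\<Sum>f\<in>?F. ?V t f) \<le> real N ^ G" if t: "t \<in> T" for t
  proof -
    have "(\<Sum>\<gamma><N. exp (X t \<gamma>)) \<le> (\<Sum>\<gamma><N. 1 + 2 * X t \<gamma>)"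
    proof (rule sum_mono)
      fix \<gamma> assume "\<gamma> \<in> {..<N}"
      then have x: "0 \<le> X t \<gamma>" "X t \<gamma> \<le> 1" using X0[OF t] by auto
      have "exp (X t \<gamma>) \<le> 1 + X t \<gamma> + (X t \<gamma>)\<^sup>2" using x by (rule exp_bound)
      also have "(X t \<gamma>)\<^sup>2 \<le> X t \<gamma>" using x by (simp add: power2_eq_square mult_left_le)
      finally show "exp (X t \<gamma>) \<le> 1 + 2 * X t \<gamma>" by simp
    qed
    also have "\<dots> = real N + 2 * (\<Sum>\<gamma><N. X t \<gamma>)" by (simp add: sum.distrib sum_distrib_left)
    also have "\<dots> \<le> real N * (1 + 2 * \<mu> t)" using mean[OF t] by (simp add: algebra_simps)
    also have "\<dots> \<le> real N * exp (2 * \<mu> t)" by (intro mult_left_mono exp_ge_add_one_self) auto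
    finally have 1: "(\<Sum>\<gamma><N. exp (X t \<gamma>)) \<le> real N * exp (2 * \<mu> t)" .
    have "(\<Sum>f\<in>?F. ?V t f) = (\<Sum>f\<in>?F. \<Prod>g<G. exp (X t (f g))) * exp (- (2 * real G * \<mu> t))"
      by (simp add: exp_diff exp_minus exp_sum sum_distrib_right divide_inverse)
    also have "(\<Sum>f\<in>?F. \<Prod>g<G. exp (X t (f g))) = (\<Sum>\<gamma><N. exp (X t \<gamma>)) ^ G"
      by (subst sum_words_prod[of "{..<N}" "\<lambda>_ \<gamma>. exp (X t \<gamma>)"]) simp_all
    also have "\<dots> \<le> (real N * exp (2 * \<mu> t)) ^ G" using 1 by (intro power_mono sum_nonneg) auto
    also have "\<dots> = real N ^ G * exp (2 * real G * \<mu> t)"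
      by (simp add: power_mult_distrib mult_ac flip: exp_of_nat_mult)
    finally show ?thesis by (simp add: exp_minus field_simps)
  qed
  have "(\<Sum>f\<in>?F. \<Sum>t\<in>T. ?V t f) = (\<Sum>t\<in>T. \<Sum>f\<in>?F. ?V t f)" by (rule sum.swap)
  also have "\<dots> \<le> (\<Sum>t\<in>T. real N ^ G)" using moment by (rule sum_mono)
  also have "\<dots> = (\<Sum>f\<in>?F. real (card T))" by (simp add: card_words)
  finally have le: "(\<Sum>f\<in>?F. \<Sum>t\<in>T. ?V t f) \<le> (\<Sum>f\<in>?F. real (card T))" .
  have "?F \<noteq> {}" using N by (intro words_nonempty) (simp add: lessThan_empty_iff)
  then have "\<exists>f\<in>?F. (\<Sum>t\<in>T. ?V t f) \<le> real (card T)"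
    using le sum_strict_mono[of ?F "\<lambda>_. real (card T)" "\<lambda>f. \<Sum>t\<in>T. ?V t f"]
    by (meson finite_lessThan finite_words not_le)
  then obtain f where f: "f \<in> ?F" "(\<Sum>t\<in>T. ?V t f) \<le> real (card T)" by blast
  have "(\<Sum>g<G. X t (f g)) \<le> 2 * real G * \<mu> t + ln (real (card T))" if t: "t \<in> T" for t
  proof -
    have "?V t f \<le> (\<Sum>t\<in>T. ?V t f)" using t T by (intro member_le_sum) auto
    then have "?V t f \<le> real (card T)" using f(2) by linarith
    then have "(\<Sum>g<G. X t (f g)) - 2 * real G * \<mu> t \<le> ln (real (card T))"
      using False T by (subst ln_ge_iff) (auto simp: card_gt_0_iff)
    then show ?thesis by simp
  qed
  then show ?thesis using words_nth[OF f(1)] by blast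
qed

context
  fixes A :: "('s, 'x, 'y, 'z) avwc"
  assumes avwc: "is_avwc A"
begin

lemma reduce_randomness:
  assumes code: "is_code A n K \<Gamma> e D" and G: "1 \<le> G"
    and l: "\<And>s. s \<in> words n (St A) \<Longrightarrow> cond_mi A n K \<Gamma> e s \<le> l"
  defines "r \<equiv> ln (2 * real (card (St A)) ^ n) / real G"
  shows "\<exists>e' D'. is_code A n K G e' D' \<and> code_err A n K G e' D' \<le> 2 * code_err A n K \<Gamma> e D + r \<and>
     (\<forall>s\<in>words n (St A). cond_mi A n K G e' s \<le> 2 * l + (log 2 (real K) + 1) * r)"
proof -
  have KG: "K \<ge> 1" "\<Gamma> \<ge> 1" using code unfolding is_code_def by auto
  define L where "L = log 2 (real K) + 1"
  have L: "L > 0" unfolding L_def using KG by (simp add: add_nonneg_pos)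
  let ?I = "\<lambda>s \<gamma>. mut_inf K (words n (OutE A)) (\<lambda>k. eve_out A n (e \<gamma> k) s)"
  let ?S = "\<lambda>s \<gamma>. succ_prob A n K (e \<gamma>) (D \<gamma>) s"
  have I: "0 \<le> ?I s \<gamma>" "?I s \<gamma> \<le> L" if "s \<in> words n (St A)" "\<gamma> < \<Gamma>" for s \<gamma>
  proof -
    show "0 \<le> ?I s \<gamma>" using eve_out_nonneg[OF avwc code] that by (intro mut_inf_nonneg) auto
    have "?I s \<gamma> \<le> log 2 (real K)"
      using eve_out_nonneg[OF avwc code] sum_eve_out[OF avwc code] that KG by (intro mut_inf_le) auto
    then show "?I s \<gamma> \<le> L" unfolding L_def by simp
  qed
  let ?T = "words n (St A) \<times> (UNIV :: bool set)"
  define X where "X = (\<lambda>(s, b) \<gamma>. if b then ?I s \<gamma> / L else 1 - ?S s \<gamma>)"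
  define \<mu> where "\<mu> = (\<lambda>(s :: nat \<Rightarrow> 's, b). if b then l / L else code_err A n K \<Gamma> e D)"
  have cT: "real (card ?T) = 2 * real (card (St A)) ^ n" by (simp add: card_cartesian_product card_words)
  have "\<exists>f. (\<forall>g<G. f g < \<Gamma>) \<and> (\<forall>t\<in>?T. (\<Sum>g<G. X t (f g)) \<le> 2 * real G * \<mu> t + ln (real (card ?T)))"
  proof (rule exists_good_sample)
    show "finite ?T" using avwc by auto
    show "1 \<le> \<Gamma>" by (rule KG)
    show "0 \<le> X t \<gamma> \<and> X t \<gamma> \<le> 1" if "t \<in> ?T" "\<gamma> < \<Gamma>" for t \<gamma>
      using that I succ_prob_bounds[OF avwc code] L unfolding X_def by auto
    show "(\<Sum>\<gamma><\<Gamma>. X t \<gamma>) \<le> real \<Gamma> * \<mu> t" if t: "t \<in> ?T" for t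
    proof -
      obtain s b where sb: "t = (s, b)" "s \<in> words n (St A)" using t by auto
      have "(\<Sum>\<gamma><\<Gamma>. ?I s \<gamma>) / real \<Gamma> \<le> l" using l[OF sb(2)] unfolding cond_mi_eq .
      then have "(\<Sum>\<gamma><\<Gamma>. ?I s \<gamma>) \<le> real \<Gamma> * l" using KG by (simp add: field_simps)
      then have 1: "(\<Sum>\<gamma><\<Gamma>. ?I s \<gamma> / L) \<le> real \<Gamma> * (l / L)"
        using L by (simp add: divide_right_mono flip: sum_divide_distrib)
      have "1 - code_err A n K \<Gamma> e D \<le> (\<Sum>\<gamma><\<Gamma>. ?S s \<gamma>) / real \<Gamma>"
        using code_err_le_iff[OF avwc, of n K \<Gamma> e D "code_err A n K \<Gamma> e D"] sb by blast
      then have "(\<Sum>\<gamma><\<Gamma>. 1 - ?S s \<gamma>) \<le> real \<Gamma> * code_err A n K \<Gamma> e D"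
        using KG by (simp add: sum_subtractf field_simps)
      then show ?thesis unfolding X_def \<mu>_def sb using 1 by auto
    qed
  qed
  then obtain f where f: "\<And>g. g < G \<Longrightarrow> f g < \<Gamma>"
    and fX: "\<And>t. t \<in> ?T \<Longrightarrow> (\<Sum>g<G. X t (f g)) \<le> 2 * real G * \<mu> t + ln (real (card ?T))" by blast
  have r: "real G * r = ln (real (card ?T))" unfolding r_def cT using G by simp
  have "is_code A n K G (\<lambda>g. e (f g)) (\<lambda>g. D (f g))"
    using code f G unfolding is_code_def by auto
  moreover have "code_err A n K G (\<lambda>g. e (f g)) (\<lambda>g. D (f g)) \<le> 2 * code_err A n K \<Gamma> e D + r"
    unfolding code_err_le_iff[OF avwc]
  proof
    fix s assume s: "s \<in> words n (St A)"
    have "(\<Sum>g<G. 1 - ?S s (f g)) \<le> 2 * real G * code_err A n K \<Gamma> e D + real G * r"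
      using fX[of "(s, False)"] s unfolding r X_def \<mu>_def by simp
    then have "real G * (1 - (2 * code_err A n K \<Gamma> e D + r)) \<le> (\<Sum>g<G. ?S s (f g))"
      by (simp add: sum_subtractf algebra_simps)
    then show "1 - (2 * code_err A n K \<Gamma> e D + r) \<le> (\<Sum>g<G. ?S s (f g)) / real G"
      using G by (simp add: field_simps)
  qed
  moreover have "cond_mi A n K G (\<lambda>g. e (f g)) s \<le> 2 * l + L * r" if s: "s \<in> words n (St A)" for s
  proof -
    have "(\<Sum>g<G. ?I s (f g) / L) \<le> 2 * real G * (l / L) + real G * r"
      using fX[of "(s, True)"] s unfolding r X_def \<mu>_def by simp
    then have "(\<Sum>g<G. ?I s (f g)) \<le> (2 * real G * (l / L) + real G * r) * L"
      using L by (simp add: pos_divide_le_eq flip: sum_divide_distrib)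
    also have "\<dots> = real G * (2 * l + L * r)" using L by (simp add: algebra_simps)
    finally show ?thesis unfolding cond_mi_eq using G by (simp add: field_simps)
  qed
  ultimately show ?thesis unfolding L_def by blast
qed

end

section \<open>The secrecy capacity of symmetrizable channels\<close>

lemma rate_nonpos_if_bounded:
  assumes K: "\<forall>\<^sub>F n in sequentially. 1 \<le> K n \<and> K n \<le> b" and R: "liminf (\<lambda>n. ereal (log 2 (real (K n)) / real n)) = ereal R"
  shows "R \<le> 0"
proof -
  have "(\<lambda>n. log 2 (real b) / real n) \<longlonglongrightarrow> 0" by real_asymp
  then have "(\<lambda>n. ereal (log 2 (real b) / real n)) \<longlonglongrightarrow> 0" by (simp add: zero_ereal_def)
  then have "liminf (\<lambda>n. ereal (log 2 (real b) / real n)) = 0" by (intro lim_imp_Liminf) auto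
  moreover have "liminf (\<lambda>n. ereal (log 2 (real (K n)) / real n)) \<le> liminf (\<lambda>n. ereal (log 2 (real b) / real n))"
    using K by (intro Liminf_mono) (auto elim!: eventually_mono intro!: divide_right_mono)
  ultimately show ?thesis using R by simp
qed

context
  fixes A :: "('s, 'x, 'y, 'z) avwc"
  assumes avwc: "is_avwc A"
begin

lemma achievableI:
  assumes "nocr \<Longrightarrow> \<forall>n. G n = 1" and code: "\<And>n. is_code A n (K n) (G n) (e n) (D n)"
    and "(\<lambda>n. code_err A n (K n) (G n) (e n) (D n)) \<longlonglongrightarrow> 0"
    and "liminf (\<lambda>n. ereal (log 2 (real (K n)) / real n)) = ereal R"
    and leak: "\<forall>\<^sub>F n in sequentially. \<forall>s\<in>words n (St A). cond_mi A n (K n) (G n) (e n) s \<le> h n"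
    and h: "h \<longlonglongrightarrow> 0"
  shows "achievable nocr A R"
proof -
  let ?m = "\<lambda>n. Max ((\<lambda>s. cond_mi A n (K n) (G n) (e n) s) ` words n (St A))"
  have fin: "finite (words n (St A))" "words n (St A) \<noteq> {}" for n using avwc words_nonempty[of "St A"] by auto
  have "?m \<longlonglongrightarrow> 0"
  proof (rule tendsto_sandwich[OF _ _ tendsto_const h])
    show "\<forall>\<^sub>F n in sequentially. 0 \<le> ?m n"
    proof (intro always_eventually allI)
      fix n
      obtain s where s: "s \<in> words n (St A)" using fin by blast
      have "0 \<le> cond_mi A n (K n) (G n) (e n) s" by (rule cond_mi_nonneg[OF avwc code s])
      also have "\<dots> \<le> ?m n" using s fin by (intro Max_ge) auto
      finally show "0 \<le> ?m n" .
    qed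
    show "\<forall>\<^sub>F n in sequentially. ?m n \<le> h n"
      using leak by eventually_elim (use fin in \<open>simp add: Max_le_iff\<close>)
  qed
  then have "(\<lambda>n. ereal (?m n)) \<longlonglongrightarrow> 0" by (simp add: zero_ereal_def)
  then have "limsup (\<lambda>n. ereal (?m n)) = 0" by (intro lim_imp_Limsup) auto
  then show ?thesis unfolding achievable_def using assms by blast
qed

lemma achievableE:
  assumes "achievable nocr A R"
  obtains K G e D h where "\<forall>n. is_code A n (K n) (G n) (e n) (D n)" "nocr \<longrightarrow> (\<forall>n. G n = 1)"
    "(\<lambda>n. code_err A n (K n) (G n) (e n) (D n)) \<longlonglongrightarrow> 0"
    "liminf (\<lambda>n. ereal (log 2 (real (K n)) / real n)) = ereal R"
    "\<forall>n. \<forall>s\<in>words n (St A). cond_mi A n (K n) (G n) (e n) s \<le> h n" "h \<longlonglongrightarrow> 0"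
proof -
  obtain K G e D where *: "nocr \<longrightarrow> (\<forall>n. G n = 1)" and code: "\<And>n. is_code A n (K n) (G n) (e n) (D n)"
    and **: "(\<lambda>n. code_err A n (K n) (G n) (e n) (D n)) \<longlonglongrightarrow> 0"
    "liminf (\<lambda>n. ereal (log 2 (real (K n)) / real n)) = ereal R"
    and ls: "limsup (\<lambda>n. ereal (Max ((\<lambda>s. cond_mi A n (K n) (G n) (e n) s) ` words n (St A)))) = 0"
    using assms unfolding achievable_def by blast
  define h where "h n = Max ((\<lambda>s. cond_mi A n (K n) (G n) (e n) s) ` words n (St A))" for n
  have fin: "finite (words n (St A))" "words n (St A) \<noteq> {}" for n using avwc words_nonempty[of "St A"] by auto
  have le: "cond_mi A n (K n) (G n) (e n) s \<le> h n" if "s \<in> words n (St A)" for n s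
    unfolding h_def using that fin by (intro Max_ge) auto
  have h0: "0 \<le> h n" for n
    using le[of _ n] cond_mi_nonneg[OF avwc code, of _ n] fin(2)[of n] by (meson all_not_in_conv order_trans)
  have "0 \<le> liminf (\<lambda>n. ereal (h n))" using h0 by (intro Liminf_bounded) auto
  moreover have "liminf (\<lambda>n. ereal (h n)) \<le> limsup (\<lambda>n. ereal (h n))" by (intro Liminf_le_Limsup) simp
  ultimately have "(\<lambda>n. ereal (h n)) \<longlonglongrightarrow> 0" using ls unfolding h_def[symmetric]
    by (simp add: tendsto_iff_Liminf_eq_Limsup)
  then have "h \<longlonglongrightarrow> 0" by (simp add: zero_ereal_def)
  then show thesis using that[of K G e D h] * code ** le by blast
qed

lemma trivial_code:
  "\<exists>e D. is_code A n 1 1 e D \<and> code_err A n 1 1 e D = 0 \<and> (\<forall>s. cond_mi A n 1 1 e s = 0)"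
proof -
  obtain x where x: "x \<in> words n (Inp A)" using words_nonempty[of "Inp A" n] avwc by auto
  define e where "e = (\<lambda>(g::nat) (k::nat) w. of_bool (w = x) :: real)"
  define D where "D = (\<lambda>(g::nat) (k::nat). words n (OutB A))"
  have code: "is_code A n 1 1 e D" unfolding is_code_def e_def D_def
    using sum_of_bool_point[of "words n (Inp A)" x "\<lambda>_. 1"] x avwc by auto
  have "code_err A n 1 1 e D \<le> 0"
    unfolding code_err_le_iff[OF avwc] succ_prob_def e_def D_def
    using sum_of_bool_point[of "words n (Inp A)" x] x avwc dprob_words[OF avwc] by (simp add: lessThan_Suc)
  moreover have "cond_mi A n 1 1 e s = 0" for s
    unfolding cond_mi_eq mut_inf_def by (auto simp: lessThan_Suc rel_term_def intro!: sum.neutral)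
  ultimately show ?thesis using code code_err_nonneg[OF avwc code] by (metis order_antisym)
qed

lemma achievable_0: "achievable nocr A 0"
proof -
  have "\<forall>n. \<exists>p. is_code A n 1 1 (fst p) (snd p) \<and> code_err A n 1 1 (fst p) (snd p) = 0 \<and> (\<forall>s. cond_mi A n 1 1 (fst p) s = 0)"
    using trivial_code by simp
  then obtain p where p: "\<And>n. is_code A n 1 1 (fst (p n)) (snd (p n)) \<and> code_err A n 1 1 (fst (p n)) (snd (p n)) = 0 \<and> (\<forall>s. cond_mi A n 1 1 (fst (p n)) s = 0)"
    by metis
  show ?thesis
  proof (rule achievableI[where K = "\<lambda>_. 1" and G = "\<lambda>_. 1" and e = "\<lambda>n. fst (p n)" and D = "\<lambda>n. snd (p n)" and h = "\<lambda>_. 0"])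
    show "liminf (\<lambda>n. ereal (log 2 (real 1) / real n)) = ereal 0" by (simp add: Liminf_const)
  qed (use p in auto)
qed

lemma C_S_nonneg: "0 \<le> C_S A"
  unfolding C_S_def by (rule Sup_upper) (use achievable_0[of True] in \<open>force simp: zero_ereal_def\<close>)

lemma C_S_le_C_mean_ran: "C_S A \<le> C_mean_ran A"
proof -
  have "achievable True A R \<Longrightarrow> achievable False A R" for R unfolding achievable_def by blast
  then show ?thesis unfolding C_S_def C_mean_ran_def by (intro Sup_subset_mono) auto
qed

lemma C_S_eq_0I:
  assumes "\<And>R. achievable True A R \<Longrightarrow> R \<le> 0"
  shows "C_S A = 0"
proof (rule order_antisym[OF _ C_S_nonneg])
  show "C_S A \<le> 0" unfolding C_S_def using assms by (intro Sup_least) auto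
qed

text \<open>The jammer encodes a random message itself and passes the codeword through the
  symmetrizing channel; Bob cannot tell the two messages apart.\<close>
lemma symmetrizable_succ_le:
  assumes "symmetrizable A" and code: "is_code A n K 1 e D"
  shows "real K * (1 - code_err A n K 1 e D) \<le> (real K + 1) / 2"
proof -
  obtain u where u: "channel (Inp A) (St A) u"
    and sym: "\<And>x x' y. x \<in> Inp A \<Longrightarrow> x' \<in> Inp A \<Longrightarrow> y \<in> OutB A \<Longrightarrow>
       (\<Sum>s\<in>St A. u x s * chW A s x' y) = (\<Sum>s\<in>St A. u x' s * chW A s x y)"
    using assms(1) unfolding symmetrizable_def by blast
  let ?X = "words n (Inp A)" and ?S = "words n (St A)" and ?Y = "words n (OutB A)"
  let ?c = "1 - code_err A n K 1 e D"
  define v where "v x s = (\<Prod>i<n. u (x i) (s i))" for x s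
  define B where "B x x' y = (\<Sum>s\<in>?S. v x' s * prodch n (chW A) s x y)" for x x' y
  have K: "K \<ge> 1" using code unfolding is_code_def by blast
  have e: "\<And>x. x \<in> ?X \<Longrightarrow> 0 \<le> e 0 k x" "(\<Sum>x\<in>?X. e 0 k x) = 1" and D: "D 0 k \<subseteq> ?Y" if "k < K" for k
    using code that unfolding is_code_def by auto
  have fin: "finite ?X" "finite ?S" "finite ?Y" using avwc by auto
  have v0: "0 \<le> v x s" if "x \<in> ?X" "s \<in> ?S" for x s
    unfolding v_def using u words_nth[OF that(1)] words_nth[OF that(2)] by (intro prod_nonneg) (auto simp: channel_def)
  have v1: "(\<Sum>s\<in>?S. v x s) = 1" if "x \<in> ?X" for x
    unfolding v_def using u words_nth[OF that] avwc
    by (subst sum_words_prod[of "St A" "\<lambda>i. u (x i)"]) (auto simp: channel_def intro!: prod.neutral)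
  have B_prod: "B x x' y = (\<Prod>i<n. \<Sum>s\<in>St A. u (x' i) s * chW A s (x i) (y i))" for x x' y
    unfolding B_def v_def prodch_def using avwc
    by (subst sum_words_prod[of "St A" "\<lambda>i s. u (x' i) s * chW A s (x i) (y i)", symmetric]) (simp_all add: prod.distrib)
  have B_sym: "B x x' y = B x' x y" if "x \<in> ?X" "x' \<in> ?X" "y \<in> ?Y" for x x' y
    unfolding B_prod using sym words_nth[OF that(1)] words_nth[OF that(2)] words_nth[OF that(3)]
    by (intro prod.cong) auto
  have B0: "0 \<le> B x x' y" if "x \<in> ?X" "x' \<in> ?X" "y \<in> ?Y" for x x' y
    unfolding B_def using v0 that prodch_nonneg[OF avwc_chW[OF avwc]] by (intro sum_nonneg mult_nonneg_nonneg) auto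
  have B1: "(\<Sum>y\<in>?Y. B x x' y) = 1" if "x \<in> ?X" "x' \<in> ?X" for x x'
  proof -
    have "(\<Sum>y\<in>?Y. B x x' y) = (\<Sum>s\<in>?S. v x' s * (\<Sum>y\<in>?Y. prodch n (chW A) s x y))"
      unfolding B_def by (subst sum.swap) (simp add: sum_distrib_left)
    also have "\<dots> = (\<Sum>s\<in>?S. v x' s)" using sum_prodch[OF avwc_chW[OF avwc] _ that(1)] avwc by simp
    finally show ?thesis using v1[OF that(2)] by simp
  qed
  define M where "M k k' y = (\<Sum>x\<in>?X. \<Sum>x'\<in>?X. e 0 k x * e 0 k' x' * B x x' y)" for k k' y
  have M_sym: "M k k' y = M k' k y" if "k < K" "k' < K" "y \<in> ?Y" for k k' y
  proof -
    have "M k k' y = (\<Sum>x'\<in>?X. \<Sum>x\<in>?X. e 0 k x * e 0 k' x' * B x x' y)" unfolding M_def by (rule sum.swap)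
    also have "\<dots> = M k' k y" unfolding M_def using B_sym that(3) by (intro sum.cong refl) (simp add: mult_ac)
    finally show ?thesis .
  qed
  have M0: "0 \<le> M k k' y" if "k < K" "k' < K" "y \<in> ?Y" for k k' y
    unfolding M_def using e that B0 by (intro sum_nonneg mult_nonneg_nonneg) auto
  have M1: "(\<Sum>y\<in>?Y. M k k' y) = 1" if "k < K" "k' < K" for k k'
  proof -
    have "(\<Sum>y\<in>?Y. M k k' y) = (\<Sum>x\<in>?X. \<Sum>x'\<in>?X. e 0 k x * e 0 k' x' * (\<Sum>y\<in>?Y. B x x' y))"
      unfolding M_def by (subst sum.swap) (simp add: sum.swap[of _ ?Y ?X] sum_distrib_left)
    also have "\<dots> = (\<Sum>x\<in>?X. e 0 k x) * (\<Sum>x'\<in>?X. e 0 k' x')" using B1 by (simp add: sum_product)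
    finally show ?thesis using e that by simp
  qed
  have MD: "(\<Sum>y\<in>D 0 j. M k k' y) \<le> 1" if "k < K" "k' < K" "j < K" for j k k'
    unfolding M1[OF that(1,2), symmetric] using D that M0 fin by (intro sum_mono2) auto
  have key: "real K * ?c \<le> (\<Sum>k<K. \<Sum>y\<in>D 0 k. M k k' y)" if k': "k' < K" for k'
  proof -
    have "real K * ?c \<le> (\<Sum>k<K. \<Sum>x\<in>?X. e 0 k x * dprob n A s x (D 0 k))" if "s \<in> ?S" for s
    proof -
      have "?c \<le> (\<Sum>g<1. succ_prob A n K (e g) (D g) s) / real 1"
        using code_err_le_iff[OF avwc, of n K 1 e D "code_err A n K 1 e D"] that by blast
      then show ?thesis unfolding succ_prob_def using K by (simp add: lessThan_Suc field_simps)
    qed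
    then have "(\<Sum>x'\<in>?X. e 0 k' x' * (\<Sum>s\<in>?S. v x' s * (real K * ?c)))
       \<le> (\<Sum>x'\<in>?X. e 0 k' x' * (\<Sum>s\<in>?S. v x' s * (\<Sum>k<K. \<Sum>x\<in>?X. e 0 k x * dprob n A s x (D 0 k))))"
      using e[OF k'] v0 by (intro sum_mono mult_left_mono) auto
    also have "(\<Sum>x'\<in>?X. e 0 k' x' * (\<Sum>s\<in>?S. v x' s * (real K * ?c))) = real K * ?c"
      using e[OF k'] v1 by (simp flip: sum_distrib_right)
    also have "(\<Sum>x'\<in>?X. e 0 k' x' * (\<Sum>s\<in>?S. v x' s * (\<Sum>k<K. \<Sum>x\<in>?X. e 0 k x * dprob n A s x (D 0 k))))
       = (\<Sum>x'\<in>?X. \<Sum>k<K. \<Sum>x\<in>?X. \<Sum>y\<in>D 0 k. e 0 k x * e 0 k' x' * B x x' y)"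
    proof (rule sum.cong[OF refl])
      fix x' assume "x' \<in> ?X"
      have "e 0 k' x' * (\<Sum>s\<in>?S. v x' s * (\<Sum>k<K. \<Sum>x\<in>?X. e 0 k x * dprob n A s x (D 0 k)))
         = (\<Sum>s\<in>?S. \<Sum>k<K. \<Sum>x\<in>?X. \<Sum>y\<in>D 0 k. e 0 k x * e 0 k' x' * (v x' s * prodch n (chW A) s x y))"
        unfolding dprob_def sum_distrib_left by (intro sum.cong refl) (simp add: mult_ac)
      also have "\<dots> = (\<Sum>k<K. \<Sum>s\<in>?S. \<Sum>x\<in>?X. \<Sum>y\<in>D 0 k. e 0 k x * e 0 k' x' * (v x' s * prodch n (chW A) s x y))"
        by (rule sum.swap)
      also have "\<dots> = (\<Sum>k<K. \<Sum>x\<in>?X. \<Sum>s\<in>?S. \<Sum>y\<in>D 0 k. e 0 k x * e 0 k' x' * (v x' s * prodch n (chW A) s x y))"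
        by (intro sum.cong refl sum.swap)
      also have "\<dots> = (\<Sum>k<K. \<Sum>x\<in>?X. \<Sum>y\<in>D 0 k. \<Sum>s\<in>?S. e 0 k x * e 0 k' x' * (v x' s * prodch n (chW A) s x y))"
        by (intro sum.cong refl sum.swap)
      finally show "e 0 k' x' * (\<Sum>s\<in>?S. v x' s * (\<Sum>k<K. \<Sum>x\<in>?X. e 0 k x * dprob n A s x (D 0 k)))
        = (\<Sum>k<K. \<Sum>x\<in>?X. \<Sum>y\<in>D 0 k. e 0 k x * e 0 k' x' * B x x' y)"
        unfolding B_def by (simp only: sum_distrib_left)
    qed
    also have "\<dots> = (\<Sum>k<K. \<Sum>x'\<in>?X. \<Sum>x\<in>?X. \<Sum>y\<in>D 0 k. e 0 k x * e 0 k' x' * B x x' y)"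
      by (rule sum.swap)
    also have "\<dots> = (\<Sum>k<K. \<Sum>x\<in>?X. \<Sum>x'\<in>?X. \<Sum>y\<in>D 0 k. e 0 k x * e 0 k' x' * B x x' y)"
      by (intro sum.cong refl sum.swap)
    also have "\<dots> = (\<Sum>k<K. \<Sum>x\<in>?X. \<Sum>y\<in>D 0 k. \<Sum>x'\<in>?X. e 0 k x * e 0 k' x' * B x x' y)"
      by (intro sum.cong refl sum.swap)
    also have "\<dots> = (\<Sum>k<K. \<Sum>y\<in>D 0 k. M k k' y)" unfolding M_def by (intro sum.cong refl sum.swap)
    finally show ?thesis .
  qed
  have "2 * (real K * (real K * ?c)) = 2 * (\<Sum>k'<K. real K * ?c)" by simp
  also have "\<dots> \<le> 2 * (\<Sum>k'<K. \<Sum>k<K. \<Sum>y\<in>D 0 k. M k k' y)"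
    using key by (intro mult_left_mono sum_mono) auto
  also have "\<dots> = (\<Sum>k'<K. \<Sum>k<K. \<Sum>y\<in>D 0 k. M k k' y) + (\<Sum>k'<K. \<Sum>k<K. \<Sum>y\<in>D 0 k'. M k k' y)"
  proof -
    have "(\<Sum>k'<K. \<Sum>k<K. \<Sum>y\<in>D 0 k. M k k' y) = (\<Sum>k<K. \<Sum>k'<K. \<Sum>y\<in>D 0 k. M k' k y)"
      using M_sym D by (subst sum.swap) (intro sum.cong refl, simp, blast)
    then show ?thesis by simp
  qed
  also have "\<dots> = (\<Sum>k'<K. \<Sum>k<K. (\<Sum>y\<in>D 0 k. M k k' y) + (\<Sum>y\<in>D 0 k'. M k k' y))"
    by (simp add: sum.distrib)
  also have "\<dots> \<le> (\<Sum>k'<K. \<Sum>k<K. 1 + of_bool (k = k'))"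
  proof (intro sum_mono)
    fix k' k assume k: "k' \<in> {..<K}" "k \<in> {..<K}"
    show "(\<Sum>y\<in>D 0 k. M k k' y) + (\<Sum>y\<in>D 0 k'. M k k' y) \<le> 1 + of_bool (k = k')"
    proof (cases "k = k'")
      case True
      then show ?thesis using MD k by (intro add_mono) auto
    next
      case False
      have "D 0 k \<inter> D 0 k' = {}" using code k False unfolding is_code_def by auto
      then have "(\<Sum>y\<in>D 0 k. M k k' y) + (\<Sum>y\<in>D 0 k'. M k k' y) = (\<Sum>y\<in>D 0 k \<union> D 0 k'. M k k' y)"
        using D k fin by (intro sum.union_disjoint[symmetric]) (auto intro: finite_subset)
      also have "\<dots> \<le> (\<Sum>y\<in>?Y. M k k' y)" using D k M0 fin by (intro sum_mono2) auto
      finally show ?thesis using M1 k False by simp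
    qed
  qed
  also have "\<dots> = real K * (real K + 1)"
    by (simp add: sum.distrib of_bool_def algebra_simps)
  finally have "real K * (2 * (real K * ?c)) \<le> real K * (real K + 1)" by (simp only: mult_ac)
  then have "2 * (real K * ?c) \<le> real K + 1" using K by (simp only: mult_le_cancel_left)
  then show ?thesis by simp
qed

lemma symmetrizable_C_S:
  assumes "symmetrizable A"
  shows "C_S A = 0"
proof (rule C_S_eq_0I)
  fix R assume "achievable True A R"
  then obtain K G e D h where code: "\<forall>n. is_code A n (K n) (G n) (e n) (D n)" and G: "True \<longrightarrow> (\<forall>n. G n = 1)"
    and err: "(\<lambda>n. code_err A n (K n) (G n) (e n) (D n)) \<longlonglongrightarrow> 0"
    and R: "liminf (\<lambda>n. ereal (log 2 (real (K n)) / real n)) = ereal R"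
    and "\<forall>n. \<forall>s\<in>words n (St A). cond_mi A n (K n) (G n) (e n) s \<le> h n" "h \<longlonglongrightarrow> 0"
    by (rule achievableE)
  have "\<forall>\<^sub>F n in sequentially. code_err A n (K n) (G n) (e n) (D n) < 1 / 4"
    using err by (rule order_tendstoD) simp
  then have "\<forall>\<^sub>F n in sequentially. 1 \<le> K n \<and> K n \<le> 1"
  proof eventually_elim
    case (elim n)
    have G1: "G n = 1" using G by simp
    have K1: "1 \<le> K n" using code unfolding is_code_def by blast
    have "real (K n) * (1 - 1 / 4) \<le> real (K n) * (1 - code_err A n (K n) 1 (e n) (D n))"
      using elim G1 by (intro mult_left_mono) auto
    also have "\<dots> \<le> (real (K n) + 1) / 2" using symmetrizable_succ_le[OF assms] code G1 by metis
    finally have "real (K n) \<le> 2" by simp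
    moreover have "real (K n) * (1 - code_err A n (K n) 1 (e n) (D n)) > real (K n) * (3 / 4)"
      using elim G1 K1 by (intro mult_strict_left_mono) auto
    moreover have "real (K n) * (1 - code_err A n (K n) 1 (e n) (D n)) \<le> (real (K n) + 1) / 2"
      using symmetrizable_succ_le[OF assms] code G1 by metis
    ultimately have "real (K n) < 2" by argo
    then show ?case using K1 by simp
  qed
  then show "R \<le> 0" using R by (rule rate_nonpos_if_bounded)
qed

end

section \<open>The secrecy capacity of non-symmetrizable channels\<close>

lemma liminf_compose_ge:
  fixes v :: "nat \<Rightarrow> ereal"
  assumes "filterlim n at_top sequentially"
  shows "liminf v \<le> liminf (\<lambda>l. v (n l))"
proof -
  have "liminf v \<le> Liminf (filtermap n sequentially) v"
    using assms unfolding filterlim_def by (simp add: Liminf_def le_filter_def SUP_subset_mono Collect_mono)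
  also have "\<dots> \<le> liminf (\<lambda>l. v (n l))" by (rule Liminf_filtermap_le)
  finally show ?thesis .
qed

context
  fixes A :: "('s, 'x, 'y, 'z) avwc"
  assumes avwc: "is_avwc A"
begin

lemma messages_rate_le:
  assumes "is_code A n K G e D" "code_err A n K G e D \<le> 1 / 2"
  shows "log 2 (real K) \<le> 1 + real n * log 2 (real (card (OutB A)))"
proof -
  have K: "K \<ge> 1" using assms(1) unfolding is_code_def by blast
  have Y: "card (OutB A) > 0" using avwc by (simp add: card_gt_0_iff)
  have "real K * (1 / 2) \<le> real K * (1 - code_err A n K G e D)" using assms(2) by (intro mult_left_mono) auto
  also have "\<dots> \<le> real (card (OutB A) ^ n)" by (rule card_messages_le[OF avwc assms(1)])
  finally have "real K \<le> 2 * real (card (OutB A)) ^ n" by simp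
  then have "log 2 (real K) \<le> log 2 (2 * real (card (OutB A)) ^ n)" using K Y by simp
  also have "\<dots> = 1 + real n * log 2 (real (card (OutB A)))"
    using Y by (simp add: log_mult log_nat_power)
  finally show ?thesis .
qed

lemma not_symmetrizable_C_S_ge:
  assumes ns: "\<not> symmetrizable A" and R: "achievable False A R"
  shows "ereal R \<le> C_S A"
proof -
  obtain K \<Gamma> e D h where code_all: "\<forall>n. is_code A n (K n) (\<Gamma> n) (e n) (D n)" and "False \<longrightarrow> (\<forall>n. \<Gamma> n = 1)"
    and err: "(\<lambda>n. code_err A n (K n) (\<Gamma> n) (e n) (D n)) \<longlonglongrightarrow> 0"
    and rate: "liminf (\<lambda>n. ereal (log 2 (real (K n)) / real n)) = ereal R"
    and leak_all: "\<forall>n. \<forall>s\<in>words n (St A). cond_mi A n (K n) (\<Gamma> n) (e n) s \<le> h n" and h: "h \<longlonglongrightarrow> 0"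
    using R by (rule achievableE[OF avwc])
  note code = spec[OF code_all] and leak = bspec[OF spec[OF leak_all]]
  define \<epsilon> where "\<epsilon> n = code_err A n (K n) (\<Gamma> n) (e n) (D n)" for n
  have \<epsilon>: "\<epsilon> \<longlonglongrightarrow> 0" using err unfolding \<epsilon>_def .
  obtain C where C: "C > 0" "\<And>N. \<exists>c D. det_code A (card (Inp A) ^ N) N c D (C / real N)"
    using block_code[OF avwc ns] by blast
  define q where "q = real (card (Inp A))"
  define qL where "qL = ln q"
  have q: "q \<ge> 2" using not_symmetrizable_card_ge_2[OF avwc ns] unfolding q_def by simp
  then have qL: "qL > 0" unfolding qL_def by simp
  text \<open>A prefix made of \<open>t\<close> blocks over \<open>N\<close> messages carries \<open>N ^ t \<ge> l ^ 3\<close> values.\<close>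
  define N where "N l = nat \<lfloor>ln (real l) / (2 * qL)\<rfloor>" for l :: nat
  define t where "t l = nat \<lceil>3 * ln (real l) / ln (real (N l))\<rceil>" for l
  define p where "p l = t l * card (Inp A) ^ N l" for l
  define n where "n l = l - p l" for l
  define b where "b l = ln (real l) / (2 * qL) - 1" for l :: nat
  have "filterlim b at_top sequentially" unfolding b_def using qL by real_asymp
  then have ev_b: "\<forall>\<^sub>F l in sequentially. 2 \<le> b l" by (simp add: filterlim_at_top)
  have Nb: "b l \<le> real (N l)" for l unfolding N_def b_def by linarith
  have ev_N: "\<forall>\<^sub>F l in sequentially. 2 \<le> N l"
    using ev_b
  proof eventually_elim
    case (elim l)
    then have "2 \<le> real (N l)" using Nb[of l] by linarith
    then show ?case by simp
  qed
  have ev_NN: "\<forall>\<^sub>F l in sequentially. q ^ N l \<le> sqrt (real l)"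
    using eventually_gt_at_top[of 0]
  proof eventually_elim
    case (elim l)
    have "real (N l) \<le> ln (real l) / (2 * qL)" unfolding N_def using elim qL by simp
    then have "real (N l) * ln q \<le> ln (real l) / 2" using qL unfolding qL_def by (simp add: field_simps)
    then have "exp (real (N l) * ln q) \<le> exp (ln (real l) / 2)" by simp
    moreover have "exp (real (N l) * ln q) = q ^ N l" using q by (simp add: exp_of_nat_mult)
    moreover have "exp (ln (real l) / 2) = sqrt (real l)"
      using elim by (simp flip: powr_half_sqrt add: powr_def)
    ultimately show ?case by simp
  qed
  have ev_t: "\<forall>\<^sub>F l in sequentially. real (t l) \<le> 3 * ln (real l) / ln (b l) + 1"
    using ev_b eventually_gt_at_top[of 0]
  proof eventually_elim
    case (elim l)
    have b0: "ln (b l) > 0" using elim by simp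
    moreover have bN: "ln (b l) \<le> ln (real (N l))" using elim Nb[of l] by simp
    moreover have "ln (real (N l)) > 0" using b0 bN by linarith
    ultimately have "3 * ln (real l) / ln (real (N l)) \<le> 3 * ln (real l) / ln (b l)"
      using elim by (intro divide_left_mono mult_pos_pos) auto
    moreover have "0 \<le> 3 * ln (real l) / ln (real (N l))" using elim Nb[of l] by simp
    ultimately show ?case unfolding t_def by linarith
  qed
  have "(\<lambda>l. (3 * ln (real l) / ln (b l) + 1) * sqrt (real l) / real l) \<longlonglongrightarrow> 0"
    unfolding b_def using qL by real_asymp
  then have p_lim: "(\<lambda>l. real (p l) / real l) \<longlonglongrightarrow> 0"
  proof (rule tendsto_sandwich[OF _ _ tendsto_const, rotated 2])
    show "\<forall>\<^sub>F l in sequentially. real (p l) / real l \<le> (3 * ln (real l) / ln (b l) + 1) * sqrt (real l) / real l"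
      using ev_t ev_NN
    proof eventually_elim
      case (elim l)
      have "0 \<le> real (t l)" by simp
      also note elim(1)
      finally have "real (t l) * q ^ N l \<le> (3 * ln (real l) / ln (b l) + 1) * sqrt (real l)"
        using elim q by (intro mult_mono) auto
      then show ?case unfolding p_def q_def by (simp add: divide_right_mono)
    qed
  qed auto
  have "(\<lambda>l. (3 * ln (real l) / ln (b l) + 1) * C / b l) \<longlonglongrightarrow> 0"
    unfolding b_def using qL by real_asymp
  then have tC_lim: "(\<lambda>l. real (t l) * (C / real (N l))) \<longlonglongrightarrow> 0"
  proof (rule tendsto_sandwich[OF _ _ tendsto_const, rotated 2])
    show "\<forall>\<^sub>F l in sequentially. real (t l) * (C / real (N l)) \<le> (3 * ln (real l) / ln (b l) + 1) * C / b l"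
      using ev_t ev_b
    proof eventually_elim
      case (elim l)
      have t0: "0 \<le> real (t l)" by simp
      also note elim(1)
      finally have "0 \<le> 3 * ln (real l) / ln (b l) + 1" .
      moreover have "C / real (N l) \<le> C / b l" using C(1) Nb[of l] elim by (intro divide_left_mono) auto
      ultimately have "real (t l) * (C / real (N l)) \<le> (3 * ln (real l) / ln (b l) + 1) * (C / b l)"
        using elim C by (intro mult_mono) auto
      then show ?case by simp
    qed
  qed (use C in auto)
  have ev_G: "\<forall>\<^sub>F l in sequentially. real l ^ 3 \<le> real (N l ^ t l)"
    using ev_N eventually_gt_at_top[of 0]
  proof eventually_elim
    case (elim l)
    have lN: "ln (real (N l)) > 0" using elim by simp
    have "3 * ln (real l) / ln (real (N l)) \<le> real (t l)" unfolding t_def by linarith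
    then have "3 * ln (real l) \<le> real (t l) * ln (real (N l))" using lN by (simp add: pos_divide_le_eq)
    then have "ln (real l ^ 3) \<le> ln (real (N l) ^ t l)" using elim by (simp add: ln_realpow)
    then show ?case using elim by (subst (asm) ln_le_cancel_iff) auto
  qed
  have ev_p: "\<forall>\<^sub>F l in sequentially. real (p l) / real l < 1 / 2" using p_lim by (rule order_tendstoD) simp
  have ev_pl: "\<forall>\<^sub>F l in sequentially. p l + n l = l \<and> real l / 2 \<le> real (n l)"
    using ev_p eventually_gt_at_top[of 0]
  proof eventually_elim
    case (elim l)
    then have "2 * real (p l) < real l" by (simp add: divide_less_eq)
    then show ?case unfolding n_def by auto
  qed
  have n_top: "filterlim n at_top sequentially"
  proof -
    have "filterlim (\<lambda>l. real (n l)) at_top sequentially"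
    proof (rule filterlim_at_top_mono)
      show "filterlim (\<lambda>l. real l / 2) at_top sequentially" by real_asymp
      show "\<forall>\<^sub>F l in sequentially. real l / 2 \<le> real (n l)" using ev_pl by eventually_elim simp
    qed
    then show ?thesis by (simp add: filterlim_sequentially_iff_filterlim_real)
  qed
  have \<epsilon>n: "(\<lambda>l. \<epsilon> (n l)) \<longlonglongrightarrow> 0" and hn: "(\<lambda>l. h (n l)) \<longlonglongrightarrow> 0"
    using filterlim_compose[OF \<epsilon> n_top] filterlim_compose[OF h n_top] by auto
  have ev_\<epsilon>: "\<forall>\<^sub>F l in sequentially. \<epsilon> (n l) < 1 / 2" using \<epsilon>n by (rule order_tendstoD) simp
  define \<sigma> where "\<sigma> = real (card (St A))"
  define \<upsilon> where "\<upsilon> = log 2 (real (card (OutB A)))"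
  have \<sigma>: "\<sigma> \<ge> 1" and \<upsilon>: "\<upsilon> \<ge> 0" unfolding \<sigma>_def \<upsilon>_def using avwc card_gt_0_iff[of "St A"] card_gt_0_iff[of "OutB A"]
    by (auto simp: Suc_le_eq)
  define r where "r l = ln (2 * \<sigma> ^ n l) / real (N l ^ t l)" for l
  define good where "good l \<longleftrightarrow> p l + n l = l \<and> 1 \<le> N l ^ t l" for l
  have ev_good: "\<forall>\<^sub>F l in sequentially. good l"
    using ev_pl ev_N unfolding good_def by eventually_elim simp
  have "\<exists>K' e' D'. is_code A l K' 1 e' D' \<and> (good l \<longrightarrow> K' = K (n l) \<and>
      code_err A l K' 1 e' D' \<le> 2 * \<epsilon> (n l) + r l + real (t l) * (C / real (N l)) \<and>
      (\<forall>s\<in>words l (St A). cond_mi A l K' 1 e' s \<le> 2 * h (n l) + (log 2 (real (K (n l))) + 1) * r l))" for l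
  proof (cases "good l")
    case False
    then show ?thesis using trivial_code[OF avwc, of l] by blast
  next
    case True
    then have l: "p l + n l = l" and G: "1 \<le> N l ^ t l" unfolding good_def by auto
    obtain c0 D0 where "det_code A (card (Inp A) ^ N l) (N l) c0 D0 (C / real (N l))" using C(2) by blast
    then obtain c P where cP: "det_code A (p l) (N l ^ t l) c P (real (t l) * (C / real (N l)))"
      using det_code_power[OF avwc] unfolding p_def by blast
    obtain e1 D1 where 1: "is_code A (n l) (K (n l)) (N l ^ t l) e1 D1"
        "code_err A (n l) (K (n l)) (N l ^ t l) e1 D1 \<le> 2 * \<epsilon> (n l) + r l"
        "\<And>s. s \<in> words (n l) (St A) \<Longrightarrow> cond_mi A (n l) (K (n l)) (N l ^ t l) e1 s \<le> 2 * h (n l) + (log 2 (real (K (n l))) + 1) * r l"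
      using reduce_randomness[OF avwc code G leak] unfolding r_def \<sigma>_def \<epsilon>_def by blast
    obtain e2 D2 where 2: "is_code A l (K (n l)) 1 e2 D2"
        "code_err A l (K (n l)) 1 e2 D2 \<le> code_err A (n l) (K (n l)) (N l ^ t l) e1 D1 + real (t l) * (C / real (N l))"
        "\<forall>s\<in>words l (St A). \<exists>s'\<in>words (n l) (St A). cond_mi A l (K (n l)) 1 e2 s \<le> cond_mi A (n l) (K (n l)) (N l ^ t l) e1 s'"
      using concat_code[OF avwc 1(1) cP] unfolding l by blast
    have "cond_mi A l (K (n l)) 1 e2 s \<le> 2 * h (n l) + (log 2 (real (K (n l))) + 1) * r l" if "s \<in> words l (St A)" for s
      using 2(3) that 1(3) by (meson order_trans)
    then show ?thesis using 2(1,2) 1(2) by (intro exI[of _ "K (n l)"] exI[of _ e2] exI[of _ D2]) auto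
  qed
  then obtain K' e' D' where code': "\<And>l. is_code A l (K' l) 1 (e' l) (D' l)"
    and K': "\<And>l. good l \<Longrightarrow> K' l = K (n l)"
    and err': "\<And>l. good l \<Longrightarrow> code_err A l (K' l) 1 (e' l) (D' l) \<le> 2 * \<epsilon> (n l) + r l + real (t l) * (C / real (N l))"
    and leak': "\<And>l s. good l \<Longrightarrow> s \<in> words l (St A) \<Longrightarrow> cond_mi A l (K' l) 1 (e' l) s \<le> 2 * h (n l) + (log 2 (real (K (n l))) + 1) * r l"
    by metis
  have ev_r: "\<forall>\<^sub>F l in sequentially. 0 \<le> r l \<and> r l \<le> (ln 2 + real l * ln \<sigma>) / real l ^ 3"
    using ev_G eventually_gt_at_top[of 0]
  proof eventually_elim
    case (elim l)
    have "ln (2 * \<sigma> ^ n l) = ln 2 + real (n l) * ln \<sigma>" using \<sigma> by (simp add: ln_mult ln_realpow)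
    moreover have "real (n l) * ln \<sigma> \<le> real l * ln \<sigma>" using \<sigma> unfolding n_def by (intro mult_right_mono) auto
    moreover have "0 \<le> real (n l) * ln \<sigma>" using \<sigma> by simp
    moreover have "0 < real l ^ 3" using elim by simp
    ultimately show ?case unfolding r_def using elim(1) by (auto intro!: frac_le divide_nonneg_nonneg)
  qed
  have "(\<lambda>l. (ln 2 + real l * ln \<sigma>) / real l ^ 3) \<longlonglongrightarrow> 0" by real_asymp
  then have r_lim: "r \<longlonglongrightarrow> 0"
    by (rule tendsto_sandwich[OF _ _ tendsto_const, rotated 2]) (use ev_r in \<open>auto elim: eventually_mono\<close>)
  have ev_K: "\<forall>\<^sub>F l in sequentially. 0 \<le> log 2 (real (K (n l))) \<and> log 2 (real (K (n l))) \<le> 1 + real l * \<upsilon>"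
    using ev_\<epsilon>
  proof eventually_elim
    case (elim l)
    have "log 2 (real (K (n l))) \<le> 1 + real (n l) * \<upsilon>"
      unfolding \<upsilon>_def using elim by (intro messages_rate_le[OF code]) (simp add: \<epsilon>_def)
    moreover have "real (n l) * \<upsilon> \<le> real l * \<upsilon>" using \<upsilon> unfolding n_def by (intro mult_right_mono) auto
    moreover have "K (n l) \<ge> 1" using code[of "n l"] unfolding is_code_def by blast
    ultimately show ?case by simp
  qed
  have "(\<lambda>l. (2 + real l * \<upsilon>) * ((ln 2 + real l * ln \<sigma>) / real l ^ 3)) \<longlonglongrightarrow> 0" by real_asymp
  then have Kr_lim: "(\<lambda>l. (log 2 (real (K (n l))) + 1) * r l) \<longlonglongrightarrow> 0"
  proof (rule tendsto_sandwich[OF _ _ tendsto_const, rotated 2])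
    show "\<forall>\<^sub>F l in sequentially. 0 \<le> (log 2 (real (K (n l))) + 1) * r l"
      using ev_r ev_K by eventually_elim simp
    show "\<forall>\<^sub>F l in sequentially. (log 2 (real (K (n l))) + 1) * r l \<le> (2 + real l * \<upsilon>) * ((ln 2 + real l * ln \<sigma>) / real l ^ 3)"
      using ev_r ev_K by eventually_elim (intro mult_mono, auto)
  qed
  have err_lim: "(\<lambda>l. code_err A l (K' l) 1 (e' l) (D' l)) \<longlonglongrightarrow> 0"
  proof (rule tendsto_sandwich[OF _ _ tendsto_const])
    show "\<forall>\<^sub>F l in sequentially. 0 \<le> code_err A l (K' l) 1 (e' l) (D' l)"
      using code_err_nonneg[OF avwc code'] by simp
    show "\<forall>\<^sub>F l in sequentially. code_err A l (K' l) 1 (e' l) (D' l) \<le> 2 * \<epsilon> (n l) + r l + real (t l) * (C / real (N l))"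
      using ev_good by eventually_elim (rule err')
    have "(\<lambda>l. 2 * \<epsilon> (n l) + r l + real (t l) * (C / real (N l))) \<longlonglongrightarrow> 2 * 0 + 0 + 0"
      by (intro tendsto_intros \<epsilon>n r_lim tC_lim)
    then show "(\<lambda>l. 2 * \<epsilon> (n l) + r l + real (t l) * (C / real (N l))) \<longlonglongrightarrow> 0" by simp
  qed
  have "(\<lambda>l. 2 * h (n l) + (log 2 (real (K (n l))) + 1) * r l) \<longlonglongrightarrow> 2 * 0 + 0"
    by (intro tendsto_intros hn Kr_lim)
  then have leak_lim: "(\<lambda>l. 2 * h (n l) + (log 2 (real (K (n l))) + 1) * r l) \<longlonglongrightarrow> 0" by simp
  let ?L = "liminf (\<lambda>l. ereal (log 2 (real (K' l)) / real l))"
  have "(\<lambda>l. 1 - real (p l) / real l) \<longlonglongrightarrow> 1 - 0" by (intro tendsto_intros p_lim)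
  then have "(\<lambda>l. real (n l) / real l) \<longlonglongrightarrow> 1"
  proof (rule tendsto_cong[THEN iffD2, rotated, OF tendsto_eq_rhs])
    show "\<forall>\<^sub>F l in sequentially. real (n l) / real l = 1 - real (p l) / real l"
      using ev_pl eventually_gt_at_top[of 0]
    proof eventually_elim
      case (elim l)
      then have eq: "real (n l) = real l - real (p l)" by linarith
      show ?case unfolding eq using elim(2) by (simp add: diff_divide_distrib)
    qed
  qed simp
  then have u: "(\<lambda>l. ereal (real (n l) / real l)) \<longlonglongrightarrow> 1" by (simp add: one_ereal_def)
  have "ereal R \<le> liminf (\<lambda>l. ereal (log 2 (real (K (n l))) / real (n l)))"
    using liminf_compose_ge[OF n_top, of "\<lambda>n. ereal (log 2 (real (K n)) / real n)"] unfolding rate .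
  also have "\<dots> = liminf (\<lambda>l. ereal (real (n l) / real l) * ereal (log 2 (real (K (n l))) / real (n l)))"
    using ereal_liminf_lim_mult[OF u, of "\<lambda>l. ereal (log 2 (real (K (n l))) / real (n l))"]
    by (simp del: times_ereal.simps)
  also have "\<dots> = ?L"
  proof (rule Liminf_eq)
    show "\<forall>\<^sub>F l in sequentially. ereal (real (n l) / real l) * ereal (log 2 (real (K (n l))) / real (n l)) = ereal (log 2 (real (K' l)) / real l)"
      using ev_pl ev_good eventually_gt_at_top[of 0]
    proof eventually_elim
      case (elim l)
      then have "real (n l) > 0" by auto
      then show ?case using K'[of l] elim by simp
    qed
  qed
  finally have RL: "ereal R \<le> ?L" .
  have "?L \<le> limsup (\<lambda>l. ereal (log 2 (real (K' l)) / real l))" by (intro Liminf_le_Limsup) simp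
  also have "\<dots> \<le> ereal (1 + \<upsilon>)"
  proof (rule Limsup_bounded)
    show "\<forall>\<^sub>F l in sequentially. ereal (log 2 (real (K' l)) / real l) \<le> ereal (1 + \<upsilon>)"
      using ev_good ev_K eventually_gt_at_top[of 0]
    proof eventually_elim
      case (elim l)
      then have "log 2 (real (K' l)) \<le> 1 + real l * \<upsilon>" using K' by simp
      also have "\<dots> \<le> (1 + \<upsilon>) * real l" using elim by (simp add: algebra_simps)
      finally show ?case using elim by (simp add: pos_divide_le_eq)
    qed
  qed
  finally obtain R' where R': "?L = ereal R'" using RL by (cases ?L) auto
  have "achievable True A R'"
  proof (rule achievableI[OF avwc, where G = "\<lambda>_. 1"])
    show "\<forall>\<^sub>F l in sequentially. \<forall>s\<in>words l (St A). cond_mi A l (K' l) 1 (e' l) s \<le> 2 * h (n l) + (log 2 (real (K (n l))) + 1) * r l"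
      using ev_good by eventually_elim (use leak' in blast)
  qed (use code' err_lim R' leak_lim in auto)
  then have "ereal R' \<le> C_S A" unfolding C_S_def by (intro Sup_upper) auto
  then show ?thesis using RL R' by (metis order_trans)
qed

lemma not_symmetrizable_C_S:
  assumes "\<not> symmetrizable A"
  shows "C_S A = C_mean_ran A"
proof (rule order_antisym[OF C_S_le_C_mean_ran[OF avwc]])
  show "C_mean_ran A \<le> C_S A"
    unfolding C_mean_ran_def using not_symmetrizable_C_S_ge[OF assms] by (intro Sup_least) auto
qed

end

section \<open>Joint use\<close>

lemma joint_sel [simp]:
  "St (joint A1 A2) = St A1 \<times> St A2" "Inp (joint A1 A2) = Inp A1 \<times> Inp A2"
  "OutB (joint A1 A2) = OutB A1 \<times> OutB A2" "OutE (joint A1 A2) = OutE A1 \<times> OutE A2"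
  "chW (joint A1 A2) (s1, s2) (x1, x2) (y1, y2) = chW A1 s1 x1 y1 * chW A2 s2 x2 y2"
  "chV (joint A1 A2) (s1, s2) (x1, x2) (z1, z2) = chV A1 s1 x1 z1 * chV A2 s2 x2 z2"
  unfolding joint_def by simp_all

lemma is_avwc_joint:
  assumes "is_avwc A1" "is_avwc A2"
  shows "is_avwc (joint A1 A2)"
proof -
  have "channel (Inp (joint A1 A2)) (OutB (joint A1 A2)) (chW (joint A1 A2) (s1, s2))"
    "channel (Inp (joint A1 A2)) (OutE (joint A1 A2)) (chV (joint A1 A2) (s1, s2))"
    if "s1 \<in> St A1" "s2 \<in> St A2" for s1 s2
    using assms that unfolding channel_def is_avwc_def
    by (auto simp: sum.cartesian_product' sum_product[symmetric])
  then show ?thesis using assms unfolding is_avwc_def by auto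
qed

lemma symmetrizable_joint:
  assumes A: "is_avwc A1" "is_avwc A2"
  shows "symmetrizable (joint A1 A2) \<longleftrightarrow> symmetrizable A1 \<and> symmetrizable A2"
proof (intro iffI conjI)
  assume "symmetrizable (joint A1 A2)"
  then obtain u where u: "channel (Inp A1 \<times> Inp A2) (St A1 \<times> St A2) u"
    and "\<forall>x\<in>Inp A1 \<times> Inp A2. \<forall>x'\<in>Inp A1 \<times> Inp A2. \<forall>y\<in>OutB A1 \<times> OutB A2.
       (\<Sum>s\<in>St A1 \<times> St A2. u x s * chW (joint A1 A2) s x' y) = (\<Sum>s\<in>St A1 \<times> St A2. u x' s * chW (joint A1 A2) s x y)"
    unfolding symmetrizable_def by auto
  then have sym: "(\<Sum>s1\<in>St A1. \<Sum>s2\<in>St A2. u (x1, x2) (s1, s2) * (chW A1 s1 x1' y1 * chW A2 s2 x2' y2))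
      = (\<Sum>s1\<in>St A1. \<Sum>s2\<in>St A2. u (x1', x2') (s1, s2) * (chW A1 s1 x1 y1 * chW A2 s2 x2 y2))"
    if "x1 \<in> Inp A1" "x2 \<in> Inp A2" "x1' \<in> Inp A1" "x2' \<in> Inp A2" "y1 \<in> OutB A1" "y2 \<in> OutB A2"
    for x1 x2 x1' x2' y1 y2
    using that by (fastforce simp: sum.cartesian_product')
  have u0: "0 \<le> u (x1, x2) (s1, s2)" and u1: "(\<Sum>s1\<in>St A1. \<Sum>s2\<in>St A2. u (x1, x2) (s1, s2)) = 1"
    if "x1 \<in> Inp A1" "x2 \<in> Inp A2" "s1 \<in> St A1" "s2 \<in> St A2" for x1 x2 s1 s2
    using u that unfolding channel_def by (auto simp: sum.cartesian_product')
  have ne: "St A1 \<noteq> {}" "St A2 \<noteq> {}" using A by auto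
  have W1: "(\<Sum>y\<in>OutB A1. chW A1 s x y) = 1" if "s \<in> St A1" "x \<in> Inp A1" for s x
    using avwc_chW[OF A(1)] that unfolding channel_def by auto
  have W2: "(\<Sum>y\<in>OutB A2. chW A2 s x y) = 1" if "s \<in> St A2" "x \<in> Inp A2" for s x
    using avwc_chW[OF A(2)] that unfolding channel_def by auto
  show "symmetrizable A1"
  proof -
    obtain x2 where x2: "x2 \<in> Inp A2" using avwc_nonempty[OF A(2)] by blast
    let ?v = "\<lambda>x1 s1. \<Sum>s2\<in>St A2. u (x1, x2) (s1, s2)"
    have "channel (Inp A1) (St A1) ?v"
      unfolding channel_def using u0 u1 x2 ne by (auto intro!: sum_nonneg)
    moreover have "(\<Sum>s1\<in>St A1. ?v x1 s1 * chW A1 s1 x1' y1) = (\<Sum>s1\<in>St A1. ?v x1' s1 * chW A1 s1 x1 y1)"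
      if x: "x1 \<in> Inp A1" "x1' \<in> Inp A1" "y1 \<in> OutB A1" for x1 x1' y1
    proof -
      have e: "(\<Sum>y2\<in>OutB A2. \<Sum>s1\<in>St A1. \<Sum>s2\<in>St A2. u (a, x2) (s1, s2) * (chW A1 s1 b y1 * chW A2 s2 x2 y2))
         = (\<Sum>s1\<in>St A1. ?v a s1 * chW A1 s1 b y1)" for a b
      proof -
        have "(\<Sum>y2\<in>OutB A2. \<Sum>s1\<in>St A1. \<Sum>s2\<in>St A2. u (a, x2) (s1, s2) * (chW A1 s1 b y1 * chW A2 s2 x2 y2))
         = (\<Sum>s1\<in>St A1. \<Sum>s2\<in>St A2. \<Sum>y2\<in>OutB A2. u (a, x2) (s1, s2) * chW A1 s1 b y1 * chW A2 s2 x2 y2)"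
          by (subst sum.swap, rule sum.cong[OF refl], subst sum.swap) (simp add: mult.assoc)
        also have "\<dots> = (\<Sum>s1\<in>St A1. \<Sum>s2\<in>St A2. u (a, x2) (s1, s2) * chW A1 s1 b y1)"
          using W2 x2 by (intro sum.cong refl) (simp flip: sum_distrib_left)
        finally show ?thesis by (simp add: sum_distrib_right)
      qed
      show ?thesis unfolding e[symmetric] by (rule sum.cong[OF refl]) (rule sym[OF x(1) x2 x(2) x2 x(3)])
    qed
    ultimately show ?thesis unfolding symmetrizable_def by blast
  qed
  show "symmetrizable A2"
  proof -
    obtain x1 where x1: "x1 \<in> Inp A1" using avwc_nonempty[OF A(1)] by blast
    let ?v = "\<lambda>x2 s2. \<Sum>s1\<in>St A1. u (x1, x2) (s1, s2)"
    have "channel (Inp A2) (St A2) ?v"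
      unfolding channel_def using u0 u1 x1 ne by (auto intro!: sum_nonneg simp: sum.swap[of _ "St A1"])
    moreover have "(\<Sum>s2\<in>St A2. ?v x2 s2 * chW A2 s2 x2' y2) = (\<Sum>s2\<in>St A2. ?v x2' s2 * chW A2 s2 x2 y2)"
      if x: "x2 \<in> Inp A2" "x2' \<in> Inp A2" "y2 \<in> OutB A2" for x2 x2' y2
    proof -
      have e: "(\<Sum>y1\<in>OutB A1. \<Sum>s1\<in>St A1. \<Sum>s2\<in>St A2. u (x1, a) (s1, s2) * (chW A1 s1 x1 y1 * chW A2 s2 b y2))
         = (\<Sum>s2\<in>St A2. ?v a s2 * chW A2 s2 b y2)" for a b
      proof -
        have "(\<Sum>y1\<in>OutB A1. \<Sum>s1\<in>St A1. \<Sum>s2\<in>St A2. u (x1, a) (s1, s2) * (chW A1 s1 x1 y1 * chW A2 s2 b y2))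
         = (\<Sum>s1\<in>St A1. \<Sum>s2\<in>St A2. \<Sum>y1\<in>OutB A1. u (x1, a) (s1, s2) * chW A2 s2 b y2 * chW A1 s1 x1 y1)"
          by (subst sum.swap, rule sum.cong[OF refl], subst sum.swap) (simp add: mult_ac)
        also have "\<dots> = (\<Sum>s1\<in>St A1. \<Sum>s2\<in>St A2. u (x1, a) (s1, s2) * chW A2 s2 b y2)"
          using W1 x1 by (intro sum.cong refl) (simp flip: sum_distrib_left)
        also have "\<dots> = (\<Sum>s2\<in>St A2. \<Sum>s1\<in>St A1. u (x1, a) (s1, s2) * chW A2 s2 b y2)"
          by (rule sum.swap)
        finally show ?thesis by (simp add: sum_distrib_right)
      qed
      show ?thesis unfolding e[symmetric] by (rule sum.cong[OF refl]) (rule sym[OF x1 x(1) x1 x(2) _ x(3)])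
    qed
    ultimately show ?thesis unfolding symmetrizable_def by blast
  qed
next
  assume "symmetrizable A1 \<and> symmetrizable A2"
  then obtain u1 u2 where u: "channel (Inp A1) (St A1) u1" "channel (Inp A2) (St A2) u2"
    and s1: "\<And>x x' y. x \<in> Inp A1 \<Longrightarrow> x' \<in> Inp A1 \<Longrightarrow> y \<in> OutB A1 \<Longrightarrow>
       (\<Sum>s\<in>St A1. u1 x s * chW A1 s x' y) = (\<Sum>s\<in>St A1. u1 x' s * chW A1 s x y)"
    and s2: "\<And>x x' y. x \<in> Inp A2 \<Longrightarrow> x' \<in> Inp A2 \<Longrightarrow> y \<in> OutB A2 \<Longrightarrow>
       (\<Sum>s\<in>St A2. u2 x s * chW A2 s x' y) = (\<Sum>s\<in>St A2. u2 x' s * chW A2 s x y)"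
    unfolding symmetrizable_def by blast
  let ?u = "\<lambda>(x1, x2) (s1, s2). u1 x1 s1 * u2 x2 s2"
  have "channel (Inp A1 \<times> Inp A2) (St A1 \<times> St A2) ?u"
    using u unfolding channel_def by (auto simp: sum.cartesian_product' sum_product[symmetric])
  moreover have "(\<Sum>s\<in>St A1 \<times> St A2. ?u (x1, x2) s * chW (joint A1 A2) s (x1', x2') (y1, y2))
      = (\<Sum>s\<in>St A1. u1 x1 s * chW A1 s x1' y1) * (\<Sum>s\<in>St A2. u2 x2 s * chW A2 s x2' y2)" for x1 x2 x1' x2' y1 y2
    by (simp add: sum.cartesian_product' sum_product mult_ac)
  ultimately show "symmetrizable (joint A1 A2)"
    unfolding symmetrizable_def using s1 s2 by (intro exI[of _ ?u]) auto
qed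

lemma mut_inf_const:
  assumes "\<And>k z. k < K \<Longrightarrow> z \<in> Z \<Longrightarrow> q k z = r z"
  shows "mut_inf K Z q = 0"
proof -
  have "rel_term (q k z) ((\<Sum>k'<K. q k' z) / real K) = 0" if "k < K" "z \<in> Z" for k z
    using that assms by (simp add: rel_term_def)
  then show ?thesis unfolding mut_inf_def by simp
qed

text \<open>Uses \<open>rel_term_ge\<close> with \<open>t = e\<close> on the decoding sets and \<open>t = 1\<close> elsewhere.\<close>
lemma leakage_ge_succ:
  fixes A :: "('s, 'x, 'y, 'y) avwc"
  assumes avwc: "is_avwc A" and same: "OutE A = OutB A" "chV A = chW A"
    and code: "is_code A n K G e D" and g: "g < G" and s: "s \<in> words n (St A)"
  shows "succ_prob A n K (e g) (D g) s - 2 / real K \<le> mut_inf K (words n (OutE A)) (\<lambda>k. eve_out A n (e g k) s) * ln 2"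
proof -
  let ?Z = "words n (OutB A)" and ?q = "\<lambda>k. eve_out A n (e g k) s"
  let ?p = "\<lambda>z. (\<Sum>k<K. ?q k z) / real K"
  have K: "K \<ge> 1" using code unfolding is_code_def by blast
  have fZ: "finite ?Z" using avwc by simp
  have D: "D g k \<subseteq> ?Z" if "k < K" for k using code g that unfolding is_code_def by blast
  have q0: "0 \<le> ?q k z" if "k < K" "z \<in> ?Z" for k z
    using eve_out_nonneg[OF avwc code g that(1) s] that(2) same by simp
  have q1: "(\<Sum>z\<in>?Z. ?q k z) = 1" if "k < K" for k using sum_eve_out[OF avwc code g that s] same by simp
  have p0: "0 \<le> ?p z" if "z \<in> ?Z" for z using q0 that by (intro divide_nonneg_nonneg sum_nonneg) auto
  have p1: "(\<Sum>z\<in>?Z. ?p z) = 1"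
    using q1 K by (subst sum_divide_distrib[symmetric], subst sum.swap) simp
  have succ: "succ_prob A n K (e g) (D g) s = (\<Sum>k<K. \<Sum>z\<in>D g k. ?q k z) / real K"
    unfolding succ_prob_def dprob_def eve_out_def same sum_distrib_left
    by (intro arg_cong2[where f = "(/)"] sum.cong refl sum.swap)
  have pt: "?q k z - ?p z + of_bool (z \<in> D g k) * (?q k z - 2 * ?p z) \<le> rel_term (?q k z) (?p z) * ln 2"
    if kz: "k < K" "z \<in> ?Z" for k z
  proof -
    have z: "?p z = 0 \<Longrightarrow> ?q k z = 0" using avg_eq_0D[of K ?q z k] q0 kz by auto
    have e: "exp 1 \<le> (3 :: real)" by (rule exp_le)
    have t1: "?q k z * log 2 (exp 1) + (?q k z - ?p z * exp 1) / ln 2 \<le> rel_term (?q k z) (?p z)"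
      by (rule rel_term_ge[OF q0[OF kz] p0[OF kz(2)] z]) auto
    have t2: "?q k z * log 2 1 + (?q k z - ?p z * 1) / ln 2 \<le> rel_term (?q k z) (?p z)"
      by (rule rel_term_ge[OF q0[OF kz] p0[OF kz(2)] z]) auto
    have l2: "ln 2 > (0 :: real)" by simp
    have "(2 * ?q k z - ?p z * exp 1) / ln 2 \<le> rel_term (?q k z) (?p z)"
      using t1 by (simp add: log_def add_divide_distrib[symmetric] algebra_simps)
    then have "2 * ?q k z - ?p z * exp 1 \<le> rel_term (?q k z) (?p z) * ln 2" using l2 by (simp add: pos_divide_le_eq)
    moreover have "?p z * exp 1 \<le> ?p z * 3" using e p0[OF kz(2)] by (rule mult_left_mono)
    moreover have "?q k z - ?p z \<le> rel_term (?q k z) (?p z) * ln 2" using t2 l2 by (simp add: pos_divide_le_eq)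
    ultimately show ?thesis by (cases "z \<in> D g k") auto
  qed
  have "(\<Sum>k<K. \<Sum>z\<in>D g k. ?p z) = (\<Sum>z\<in>(\<Union>k<K. D g k). ?p z)"
    using code g finite_subset[OF D fZ] unfolding is_code_def by (subst sum.UNION_disjoint) auto
  also have "\<dots> \<le> (\<Sum>z\<in>?Z. ?p z)" using D p0 fZ by (intro sum_mono2) auto
  finally have pD: "(\<Sum>k<K. \<Sum>z\<in>D g k. ?p z) \<le> 1" using p1 by simp
  have "(\<Sum>k<K. \<Sum>z\<in>D g k. ?q k z) - 2 \<le> (\<Sum>k<K. \<Sum>z\<in>D g k. ?q k z) - 2 * (\<Sum>k<K. \<Sum>z\<in>D g k. ?p z)"
    using pD by simp
  also have "\<dots> = (\<Sum>k<K. \<Sum>z\<in>D g k. ?q k z - 2 * ?p z)"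
    by (simp add: sum_subtractf sum_distrib_left)
  also have "\<dots> = (\<Sum>k<K. \<Sum>z\<in>?Z. ?q k z - ?p z + of_bool (z \<in> D g k) * (?q k z - 2 * ?p z))"
  proof (rule sum.cong[OF refl])
    fix k assume "k \<in> {..<K}"
    then have k: "k < K" by simp
    have "(\<Sum>z\<in>?Z. of_bool (z \<in> D g k) * (?q k z - 2 * ?p z)) = (\<Sum>z\<in>D g k. ?q k z - 2 * ?p z)"
      using fZ D[OF k] by (intro sum.mono_neutral_cong_right) auto
    then show "(\<Sum>z\<in>D g k. ?q k z - 2 * ?p z) = (\<Sum>z\<in>?Z. ?q k z - ?p z + of_bool (z \<in> D g k) * (?q k z - 2 * ?p z))"
      using q1[OF k] p1 by (simp only: sum.distrib sum_subtractf)
  qed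
  also have "\<dots> \<le> (\<Sum>k<K. \<Sum>z\<in>?Z. rel_term (?q k z) (?p z) * ln 2)" using pt by (intro sum_mono) auto
  finally have "(\<Sum>k<K. \<Sum>z\<in>D g k. ?q k z) - 2 \<le> (\<Sum>k<K. \<Sum>z\<in>?Z. rel_term (?q k z) (?p z)) * ln 2"
    by (simp only: sum_distrib_right)
  then have "((\<Sum>k<K. \<Sum>z\<in>D g k. ?q k z) - 2) / real K \<le> (\<Sum>k<K. \<Sum>z\<in>?Z. rel_term (?q k z) (?p z)) * ln 2 / real K"
    by (rule divide_right_mono) simp
  then show ?thesis unfolding succ mut_inf_def same by (simp add: diff_divide_distrib)
qed

lemma C_S_same_output:
  fixes A :: "('s, 'x, 'y, 'y) avwc"
  assumes avwc: "is_avwc A" and same: "OutE A = OutB A" "chV A = chW A"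
  shows "C_S A = 0"
proof (rule C_S_eq_0I[OF avwc])
  fix R assume "achievable True A R"
  then obtain K G e D h where code: "\<forall>n. is_code A n (K n) (G n) (e n) (D n)" and G: "True \<longrightarrow> (\<forall>n. G n = 1)"
    and err: "(\<lambda>n. code_err A n (K n) (G n) (e n) (D n)) \<longlonglongrightarrow> 0"
    and R: "liminf (\<lambda>n. ereal (log 2 (real (K n)) / real n)) = ereal R"
    and leak: "\<forall>n. \<forall>s\<in>words n (St A). cond_mi A n (K n) (G n) (e n) s \<le> h n" and h: "h \<longlonglongrightarrow> 0"
    by (rule achievableE[OF avwc])
  have ev1: "\<forall>\<^sub>F n in sequentially. code_err A n (K n) (G n) (e n) (D n) < 1 / 4"
    using err by (rule order_tendstoD) simp
  have ev2: "\<forall>\<^sub>F n in sequentially. h n < 1 / 4"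
    using h by (rule order_tendstoD) simp
  from ev1 ev2 have "\<forall>\<^sub>F n in sequentially. 1 \<le> K n \<and> K n \<le> 4"
  proof eventually_elim
    case (elim n)
    have G1: "G n = 1" using G by simp
    have K1: "1 \<le> K n" using code unfolding is_code_def by blast
    obtain s where s: "s \<in> words n (St A)" using words_nonempty[of "St A" n] avwc by fastforce
    let ?m = "mut_inf (K n) (words n (OutE A)) (\<lambda>k. eve_out A n (e n 0 k) s)"
    have "cond_mi A n (K n) (G n) (e n) s = ?m" unfolding cond_mi_eq G1 by (simp add: lessThan_Suc)
    moreover have "cond_mi A n (K n) (G n) (e n) s \<le> h n" using leak s by blast
    moreover have "0 \<le> cond_mi A n (K n) (G n) (e n) s"
      by (rule cond_mi_nonneg[OF avwc spec[OF code] s])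
    ultimately have m: "0 \<le> ?m" "?m \<le> 1 / 4" using elim by auto
    have "?m * ln 2 \<le> ?m * 1" using m(1) ln_2_less_1 by (intro mult_left_mono) auto
    moreover have "succ_prob A n (K n) (e n 0) (D n 0) s - 2 / real (K n) \<le> ?m * ln 2"
      by (rule leakage_ge_succ[OF avwc same spec[OF code] _ s]) (simp add: G1)
    moreover have "3 / 4 \<le> succ_prob A n (K n) (e n 0) (D n 0) s"
    proof -
      have "1 - 1 / 4 \<le> (\<Sum>g<G n. succ_prob A n (K n) (e n g) (D n g) s) / real (G n)"
        using code_err_le_iff[OF avwc, of n "K n" "G n" "e n" "D n" "1 / 4"] elim s by auto
      then show ?thesis unfolding G1 by (simp add: lessThan_Suc)
    qed
    ultimately have "1 / 2 \<le> 2 / real (K n)" using m by linarith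
    then have "real (K n) \<le> 4" using K1 by (simp add: field_simps)
    then show ?case using K1 by simp
  qed
  then show "R \<le> 0" using R by (rule rate_nonpos_if_bounded)
qed

section \<open>An example of super-activation\<close>

definition noiseless :: "(nat, nat, nat, nat) avwc" where
  "noiseless = \<lparr> St = {0}, Inp = {0, 1}, OutB = {0, 1}, OutE = {0, 1},
     chW = (\<lambda>s x y. of_bool (y = x)), chV = (\<lambda>s x y. of_bool (y = x)) \<rparr>"

definition adder :: "(nat, nat, nat, nat) avwc" where
  "adder = \<lparr> St = {0, 1}, Inp = {0, 1}, OutB = {0, 1, 2}, OutE = {0},
     chW = (\<lambda>s x y. of_bool (y = x + s)), chV = (\<lambda>s x z. 1) \<rparr>"

lemma is_avwc_noiseless: "is_avwc noiseless"
  unfolding is_avwc_def noiseless_def channel_def by auto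

lemma is_avwc_adder: "is_avwc adder"
  unfolding is_avwc_def adder_def channel_def by auto

lemma not_symmetrizable_noiseless: "\<not> symmetrizable noiseless"
proof
  assume "symmetrizable noiseless"
  then obtain u :: "nat \<Rightarrow> nat \<Rightarrow> real" where "channel {0, 1} {0} u"
    "\<forall>x\<in>{0, 1}. \<forall>x'\<in>{0, 1}. \<forall>y\<in>{0, 1::nat}. u x 0 * of_bool (y = x') = u x' 0 * of_bool (y = x)"
    unfolding symmetrizable_def noiseless_def by auto
  then have "u 0 0 * of_bool ((0::nat) = 1) = u 1 0 * of_bool ((0::nat) = 0)" "u 1 0 = 1"
    unfolding channel_def by (blast, auto)
  then show False by simp
qed

lemma symmetrizable_adder: "symmetrizable adder"
  unfolding symmetrizable_def
proof (intro exI[of _ "\<lambda>x s. of_bool (s = x)"] conjI)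
  show "channel (Inp adder) (St adder) (\<lambda>x s. of_bool (s = x))"
    unfolding channel_def adder_def by auto
  show "\<forall>x\<in>Inp adder. \<forall>x'\<in>Inp adder. \<forall>y\<in>OutB adder. (\<Sum>s\<in>St adder. of_bool (s = x) * chW adder s x' y)
      = (\<Sum>s\<in>St adder. of_bool (s = x') * chW adder s x y)"
    unfolding adder_def by auto
qed

lemma prod_of_bool: "finite I \<Longrightarrow> (\<Prod>i\<in>I. of_bool (P i) :: real) = of_bool (\<forall>i\<in>I. P i)"
  by (induction I rule: finite_induct) auto

text \<open>Common randomness selects a uniformly random codebook.  A wrong codeword is compatible with
  the output in one coordinate with probability \<open>3 / 4\<close>, whatever the state.\<close>
lemma random_codebook:
  assumes K: "1 \<le> K"
  shows "\<exists>G e D. is_code (joint noiseless adder) n K G e D \<and>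
     code_err (joint noiseless adder) n K G e D \<le> real K * (3 / 4) ^ n \<and>
     (\<forall>s. cond_mi (joint noiseless adder) n K G e s = 0)"
proof -
  let ?A = "joint noiseless adder"
  have avwc: "is_avwc ?A" by (intro is_avwc_joint is_avwc_noiseless is_avwc_adder)
  let ?W = "words n {0, 1 :: nat}" and ?Y = "words n (OutB ?A)"
  let ?F = "words K ?W"
  define G where "G = card ?F"
  have G: "G = (2 ^ n) ^ K" unfolding G_def card_words by (simp add: numeral_2_eq_2)
  obtain book where book: "bij_betw book {..<G} ?F"
    using ex_bij_betw_nat_finite[of ?F] unfolding G_def atLeast0LessThan by auto
  have bookW: "book g k \<in> ?W" if "g < G" "k < K" for g k
    using book that words_nth unfolding bij_betw_def by blast
  define emb where "emb x = (\<lambda>i\<in>{..<n}. (0 :: nat, x i :: nat))" for x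
  define out where "out x s = (\<lambda>i\<in>{..<n}. (0 :: nat, x i + snd (s i)))" for x and s :: "nat \<Rightarrow> nat \<times> nat"
  define cons where "cons x y \<longleftrightarrow> (\<forall>i<n. snd (y i) = x i \<or> snd (y i) = x i + 1)"
    for x :: "nat \<Rightarrow> nat" and y :: "nat \<Rightarrow> nat \<times> nat"
  define e where "e g k w = (of_bool (w = emb (book g k)) :: real)" for g k w
  define D where "D g k = {y \<in> ?Y. cons (book g k) y \<and> (\<forall>j<K. j \<noteq> k \<longrightarrow> \<not> cons (book g j) y)}" for g k
  have emb: "emb x \<in> words n (Inp ?A)" if "x \<in> ?W" for x
    using words_nth[OF that] unfolding emb_def words_def noiseless_def adder_def by auto
  have e_sum: "(\<Sum>w\<in>words n (Inp ?A). e g k w * f w) = f (emb (book g k))" if "g < G" "k < K" for g k f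
    unfolding e_def by (intro sum_of_bool_point finite_words avwc_finite[OF avwc] emb[OF bookW[OF that]])
  have code: "is_code ?A n K G e D"
    unfolding is_code_def
  proof (intro conjI allI impI ballI)
    show "1 \<le> K" "1 \<le> G" using K unfolding G by auto
    fix g k assume gk: "g < G" "k < K"
    show "(\<Sum>w\<in>words n (Inp ?A). e g k w) = 1" using e_sum[OF gk, of "\<lambda>_. 1"] by simp
    show "0 \<le> e g k w" for w unfolding e_def by simp
    show "D g k \<subseteq> ?Y" unfolding D_def by blast
    show "D g k \<inter> D g k' = {}" if "k' < K" "k \<noteq> k'" for k' unfolding D_def using that gk by blast
  qed
  have out: "out x s \<in> ?Y" if "x \<in> ?W" "s \<in> words n (St ?A)" for x s
  proof -
    have "(0, x i + snd (s i)) \<in> OutB ?A" if "i < n" for i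
      using words_nth[OF \<open>x \<in> ?W\<close> that] words_nth[OF \<open>s \<in> words n (St ?A)\<close> that]
      by (auto simp: noiseless_def adder_def)
    then show ?thesis unfolding out_def words_def by auto
  qed
  have W: "prodch n (chW ?A) s (emb x) y = of_bool (y = out x s)" if "x \<in> ?W" "y \<in> ?Y" for x s y
  proof -
    have "prodch n (chW ?A) s (emb x) y = (\<Prod>i<n. of_bool (y i = (0, x i + snd (s i))))"
      unfolding prodch_def emb_def
      by (intro prod.cong refl) (auto simp: joint_def noiseless_def adder_def split: prod.splits)
    also have "\<dots> = of_bool (\<forall>i\<in>{..<n}. y i = (0, x i + snd (s i)))" by (rule prod_of_bool) simp
    also have "(\<forall>i\<in>{..<n}. y i = (0, x i + snd (s i))) \<longleftrightarrow> y = out x s"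
      using that(2) unfolding out_def words_def by (auto simp: fun_eq_iff PiE_iff extensional_def)
    finally show ?thesis .
  qed
  have dprob: "dprob n ?A s (emb x) E = of_bool (out x s \<in> E)" if "x \<in> ?W" "s \<in> words n (St ?A)" "E \<subseteq> ?Y" for x s E
  proof -
    have fE: "finite E" by (rule finite_subset[OF that(3) finite_words[OF avwc_finite(3)[OF avwc]]])
    have "dprob n ?A s (emb x) E = (\<Sum>y\<in>E. of_bool (y = out x s))"
      unfolding dprob_def using W[OF that(1)] that(3) by (intro sum.cong) auto
    also have "\<dots> = of_bool (out x s \<in> E)" using fE by (simp add: of_bool_def)
    finally show ?thesis .
  qed
  have pair: "(\<Sum>x\<in>?W. \<Sum>x'\<in>?W. of_bool (cons x' (out x s)) :: real) = 3 ^ n" if s: "s \<in> words n (St ?A)" for s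
  proof -
    let ?c = "\<lambda>i a b. of_bool (a + snd (s i) = b \<or> a + snd (s i) = b + 1) :: real"
    have st: "snd (s i) \<in> {0, 1}" if "i < n" for i
      using words_nth[OF s that] by (auto simp: noiseless_def adder_def)
    have "(\<Sum>x\<in>?W. \<Sum>x'\<in>?W. of_bool (cons x' (out x s)) :: real) = (\<Sum>x\<in>?W. \<Sum>x'\<in>?W. \<Prod>i<n. ?c i (x i) (x' i))"
      unfolding cons_def out_def prod_of_bool[OF finite_lessThan]
      by (intro sum.cong refl arg_cong[where f = of_bool]) auto
    also have "\<dots> = (\<Sum>x\<in>?W. \<Prod>i<n. \<Sum>b\<in>{0, 1}. ?c i (x i) b)"
      by (intro sum.cong refl sum_words_prod) simp
    also have "\<dots> = (\<Prod>i<n. \<Sum>a\<in>{0, 1}. \<Sum>b\<in>{0, 1}. ?c i a b)"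
      by (rule sum_words_prod) simp
    also have "\<dots> = (\<Prod>i<n. 3)"
    proof (rule prod.cong[OF refl])
      fix i assume "i \<in> {..<n}"
      then have "snd (s i) = 0 \<or> snd (s i) = 1" using st[of i] by auto
      then show "(\<Sum>a\<in>{0, 1}. \<Sum>b\<in>{0, 1}. ?c i a b) = 3" by auto
    qed
    finally show ?thesis by simp
  qed
  have conf: "(\<Sum>g<G. of_bool (cons (book g j) (out (book g k) s)) :: real) = real G * (3 / 4) ^ n"
    if jk: "k < K" "j < K" "k \<noteq> j" and s: "s \<in> words n (St ?A)" for j k s
  proof -
    let ?S = "\<Sum>g<G. of_bool (cons (book g j) (out (book g k) s)) :: real"
    have "?S = (\<Sum>v\<in>?F. of_bool (cons (v j) (out (v k) s)))"
      using sum.reindex_bij_betw[OF book, of "\<lambda>v. of_bool (cons (v j) (out (v k) s)) :: real"] by simp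
    then have "real (card ?W ^ 2) * ?S = real (card ?W ^ K) * (\<Sum>x\<in>?W. \<Sum>x'\<in>?W. of_bool (cons x' (out x s)))"
      using sum_words_two_coords[OF jk, of ?W "\<lambda>x x'. of_bool (cons x' (out x s))"] by simp
    then have "4 ^ n * ?S = real G * 3 ^ n" unfolding pair[OF s] G by (simp add: card_words power_mult_distrib[symmetric] power2_eq_square)
    then show ?thesis by (simp add: power_divide field_simps)
  qed
  have "code_err ?A n K G e D \<le> real K * (3 / 4) ^ n"
    unfolding code_err_le_iff[OF avwc]
  proof
    fix s assume s: "s \<in> words n (St ?A)"
    have G0: "real G > 0" "real K > 0" unfolding G using K by auto
    have succ: "1 - (\<Sum>k<K. \<Sum>j\<in>{..<K} - {k}. of_bool (cons (book g j) (out (book g k) s))) / real K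
        \<le> succ_prob ?A n K (e g) (D g) s" if g: "g < G" for g
    proof -
      have "(\<Sum>k<K. 1 - (\<Sum>j\<in>{..<K} - {k}. of_bool (cons (book g j) (out (book g k) s))))
        \<le> (\<Sum>k<K. \<Sum>x\<in>words n (Inp ?A). e g k x * dprob n ?A s x (D g k))"
      proof (rule sum_mono)
        fix k assume k: "k \<in> {..<K}"
        have "(\<Sum>x\<in>words n (Inp ?A). e g k x * dprob n ?A s x (D g k)) = of_bool (out (book g k) s \<in> D g k)"
          using e_sum[OF g, of k] k dprob[OF bookW[OF g] s, of k "D g k"] by (simp add: D_def)
        moreover have "1 - (\<Sum>j\<in>{..<K} - {k}. of_bool (cons (book g j) (out (book g k) s))) \<le> (of_bool (out (book g k) s \<in> D g k) :: real)"
        proof (cases "out (book g k) s \<in> D g k")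
          case True
          then show ?thesis by (simp add: sum_nonneg)
        next
          case False
          have "cons (book g k) (out (book g k) s)"
          proof -
            have "snd (s i) \<in> {0, 1}" if "i < n" for i
              using words_nth[OF s that] by (auto simp: noiseless_def adder_def)
            then show ?thesis unfolding cons_def out_def by fastforce
          qed
          moreover have "out (book g k) s \<in> ?Y" using out bookW g k s by auto
          ultimately obtain j where j: "j < K" "j \<noteq> k" "cons (book g j) (out (book g k) s)"
            using False unfolding D_def by auto
          have "of_bool (cons (book g j) (out (book g k) s)) \<le> (\<Sum>j\<in>{..<K} - {k}. of_bool (cons (book g j) (out (book g k) s)) :: real)"
            using j by (intro member_le_sum) auto
          then show ?thesis using j False by simp
        qed
        ultimately show "1 - (\<Sum>j\<in>{..<K} - {k}. of_bool (cons (book g j) (out (book g k) s)))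
          \<le> (\<Sum>x\<in>words n (Inp ?A). e g k x * dprob n ?A s x (D g k))" by simp
      qed
      then have "(real K - (\<Sum>k<K. \<Sum>j\<in>{..<K} - {k}. of_bool (cons (book g j) (out (book g k) s)))) / real K
         \<le> succ_prob ?A n K (e g) (D g) s"
        unfolding succ_prob_def by (intro divide_right_mono) (simp_all add: sum_subtractf)
      then show ?thesis using G0 by (simp add: diff_divide_distrib)
    qed
    have "(\<Sum>g<G. (\<Sum>k<K. \<Sum>j\<in>{..<K} - {k}. of_bool (cons (book g j) (out (book g k) s)) :: real) / real K)
        = (\<Sum>k<K. \<Sum>j\<in>{..<K} - {k}. \<Sum>g<G. of_bool (cons (book g j) (out (book g k) s))) / real K"
    proof -
      have "(\<Sum>g<G. \<Sum>k<K. \<Sum>j\<in>{..<K} - {k}. of_bool (cons (book g j) (out (book g k) s)) :: real)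
        = (\<Sum>k<K. \<Sum>g<G. \<Sum>j\<in>{..<K} - {k}. of_bool (cons (book g j) (out (book g k) s)))"
        by (rule sum.swap)
      also have "\<dots> = (\<Sum>k<K. \<Sum>j\<in>{..<K} - {k}. \<Sum>g<G. of_bool (cons (book g j) (out (book g k) s)))"
        by (intro sum.cong refl sum.swap)
      finally show ?thesis by (simp only: sum_divide_distrib[symmetric])
    qed
    also have "\<dots> = (\<Sum>k<K. \<Sum>j\<in>{..<K} - {k}. real G * (3 / 4) ^ n) / real K"
      using conf s by (intro arg_cong2[where f = "(/)"] sum.cong refl) auto
    also have "\<dots> = (real K - 1) * (real G * (3 / 4) ^ n)"
      using G0 K by (simp add: card_Diff_singleton of_nat_diff)
    also have "\<dots> \<le> real K * (real G * (3 / 4) ^ n)" by (intro mult_right_mono) auto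
    finally have "real G - real K * (real G * (3 / 4) ^ n)
        \<le> (\<Sum>g<G. 1 - (\<Sum>k<K. \<Sum>j\<in>{..<K} - {k}. of_bool (cons (book g j) (out (book g k) s))) / real K)"
      by (simp only: sum_subtractf sum_constant card_lessThan)
    also have "\<dots> \<le> (\<Sum>g<G. succ_prob ?A n K (e g) (D g) s)" using succ by (intro sum_mono) auto
    finally have "(1 - real K * (3 / 4) ^ n) * real G \<le> (\<Sum>g<G. succ_prob ?A n K (e g) (D g) s)"
      by (simp add: algebra_simps)
    then show "1 - real K * (3 / 4) ^ n \<le> (\<Sum>g<G. succ_prob ?A n K (e g) (D g) s) / real G"
      using G0 by (simp only: pos_le_divide_eq)
  qed
  moreover have "cond_mi ?A n K G e s = 0" for s
  proof -
    have "eve_out ?A n (e g k) s z = (\<Prod>i<n. of_bool (fst (z i) = 0))" if "g < G" "k < K" for g k z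
      unfolding eve_out_def e_sum[OF that] prodch_def emb_def
      by (intro prod.cong refl) (auto simp: joint_def noiseless_def adder_def split: prod.splits)
    then have "mut_inf K (words n (OutE ?A)) (\<lambda>k. eve_out ?A n (e g k) s) = 0" if "g < G" for g
      using that by (intro mut_inf_const[where r = "\<lambda>z. \<Prod>i<n. of_bool (fst (z i) = 0)"]) auto
    then show ?thesis unfolding cond_mi_eq by simp
  qed
  ultimately show ?thesis using code by blast
qed

lemma superact_S_noiseless_adder: "superact_S noiseless adder"
proof -
  let ?A = "joint noiseless adder"
  have avwc: "is_avwc ?A" by (intro is_avwc_joint is_avwc_noiseless is_avwc_adder)
  have "\<forall>n. \<exists>p. is_code ?A n (2 ^ (n div 4)) (fst p) (fst (snd p)) (snd (snd p)) \<and>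
     code_err ?A n (2 ^ (n div 4)) (fst p) (fst (snd p)) (snd (snd p)) \<le> real (2 ^ (n div 4)) * (3 / 4) ^ n \<and>
     (\<forall>s. cond_mi ?A n (2 ^ (n div 4)) (fst p) (fst (snd p)) s = 0)"
    using random_codebook[of "2 ^ (n div 4)" for n] by simp
  then obtain p where p: "\<And>n. is_code ?A n (2 ^ (n div 4)) (fst (p n)) (fst (snd (p n))) (snd (snd (p n)))"
     "\<And>n. code_err ?A n (2 ^ (n div 4)) (fst (p n)) (fst (snd (p n))) (snd (snd (p n))) \<le> real (2 ^ (n div 4)) * (3 / 4) ^ n"
     "\<And>n s. cond_mi ?A n (2 ^ (n div 4)) (fst (p n)) (fst (snd (p n))) s = 0"
    by metis
  have "achievable False ?A (1 / 4)"
  proof (rule achievableI[OF avwc, where h = "\<lambda>_. 0", OF _ p(1)])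
    show "(\<lambda>n. code_err ?A n (2 ^ (n div 4)) (fst (p n)) (fst (snd (p n))) (snd (snd (p n)))) \<longlonglongrightarrow> 0"
    proof (rule tendsto_sandwich[OF _ _ tendsto_const])
      show "\<forall>\<^sub>F n in sequentially. 0 \<le> code_err ?A n (2 ^ (n div 4)) (fst (p n)) (fst (snd (p n))) (snd (snd (p n)))"
        using code_err_nonneg[OF avwc p(1)] by simp
      have "2 powr (real n / 4) * (3 / 4) ^ n = (81 / 128 :: real) powr (real n / 4)" for n
      proof -
        have "(3 / 4 :: real) ^ n = ((3 / 4) powr 4) powr (real n / 4)"
          by (simp only: powr_powr) (simp add: powr_realpow)
        also have "(3 / 4 :: real) powr 4 = 81 / 256" by (simp add: power_divide)
        finally show ?thesis by (simp flip: powr_mult)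
      qed
      moreover have "(\<lambda>n. (81 / 128 :: real) powr (real n / 4)) \<longlonglongrightarrow> 0" by real_asymp
      ultimately show "(\<lambda>n. 2 powr (real n / 4) * (3 / 4) ^ n :: real) \<longlonglongrightarrow> 0" by simp
      have "real (2 ^ (n div 4)) \<le> 2 powr (real n / 4)" for n
      proof -
        have "real (2 ^ (n div 4)) = 2 powr real (n div 4)" by (simp add: powr_realpow)
        also have "\<dots> \<le> 2 powr (real n / 4)" by (intro powr_mono) linarith+
        finally show ?thesis .
      qed
      then have "real (2 ^ (n div 4)) * (3 / 4) ^ n \<le> 2 powr (real n / 4) * (3 / 4) ^ n" for n
        by (intro mult_right_mono) auto
      then show "\<forall>\<^sub>F n in sequentially. code_err ?A n (2 ^ (n div 4)) (fst (p n)) (fst (snd (p n))) (snd (snd (p n)))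
          \<le> 2 powr (real n / 4) * (3 / 4) ^ n"
        using p(2) by (intro always_eventually allI) (rule order_trans)
    qed
    have "(\<lambda>n. real_of_int \<lfloor>real n / 4\<rfloor> / real n) \<longlonglongrightarrow> 1 / 4" by real_asymp
    moreover have "log 2 (real (2 ^ (n div 4))) = real_of_int \<lfloor>real n / 4\<rfloor>" for n
      using floor_divide_of_nat_eq[of n 4, where 'a = real] by (simp add: log_nat_power)
    ultimately have "(\<lambda>n. ereal (log 2 (real (2 ^ (n div 4))) / real n)) \<longlonglongrightarrow> ereal (1 / 4)" by simp
    then show "liminf (\<lambda>n. ereal (log 2 (real (2 ^ (n div 4))) / real n)) = ereal (1 / 4)"
      by (intro lim_imp_Liminf) auto
  qed (use p(3) in auto)
  then have "ereal (1 / 4) \<le> C_mean_ran ?A" unfolding C_mean_ran_def by (intro Sup_upper) auto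
  moreover have "C_S ?A = C_mean_ran ?A"
    using symmetrizable_joint[OF is_avwc_noiseless is_avwc_adder] not_symmetrizable_noiseless
    by (intro not_symmetrizable_C_S[OF avwc]) auto
  moreover have "(0 :: ereal) < ereal (1 / 4)" by simp
  ultimately have "0 < C_S ?A" by (metis order_less_le_trans)
  moreover have "C_S noiseless = 0"
    by (rule C_S_same_output[OF is_avwc_noiseless]) (auto simp: noiseless_def)
  moreover have "C_S adder = 0" by (rule symmetrizable_C_S[OF is_avwc_adder symmetrizable_adder])
  ultimately show ?thesis unfolding superact_S_def by blast
qed

theorem theorem5:
  fixes A1 :: "('s1, 'x1, 'y1, 'z1) avwc" and A2 :: "('s2, 'x2, 'y2, 'z2) avwc"
  assumes "is_avwc A1" and "is_avwc A2"
  shows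
    "((C_S A1 = 0 \<and> C_S A2 = 0) \<longrightarrow>
        (C_S (joint A1 A2) > 0 \<longleftrightarrow>
           \<not> symmetrizable (joint A1 A2) \<and> C_mean_ran (joint A1 A2) > 0)) \<and>
     (superact_S A1 A2 \<longrightarrow> C_S (joint A1 A2) = C_mean_ran (joint A1 A2)) \<and>
     (\<exists>(B1 :: (nat, nat, nat, nat) avwc) (B2 :: (nat, nat, nat, nat) avwc).
        is_avwc B1 \<and> is_avwc B2 \<and> superact_S B1 B2) \<and>
     (superact_mean A1 A2 \<longrightarrow>
        (superact_S A1 A2 \<longleftrightarrow> \<not> symmetrizable A1 \<or> \<not> symmetrizable A2)) \<and>
     (\<not> superact_mean A1 A2 \<longrightarrow> superact_S A1 A2 \<longrightarrow>
        ((\<not> symmetrizable A1 \<and> symmetrizable A2 \<and> C_mean_ran A1 = 0 \<and> C_mean_ran A2 > 0) \<or>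
         (\<not> symmetrizable A2 \<and> symmetrizable A1 \<and> C_mean_ran A2 = 0 \<and> C_mean_ran A1 > 0)))"
proof -
  have J: "is_avwc (joint A1 A2)" by (rule is_avwc_joint[OF assms])
  have dich: "\<And>A :: ('s1, 'x1, 'y1, 'z1) avwc. is_avwc A \<Longrightarrow> C_S A = (if symmetrizable A then 0 else C_mean_ran A)"
    "\<And>A :: ('s2, 'x2, 'y2, 'z2) avwc. is_avwc A \<Longrightarrow> C_S A = (if symmetrizable A then 0 else C_mean_ran A)"
    "C_S (joint A1 A2) = (if symmetrizable (joint A1 A2) then 0 else C_mean_ran (joint A1 A2))"
    using symmetrizable_C_S not_symmetrizable_C_S J by auto
  have le: "0 \<le> C_mean_ran A1" "0 \<le> C_mean_ran A2"
    using C_S_nonneg C_S_le_C_mean_ran assms by (blast intro: order_trans)+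
  have 1: "C_S (joint A1 A2) > 0 \<longleftrightarrow> \<not> symmetrizable (joint A1 A2) \<and> C_mean_ran (joint A1 A2) > 0"
    unfolding dich(3) by simp
  have zero: "C_S A1 = 0" "C_S A2 = 0" if "superact_mean A1 A2"
    using that unfolding dich(1)[OF assms(1)] dich(2)[OF assms(2)] superact_mean_def by auto
  have "superact_S A1 A2 \<longrightarrow> C_S (joint A1 A2) = C_mean_ran (joint A1 A2)"
    unfolding superact_S_def dich(3) by simp
  moreover have "\<exists>(B1 :: (nat, nat, nat, nat) avwc) (B2 :: (nat, nat, nat, nat) avwc).
        is_avwc B1 \<and> is_avwc B2 \<and> superact_S B1 B2"
    using is_avwc_noiseless is_avwc_adder superact_S_noiseless_adder by blast
  moreover have "superact_mean A1 A2 \<longrightarrow>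
        (superact_S A1 A2 \<longleftrightarrow> \<not> symmetrizable A1 \<or> \<not> symmetrizable A2)"
    using zero 1 symmetrizable_joint[OF assms] unfolding superact_S_def superact_mean_def by auto
  moreover have "(\<not> symmetrizable A1 \<and> symmetrizable A2 \<and> C_mean_ran A1 = 0 \<and> C_mean_ran A2 > 0) \<or>
         (\<not> symmetrizable A2 \<and> symmetrizable A1 \<and> C_mean_ran A2 = 0 \<and> C_mean_ran A1 > 0)"
    if nm: "\<not> superact_mean A1 A2" and S: "superact_S A1 A2"
  proof -
    have j: "\<not> symmetrizable A1 \<or> \<not> symmetrizable A2" "C_mean_ran (joint A1 A2) > 0"
      using S 1 symmetrizable_joint[OF assms] unfolding superact_S_def by auto
    have "\<not> symmetrizable A1 \<Longrightarrow> C_mean_ran A1 = 0" "\<not> symmetrizable A2 \<Longrightarrow> C_mean_ran A2 = 0"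
      using S dich(1)[OF assms(1)] dich(2)[OF assms(2)] unfolding superact_S_def by auto
    moreover have "C_mean_ran A1 \<noteq> 0 \<or> C_mean_ran A2 \<noteq> 0"
      using nm j(2) unfolding superact_mean_def by blast
    ultimately show ?thesis using j(1) le by (metis order_le_neq_trans)
  qed
  ultimately show ?thesis using 1 by blast
qed

end
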